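(* Let $B_R\subset\mathbb{R}^2$ be the disc with radius $R$ centred at the origin. The non-radial eigenvalues $\tau_{m,n}$ of $\mathcal{L}$ on $B_R$ are given by $$\tau_{m,n}(B_R)=\frac{R^2}{j_{m-1,n}^2},\qquad m,n\in\mathbb{N},$$ where $j_{m,n}$ denotes the $n$-th positive zero of the Bessel function $J_m$. The corresponding eigenfunctions (up to a constant multiple) are given by $$u_{m,n}(x)=u_{m,n}(r,\theta)=J_m\!\left(\frac{j_{m-1,n}}{R}r\right)\cos(m\theta),\qquad m,n\in\mathbb{N},$$ and $$v_{m,n}(x)=v_{m,n}(r,\theta)=J_m\!\left(\frac{j_{m-1,n}}{R}r\right)\sin(m\theta),\qquad m,n\in\mathbb{N},$$ where $(r,\theta)$ are the polar coordinates of $x$.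
   Context: For a bounded open set $\Omega\subset\mathbb{R}^2$, the Logarithmic potential operator $\mathcal{L}$ on $L^2(\Omega)$ is the self-adjoint compact operator $\mathcal{L}u(x)=\frac{1}{2\pi}\int_\Omega \log\frac{1}{|x-y|}\,u(y)\,dy$. An eigenvalue of $\mathcal{L}$ on $B_R$ is called radial if there is a radial eigenfunction corresponding to it, and non-radial if there is a non-radial eigenfunction corresponding to it; an eigenvalue can be both radial and non-radial. For an integer $k\ge 0$, $J_k(x)=\sum_{l=0}^\infty\frac{(-1)^l}{l!\,(k+l)!}\left(\frac x2\right)^{2l+k}$ is the Bessel function of order $k$. $\mathbb{N}=\{1,2,\dots\}$. *)

theory Defs
  imports "HOL-Analysis.Analysis"
begin

text \<open>Elements of \<open>L\<^sup>2(\<Omega>)\<close> are represented by functions on the whole plane that are square integrable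
  for Lebesgue measure restricted to \<open>\<Omega>\<close>; equality in \<open>L\<^sup>2(\<Omega>)\<close> is equality almost everywhere
  on \<open>\<Omega>\<close>. The operator is self-adjoint, so real-valued functions and real eigenvalues suffice.\<close>

definition L2_fun :: "(real^2) set \<Rightarrow> (real^2 \<Rightarrow> real) \<Rightarrow> bool" where
  "L2_fun \<Omega> f \<longleftrightarrow> f \<in> borel_measurable (lebesgue_on \<Omega>) \<and> integrable (lebesgue_on \<Omega>) (\<lambda>x. (f x)\<^sup>2)"

text \<open>In the integrand, \<open>ln (1 / 0) = 0\<close> at the single point \<open>y = x\<close>, a null set.\<close>

definition log_potential :: "(real^2) set \<Rightarrow> (real^2 \<Rightarrow> real) \<Rightarrow> real^2 \<Rightarrow> real" where
  "log_potential \<Omega> f x = 1 / (2 * pi) * (LINT y|lebesgue_on \<Omega>. ln (1 / norm (x - y)) * f y)"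

definition in_eigenspace :: "(real^2) set \<Rightarrow> real \<Rightarrow> (real^2 \<Rightarrow> real) \<Rightarrow> bool" where
  "in_eigenspace \<Omega> \<tau> f \<longleftrightarrow> L2_fun \<Omega> f \<and> (AE x in lebesgue_on \<Omega>. log_potential \<Omega> f x = \<tau> * f x)"

definition eigenfunction :: "(real^2) set \<Rightarrow> real \<Rightarrow> (real^2 \<Rightarrow> real) \<Rightarrow> bool" where
  "eigenfunction \<Omega> \<tau> f \<longleftrightarrow> in_eigenspace \<Omega> \<tau> f \<and> \<not> (AE x in lebesgue_on \<Omega>. f x = 0)"

definition radial :: "(real^2) set \<Rightarrow> (real^2 \<Rightarrow> real) \<Rightarrow> bool" where
  "radial \<Omega> f \<longleftrightarrow> (\<exists>\<phi>. AE x in lebesgue_on \<Omega>. f x = \<phi> (norm x))"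

definition nonradial_eigenfunction :: "(real^2) set \<Rightarrow> real \<Rightarrow> (real^2 \<Rightarrow> real) \<Rightarrow> bool" where
  "nonradial_eigenfunction \<Omega> \<tau> f \<longleftrightarrow> eigenfunction \<Omega> \<tau> f \<and> \<not> radial \<Omega> f"

definition nonradial_eigenvalue :: "(real^2) set \<Rightarrow> real \<Rightarrow> bool" where
  "nonradial_eigenvalue \<Omega> \<tau> \<longleftrightarrow> (\<exists>f. nonradial_eigenfunction \<Omega> \<tau> f)"

definition bessel_J :: "nat \<Rightarrow> real \<Rightarrow> real" where
  "bessel_J k x = (\<Sum>l. (-1) ^ l / (fact l * fact (k + l)) * (x / 2) ^ (2 * l + k))"

text \<open>The \<open>n\<close>-th positive zero, for \<open>n \<ge> 1\<close>: the positive zero \<open>x\<close> such that exactly \<open>n\<close> positive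
  zeros are at most \<open>x\<close>. For \<open>n = 0\<close> the description is not satisfiable by a locally finite
  zero set, and the value is irrelevant.\<close>

definition bessel_zero :: "nat \<Rightarrow> nat \<Rightarrow> real" where
  "bessel_zero k n = (THE x. 0 < x \<and> bessel_J k x = 0 \<and>
     card {y. 0 < y \<and> y \<le> x \<and> bessel_J k y = 0} = n)"

text \<open>The polar angle is the principal argument of \<open>x\<^sub>1 + i x\<^sub>2\<close>; its normalisation does not matter
  for \<open>cos (m \<theta>)\<close> and \<open>sin (m \<theta>)\<close> with \<open>m\<close> a natural number.\<close>

definition polar_angle :: "real^2 \<Rightarrow> real" where
  "polar_angle x = Arg (Complex (x $ 1) (x $ 2))"

definition tau :: "real \<Rightarrow> nat \<Rightarrow> nat \<Rightarrow> real" where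
  "tau R m n = R\<^sup>2 / (bessel_zero (m - 1) n)\<^sup>2"

definition u_fun :: "real \<Rightarrow> nat \<Rightarrow> nat \<Rightarrow> real^2 \<Rightarrow> real" where
  "u_fun R m n x = bessel_J m (bessel_zero (m - 1) n / R * norm x) * cos (real m * polar_angle x)"

definition v_fun :: "real \<Rightarrow> nat \<Rightarrow> nat \<Rightarrow> real^2 \<Rightarrow> real" where
  "v_fun R m n x = bessel_J m (bessel_zero (m - 1) n / R * norm x) * sin (real m * polar_angle x)"

end

theory Submission
  imports Defs "HOL-Probability.Conditional_Expectation"
begin

text \<open>
  Identify the plane with the complex numbers. For \<open>m \<ge> 1\<close> the potential of \<open>z^m |z|^(2l)\<close> on the disc
  is again elementary,
    \<open>L (z^m |z|^(2l)) = z^m (R^(2l+2) / (4m(l+1)) - |z|^(2l+2) / (4(l+1)(m+l+1)))\<close>,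
  so the operator acts on the angular frequency \<open>m\<close> by shifting the power of \<open>|z|^2\<close>, up to a boundary
  term that is a multiple of \<open>z^m\<close>. This formula (\<open>integral_log_kernel_monomial\<close>) is obtained by expanding
  the logarithm in powers of \<open>y / x\<close> or \<open>x / y\<close> and integrating term by term: the invariance of
  Lebesgue measure under rotations kills every term but one.

  Summing it along the power series of \<open>J_m (k |z|)\<close>, the shifts reproduce the series divided by \<open>k^2\<close>, and
  the boundary terms add up to a multiple of \<open>J_{m-1} (k R) z^m\<close>. Hence \<open>J_m (k |z|) cos (m \<theta>)\<close> and
  \<open>J_m (k |z|) sin (m \<theta>)\<close> are eigenfunctions with eigenvalue \<open>1 / k^2\<close> as soon as \<open>k R\<close> is a zero of
  \<open>J_{m-1}\<close> (\<open>integral_log_kernel_bessel_mode\<close>).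

  Conversely, let \<open>f\<close> be an eigenfunction for \<open>\<tau>\<close>, and let \<open>M l\<close> be the integral of \<open>f\<close> against
  \<open>z^m |z|^(2l)\<close>. As the kernel is symmetric, the formula above turns into a recurrence that expresses
  \<open>M (l+1)\<close> through \<open>M l\<close> and \<open>M 0\<close> (\<open>moment_recurrence\<close>). So \<open>M 0 = 0\<close> forces all \<open>M l\<close> to vanish. If
  \<open>M 0 \<noteq> 0\<close>, weighting the recurrence with the coefficients of the Bessel series makes it telescope, and
  the bound \<open>M l = O(R^(2l))\<close> leaves exactly \<open>J_{m-1} (R / sqrt \<tau>) = 0\<close> (\<open>nonzero_moment_clifford\<close>).

  It remains to pass from moments to functions. Polynomials in \<open>z\<close> and its conjugate are dense, so an
  integrable function whose moments against all of them vanish is zero almost everywhere; applied to the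
  difference of \<open>f\<close> and its conditional expectation given \<open>|z|\<close>, this shows that \<open>f\<close> is radial when all
  its moments of frequency \<open>m \<ge> 1\<close> vanish (\<open>radial_if_moments_zero\<close>). Only finitely many frequencies \<open>m\<close>
  have \<open>M 0 \<noteq> 0\<close>, and for each of them a combination of the two explicit eigenfunctions cancels \<open>M 0\<close>
  (\<open>eigenspace_decomposition\<close>); what is left of \<open>f\<close> is radial.

  The \<open>n\<close>-th positive zero of \<open>J_k\<close> is meaningful because the positive zeros are infinite in number and
  locally finite. Both facts are reduced by Rolle's theorem, in opposite directions along the chain
  \<open>A_k' = - A_{k+1}\<close>, where \<open>J_k (x) = (x/2)^k A_k (x^2/4)\<close>, to the oscillation of \<open>J_0\<close> and to the absence of zeros in a fixed interval for large \<open>k\<close>.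
\<close>

section \<open>The Bessel zeros\<close>

text \<open>The Bessel-Clifford function at \<open>- t\<close>. Since \<open>J_k (x) = (x/2)^k A_k (x^2/4)\<close>, it carries all
  information about positive zeros, is entire in \<open>t\<close>, and differentiation raises the index up to a sign.\<close>

definition clifford :: "nat \<Rightarrow> real \<Rightarrow> real" where
  "clifford k t = (\<Sum>j. (-1) ^ j / (fact j * fact (k + j)) * t ^ j)"

lemma summable_clifford_abs: "summable (\<lambda>j. \<bar>(-1) ^ j / (fact j * fact (k + j)) * (t::real) ^ j\<bar>)"
proof (rule summable_comparison_test'[where g = "\<lambda>j. inverse (fact j) * \<bar>t\<bar> ^ j" and N = 0])
  show "summable (\<lambda>j. inverse (fact j) * \<bar>t\<bar> ^ j)"
    by (rule summable_exp)
  fix j :: nat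
  have "1 \<le> (fact (k + j) :: real)"
    by simp
  then show "norm \<bar>(-1) ^ j / (fact j * fact (k + j)) * t ^ j\<bar> \<le> inverse (fact j) * \<bar>t\<bar> ^ j"
    using mult_right_mono[of 1 "fact (k + j)" "\<bar>t\<bar> ^ j"]
    by (simp add: abs_mult power_abs field_simps)
qed

lemma summable_clifford: "summable (\<lambda>j. (-1) ^ j / (fact j * fact (k + j)) * (t::real) ^ j)"
  using summable_clifford_abs by (rule summable_rabs_cancel)

lemma clifford_sums: "(\<lambda>j. (-1) ^ j / (fact j * fact (k + j)) * t ^ j) sums clifford k t"
  unfolding clifford_def using summable_clifford by (rule summable_sums)

lemma bessel_J_eq_clifford: "bessel_J k x = (x / 2) ^ k * clifford k (x\<^sup>2 / 4)"
proof -
  have "(\<lambda>l. (x / 2) ^ k * ((-1) ^ l / (fact l * fact (k + l)) * (x\<^sup>2 / 4) ^ l)) sums ((x / 2) ^ k * clifford k (x\<^sup>2 / 4))"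
    by (intro sums_mult clifford_sums)
  moreover have "(x / 2) ^ k * ((-1) ^ l / (fact l * fact (k + l)) * (x\<^sup>2 / 4) ^ l)
      = (-1) ^ l / (fact l * fact (k + l)) * (x / 2) ^ (2 * l + k)" for l
  proof -
    have "x\<^sup>2 / 4 = (x / 2)\<^sup>2"
      by (simp add: power_divide)
    then show ?thesis
      by (simp only: power_add power_mult[symmetric] mult_ac)
  qed
  ultimately have "(\<lambda>l. (-1) ^ l / (fact l * fact (k + l)) * (x / 2) ^ (2 * l + k)) sums ((x / 2) ^ k * clifford k (x\<^sup>2 / 4))"
    by (simp only:)
  then show ?thesis
    unfolding bessel_J_def by (rule sums_unique[symmetric])
qed

lemma clifford_deriv: "(clifford k has_real_derivative - clifford (Suc k) t) (at t)"
proof -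
  let ?c = "\<lambda>j. (-1) ^ j / (fact j * fact (k + j)) :: real"
  have "((\<lambda>t. \<Sum>j. ?c j * t ^ j) has_real_derivative (\<Sum>j. diffs ?c j * t ^ j)) (at t)"
    by (rule termdiffs_strong_converges_everywhere) (rule summable_clifford)
  moreover have "diffs ?c j * t ^ j = - ((-1) ^ j / (fact j * fact (Suc k + j)) * t ^ j)" for j
  proof -
    have f: "fact (Suc j) = real (Suc j) * fact j" "k + Suc j = Suc k + j"
      by simp_all
    show ?thesis
      unfolding diffs_def f by (simp add: divide_simps del: of_nat_Suc fact_Suc)
  qed
  then have "(\<Sum>j. diffs ?c j * t ^ j) = - clifford (Suc k) t"
    using sums_minus[OF clifford_sums[of "Suc k" t]] by (simp add: sums_iff)
  moreover have "clifford k = (\<lambda>t. \<Sum>j. ?c j * t ^ j)"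
    by (rule ext) (rule clifford_def)
  ultimately show ?thesis
    by simp
qed

lemmas clifford_deriv' [derivative_intros] = DERIV_chain2[OF clifford_deriv]

lemma continuous_on_clifford [continuous_intros]:
  "continuous_on S f \<Longrightarrow> continuous_on S (\<lambda>x. clifford k (f x))"
  by (rule continuous_on_compose2[where t = UNIV])
    (auto intro!: continuous_at_imp_continuous_on DERIV_isCont clifford_deriv)

text \<open>The three-term recurrence of the Bessel functions. With \<open>A_k' = - A_{k+1}\<close> it is the
  differential equation \<open>(t A_0')' = - A_0\<close> for \<open>k = 0\<close>.\<close>

lemma clifford_recurrence:
  "clifford k t + t * clifford (k + 2) t = (real k + 1) * clifford (k + 1) t"
proof -
  let ?c = "\<lambda>k j. (-1) ^ j / (fact j * fact (k + j)) * t ^ j"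
  have 2: "(\<lambda>j. if j = 0 then 0 else t * ?c (k + 2) (j - 1)) sums (t * clifford (k + 2) t)"
    using sums_mult[OF clifford_sums[of "k + 2" t], of t]
      sums_Suc_iff[of "\<lambda>j. if j = 0 then 0 else t * ?c (k + 2) (j - 1)" "t * clifford (k + 2) t"] by simp
  have "(\<lambda>j. ?c k j + (if j = 0 then 0 else t * ?c (k + 2) (j - 1))) sums (clifford k t + t * clifford (k + 2) t)"
    by (intro sums_add clifford_sums 2)
  moreover have "?c k j + (if j = 0 then 0 else t * ?c (k + 2) (j - 1)) = (real k + 1) * ?c (k + 1) j" for j
    by (cases j) (simp_all add: divide_simps, simp_all add: algebra_simps)
  ultimately have "(\<lambda>j. (real k + 1) * ?c (k + 1) j) sums (clifford k t + t * clifford (k + 2) t)"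
    by simp
  moreover have "(\<lambda>j. (real k + 1) * ?c (k + 1) j) sums ((real k + 1) * clifford (k + 1) t)"
    by (intro sums_mult clifford_sums)
  ultimately show ?thesis
    by (rule sums_unique2)
qed

text \<open>At non-positive arguments the series has no cancellation (it is that of a modified Bessel
  function); this excludes negative eigenvalues.\<close>

lemma clifford_pos_nonpos:
  assumes "t \<le> 0"
  shows "clifford k t > 0"
proof -
  have eq: "(-1) ^ j / (fact j * fact (k + j)) * t ^ j = (- t) ^ j / (fact j * fact (k + j))" for j
    by (simp add: power_minus[of t])
  have "0 < (\<Sum>j. (-1) ^ j / (fact j * fact (k + j)) * t ^ j)"
    by (rule suminf_pos2[OF summable_clifford, of _ _ 0]) (unfold eq, use assms in simp_all)
  then show ?thesis
    by (simp add: clifford_def)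
qed

text \<open>Beyond the constant term \<open>1 / k!\<close> the series is at most \<open>(e^t - 1) / (k! (k + 1))\<close>, too small to
  produce a zero when \<open>k\<close> is large compared with \<open>e^t\<close>.\<close>

lemma clifford_pos_large:
  assumes "0 \<le> t" "t \<le> X" "exp X \<le> real k + 1"
  shows "clifford k t > 0"
proof -
  let ?c = "\<lambda>j. (-1) ^ j / (fact j * fact (k + j)) * t ^ j"
  have s: "(\<lambda>j. ?c (Suc j)) sums (clifford k t - 1 / fact k)"
    using clifford_sums[of k t] by (subst sums_Suc_iff) simp
  have e: "(\<lambda>j. inverse (fact (Suc j)) * t ^ Suc j) sums (exp t - 1)"
    using exp_converges[of t] by (subst sums_Suc_iff) (simp add: scaleR_conv_of_real)
  have fk: "fact k * (real k + 1) \<le> (fact (k + Suc j) :: real)" for j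
  proof -
    have "(fact (k + 1) :: real) \<le> fact (k + Suc j)"
      by (rule fact_mono) simp
    then show ?thesis by (simp add: algebra_simps)
  qed
  have b: "norm (?c (Suc j)) \<le> inverse (fact k * (real k + 1)) * (inverse (fact (Suc j)) * t ^ Suc j)" for j
  proof -
    have "norm (?c (Suc j)) = inverse (fact (k + Suc j)) * (inverse (fact (Suc j)) * t ^ Suc j)"
      using assms(1) by (simp add: abs_mult field_simps)
    also have "\<dots> \<le> inverse (fact k * (real k + 1)) * (inverse (fact (Suc j)) * t ^ Suc j)"
      using assms(1) fk[of j] by (intro mult_right_mono le_imp_inverse_le) (auto intro!: mult_nonneg_nonneg)
    finally show ?thesis .
  qed
  have "\<bar>clifford k t - 1 / fact k\<bar> \<le> inverse (fact k * (real k + 1)) * (exp t - 1)"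
  proof -
    note e' = sums_mult[OF e, of "inverse (fact k * (real k + 1))"]
    have "norm (\<Sum>j. ?c (Suc j)) \<le> (\<Sum>j. inverse (fact k * (real k + 1)) * (inverse (fact (Suc j)) * t ^ Suc j))"
      by (rule norm_suminf_le[OF b sums_summable[OF e']])
    then show ?thesis
      unfolding sums_unique[OF s, symmetric] sums_unique[OF e', symmetric] by simp
  qed
  also have "\<dots> < inverse (fact k * (real k + 1)) * (real k + 1)"
  proof (intro mult_strict_left_mono)
    have "exp t \<le> exp X" using assms by simp
    then show "exp t - 1 < real k + 1" using assms(3) by linarith
  qed simp
  also have "\<dots> = 1 / fact k"
    by (simp add: inverse_eq_divide)
  finally show ?thesis
    by linarith
qed

text \<open>The equation \<open>(t f')' = - f\<close> with flux \<open>g = t f'\<close>. If \<open>f\<close> stays positive, the flux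
  decreases. Once the flux is negative, \<open>f\<close> drops below a decreasing logarithm; if it never becomes
  negative, \<open>f\<close> is bounded below by a positive constant, and then the flux decreases linearly.\<close>

lemma no_positive_solution:
  fixes f g :: "real \<Rightarrow> real"
  assumes "c > 0"
    and f: "\<And>t. t \<ge> c \<Longrightarrow> (f has_real_derivative g t / t) (at t)"
    and g: "\<And>t. t \<ge> c \<Longrightarrow> (g has_real_derivative - f t) (at t)"
    and pos: "\<And>t. t \<ge> c \<Longrightarrow> f t > 0"
  shows False
proof (cases "\<exists>d\<ge>c. g d < 0")
  case True
  then obtain d where d: "d \<ge> c" "g d < 0" by blast
  have gd: "g t \<le> g d" if "t \<ge> d" for t
  proof (rule DERIV_nonpos_imp_nonincreasing[OF that])
    fix x assume "d \<le> x" "x \<le> t"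
    then have "x \<ge> c" using d by simp
    then show "\<exists>y. (g has_real_derivative y) (at x) \<and> y \<le> 0"
      using g[of x] pos[of x] by (intro exI[of _ "- f x"]) simp
  qed
  \<comment> \<open>The point where the bound \<open>f d + g d * ln (t / d)\<close> on \<open>f\<close> reaches zero.\<close>
  define e where "e = d * exp (f d / - g d)"
  have "f d / - g d > 0"
    using d pos by (simp add: divide_pos_neg)
  then have e: "e > d"
    using d assms(1) by (auto simp: e_def)
  have "f e - g d * ln e \<le> f d - g d * ln d"
  proof (rule DERIV_nonpos_imp_nonincreasing[of d e "\<lambda>t. f t - g d * ln t"])
    fix t assume t: "d \<le> t" "t \<le> e"
    then have tp: "t > 0" "t \<ge> c" using d assms(1) by auto
    have "((\<lambda>t. f t - g d * ln t) has_real_derivative (g t / t - g d / t)) (at t)"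
      using tp by (auto intro!: derivative_eq_intros f simp: field_simps)
    moreover have "g t / t - g d / t \<le> 0"
      using gd[of t] t tp by (simp add: divide_right_mono)
    ultimately show "\<exists>y. ((\<lambda>t. f t - g d * ln t) has_real_derivative y) (at t) \<and> y \<le> 0"
      by blast
  qed (use e in simp)
  moreover have "ln e = ln d + f d / - g d"
    using d assms(1) by (simp add: e_def ln_mult)
  then have "g d * ln e = g d * ln d - f d"
    using d by (simp add: field_simps)
  ultimately have "f e \<le> 0"
    by linarith
  then show False
    using pos[of e] e d by simp
next
  case False
  then have gp: "g t \<ge> 0" if "t \<ge> c" for t
    using that by (meson linorder_not_le)
  have fc: "f c \<le> f t" if "t \<ge> c" for t
  proof (rule DERIV_nonneg_imp_nondecreasing[OF that])
    fix x assume "c \<le> x" "x \<le> t"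
    then show "\<exists>y. (f has_real_derivative y) (at x) \<and> 0 \<le> y"
      using f[of x] gp[of x] assms(1) by (intro exI[of _ "g x / x"]) simp
  qed
  \<comment> \<open>The point where the bound \<open>g c - f c * (t - c)\<close> on the flux reaches \<open>- 1\<close>.\<close>
  define e where "e = c + (g c + 1) / f c"
  have fcp: "f c > 0" using pos by simp
  have e: "e \<ge> c"
    using gp[of c] fcp by (simp add: e_def)
  have "g e + f c * e \<le> g c + f c * c"
  proof (rule DERIV_nonpos_imp_nonincreasing[OF e, of "\<lambda>t. g t + f c * t"])
    fix t assume t: "c \<le> t" "t \<le> e"
    have "((\<lambda>t. g t + f c * t) has_real_derivative (- f t + f c)) (at t)"
      using t by (auto intro!: derivative_eq_intros g)
    then show "\<exists>y. ((\<lambda>t. g t + f c * t) has_real_derivative y) (at t) \<and> y \<le> 0"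
      using fc[of t] t by force
  qed
  moreover have "f c * e = f c * c + g c + 1"
    using fcp by (simp add: e_def field_simps)
  ultimately have "g e < 0"
    by linarith
  then show False
    using gp[OF e] by simp
qed

text \<open>Without a zero beyond \<open>c\<close>, either \<open>A_0\<close> or \<open>- A_0\<close> would be a positive solution there.\<close>

lemma clifford_0_zero_beyond:
  assumes "c > 0"
  shows "\<exists>t\<ge>c. clifford 0 t = 0"
proof (rule ccontr)
  assume "\<not> ?thesis"
  then have nz: "clifford 0 t \<noteq> 0" if "t \<ge> c" for t
    using that by blast
  have same: "sgn (clifford 0 t) = sgn (clifford 0 c)" if t: "t \<ge> c" for t
  proof (rule ccontr)
    assume "sgn (clifford 0 t) \<noteq> sgn (clifford 0 c)"
    then have "clifford 0 t < 0 \<and> 0 < clifford 0 c \<or> clifford 0 c < 0 \<and> 0 < clifford 0 t"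
      using nz[OF t] nz[of c] by (auto simp: sgn_if split: if_splits)
    moreover have "continuous_on {c..t} (clifford 0)"
      using continuous_on_clifford[OF continuous_on_id] by simp
    ultimately have "\<exists>x. c \<le> x \<and> x \<le> t \<and> clifford 0 x = 0"
    proof (elim disjE conjE)
      assume "continuous_on {c..t} (clifford 0)" "clifford 0 t < 0" "0 < clifford 0 c"
      then show ?thesis
        using t by (intro IVT2') simp_all
    next
      assume "continuous_on {c..t} (clifford 0)" "clifford 0 c < 0" "0 < clifford 0 t"
      then show ?thesis
        using t by (intro IVT') simp_all
    qed
    then show False using nz by blast
  qed
  define s where "s = sgn (clifford 0 c)"
  have "s = 1 \<or> s = -1"
    using nz[of c] by (auto simp: s_def sgn_if)
  show False
  proof (rule no_positive_solution[OF assms, of "\<lambda>t. s * clifford 0 t" "\<lambda>t. s * (- t * clifford 1 t)"])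
    fix t assume t: "t \<ge> c"
    show "((\<lambda>t. s * clifford 0 t) has_real_derivative s * (- t * clifford 1 t) / t) (at t)"
      using t assms by (auto intro!: derivative_eq_intros)
    have "s * (- 1 * clifford 1 t + t * clifford 2 t) = - (s * clifford 0 t)"
      using arg_cong[OF clifford_recurrence[of 0 t], of "\<lambda>u. s * u"]
      by (simp add: algebra_simps numeral_2_eq_2[symmetric])
    then show "((\<lambda>t. s * (- t * clifford 1 t)) has_real_derivative - (s * clifford 0 t)) (at t)"
      by (auto intro!: derivative_eq_intros simp: numeral_2_eq_2[symmetric] algebra_simps)
    show "0 < s * clifford 0 t"
      using same[OF t] \<open>s = 1 \<or> s = -1\<close> by (auto simp: s_def sgn_if split: if_splits)
  qed
qed

text \<open>By Rolle's theorem, distinct zeros of \<open>f\<close> have different sets of zeros of \<open>f'\<close> to their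
  left, so there are at most as many zeros of \<open>f\<close> as subsets of the zeros of \<open>f'\<close>.\<close>

lemma finite_zeros_if_finite_zeros_deriv:
  fixes f f' :: "real \<Rightarrow> real"
  assumes I: "is_interval I"
    and f: "\<And>x. x \<in> I \<Longrightarrow> (f has_real_derivative f' x) (at x)"
    and fin: "finite {x\<in>I. f' x = 0}"
  shows "finite {x\<in>I. f x = 0}"
proof -
  define W where "W = {x\<in>I. f' x = 0}"
  have lt: "\<exists>w\<in>W. x < w \<and> w < y" if "x \<in> I" "y \<in> I" "f x = 0" "f y = 0" "x < y" for x y
  proof -
    have sub: "{x..y} \<subseteq> I"
      using mem_is_interval_1_I[OF I \<open>x \<in> I\<close> \<open>y \<in> I\<close>] by (simp add: subset_iff)
    have "\<exists>z>x. z < y \<and> (f has_real_derivative 0) (at z)"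
    proof (rule Rolle)
      show "continuous_on {x..y} f"
        using sub f by (auto intro!: continuous_at_imp_continuous_on DERIV_isCont)
      show "f differentiable at z" if "x < z" "z < y" for z
      proof -
        have "z \<in> I" using sub that by auto
        then show ?thesis using f real_differentiable_def by blast
      qed
    qed (use that in auto)
    then obtain z where z: "x < z" "z < y" "(f has_real_derivative 0) (at z)" by blast
    then have "z \<in> I" using sub by auto
    then have "f' z = 0" using z f DERIV_unique by blast
    then show ?thesis using z \<open>z \<in> I\<close> by (auto simp: W_def)
  qed
  have "inj_on (\<lambda>x. {w\<in>W. w < x}) {x\<in>I. f x = 0}"
  proof (rule linorder_inj_onI')
    fix x y assume xy: "x \<in> {x\<in>I. f x = 0}" "y \<in> {x\<in>I. f x = 0}" "x < y"
    then obtain w where "w \<in> W" "x < w" "w < y"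
      using lt[of x y] by auto
    then have "w \<in> {w\<in>W. w < y}" "w \<notin> {w\<in>W. w < x}"
      by simp_all
    then show "{w\<in>W. w < x} \<noteq> {w\<in>W. w < y}"
      by metis
  qed
  moreover have "finite ((\<lambda>x. {w\<in>W. w < x}) ` {x\<in>I. f x = 0})"
    by (rule finite_subset[of _ "Pow W"]) (use fin in \<open>auto simp: W_def\<close>)
  ultimately show ?thesis
    by (rule finite_imageD[rotated])
qed

lemma finite_clifford_zeros_step:
  assumes "is_interval I" "finite {t\<in>I. clifford (Suc k) t = 0}"
  shows "finite {t\<in>I. clifford k t = 0}"
proof (rule finite_zeros_if_finite_zeros_deriv[OF assms(1) clifford_deriv])
  show "finite {t\<in>I. - clifford (Suc k) t = 0}"
    using assms(2) by (simp only: neg_equal_0_iff_equal)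
qed

text \<open>Infinitely many zeros propagate upwards in \<open>k\<close>, starting from the unbounded zeros of \<open>A_0\<close>.\<close>

lemma clifford_zeros_infinite: "infinite {t\<in>{0<..}. clifford k t = 0}"
proof (induction k)
  case 0
  show ?case
  proof
    assume fin: "finite {t\<in>{0<..}. clifford 0 t = 0}"
    define c where "c = Max (insert 1 {t\<in>{0<..}. clifford 0 t = 0}) + 1"
    have "c > t" if "t \<in> insert 1 {t\<in>{0<..}. clifford 0 t = 0}" for t
    proof -
      have "t \<le> Max (insert 1 {t\<in>{0<..}. clifford 0 t = 0})"
        using fin that by (intro Max_ge) simp_all
      then show ?thesis by (simp add: c_def)
    qed
    then have c: "c > 1" "\<And>t. t > 0 \<Longrightarrow> clifford 0 t = 0 \<Longrightarrow> c > t"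
      by auto
    then obtain t where "t \<ge> c" "clifford 0 t = 0"
      using clifford_0_zero_beyond[of c] by force
    then show False using c(2)[of t] c(1) by simp
  qed
next
  case (Suc k)
  show ?case
  proof
    assume "finite {t\<in>{0<..}. clifford (Suc k) t = 0}"
    then have "finite {t\<in>{0<..}. clifford k t = 0}"
      by (rule finite_clifford_zeros_step[rotated]) (simp add: is_interval_convex_1)
    with Suc show False by blast
  qed
qed

text \<open>Finitely many zeros propagate downwards in \<open>k\<close>, starting from an index so large that
  \<open>A_k\<close> has no zero in the interval at all.\<close>

lemma clifford_zeros_locally_finite: "finite {t\<in>{0..X}. clifford k t = 0}"
proof -
  obtain K where "exp X \<le> real K"
    using real_arch_simple by blast
  then have K: "exp X \<le> real K + 1"
    by simp
  have "finite {t\<in>{0..X}. clifford (K + k - i) t = 0}" if "i \<le> K" for i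
    using that
  proof (induction i)
    case 0
    have "exp X \<le> real (K + k) + 1" using K by simp
    then have "{t\<in>{0..X}. clifford (K + k) t = 0} = {}"
      using clifford_pos_large[of _ X "K + k"] by fastforce
    then show ?case by (simp only: diff_zero finite.emptyI)
  next
    case (Suc i)
    have "Suc (K + k - Suc i) = K + k - i"
      using Suc.prems by simp
    then have "finite {t\<in>{0..X}. clifford (Suc (K + k - Suc i)) t = 0}"
      using Suc.IH Suc.prems by simp
    then show ?case
      by (rule finite_clifford_zeros_step[rotated]) (simp add: is_interval_convex_1)
  qed
  from this[of K] show ?thesis by simp
qed

lemma ex_nth_element:
  fixes Z :: "real set"
  assumes inf: "infinite Z" and pos: "Z \<subseteq> {0<..}" and fin: "\<And>X. finite (Z \<inter> {..X})"
  shows "\<exists>x. (x = 0 \<or> x \<in> Z) \<and> card (Z \<inter> {..x}) = n"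
proof (induction n)
  case 0
  have "Z \<inter> {..0} = {}" using pos by force
  then show ?case by (intro exI[of _ 0]) simp
next
  case (Suc n)
  then obtain x where x: "card (Z \<inter> {..x}) = n" by blast
  have "\<not> Z \<subseteq> Z \<inter> {..x}"
    using inf fin finite_subset by blast
  then obtain z where z: "z \<in> Z" "z > x" by force
  define y where "y = Min (Z \<inter> {x<..z})"
  have f: "finite (Z \<inter> {x<..z})"
    by (rule finite_subset[OF _ fin[of z]]) auto
  then have y: "y \<in> Z \<inter> {x<..z}"
    unfolding y_def using z by (intro Min_in) auto
  have "Z \<inter> {..y} = insert y (Z \<inter> {..x})"
  proof (intro set_eqI iffI)
    fix w assume w: "w \<in> Z \<inter> {..y}"
    show "w \<in> insert y (Z \<inter> {..x})"
    proof (cases "w \<le> x")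
      case False
      then have "w \<in> Z \<inter> {x<..z}" using w y by auto
      then have "y \<le> w" unfolding y_def using f by (rule Min_le[rotated])
      then show ?thesis using w by auto
    qed (use w in auto)
  qed (use y in auto)
  then have "card (Z \<inter> {..y}) = Suc n"
    using x y fin[of x] by simp
  then show ?case using y by blast
qed

lemma bessel_J_zero_iff: "x > 0 \<Longrightarrow> bessel_J k x = 0 \<longleftrightarrow> clifford k (x\<^sup>2 / 4) = 0"
  by (simp add: bessel_J_eq_clifford)

lemma finite_bessel_zeros: "finite {y. 0 < y \<and> y \<le> X \<and> bessel_J k y = 0}"
proof (rule finite_imageD[of "\<lambda>y. y\<^sup>2 / 4"])
  show "finite ((\<lambda>y. y\<^sup>2 / 4) ` {y. 0 < y \<and> y \<le> X \<and> bessel_J k y = 0})"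
  proof (rule finite_subset[OF _ clifford_zeros_locally_finite[of "X\<^sup>2 / 4" k]], rule image_subsetI)
    fix y assume "y \<in> {y. 0 < y \<and> y \<le> X \<and> bessel_J k y = 0}"
    then show "y\<^sup>2 / 4 \<in> {t\<in>{0..X\<^sup>2 / 4}. clifford k t = 0}"
      using bessel_J_zero_iff[of y k] power_mono[of y X 2] by simp
  qed
  show "inj_on (\<lambda>y. y\<^sup>2 / 4) {y. 0 < y \<and> y \<le> X \<and> bessel_J k y = 0}"
  proof (rule inj_onI)
    fix x y :: real
    assume "x \<in> {y. 0 < y \<and> y \<le> X \<and> bessel_J k y = 0}" "y \<in> {y. 0 < y \<and> y \<le> X \<and> bessel_J k y = 0}"
      "x\<^sup>2 / 4 = y\<^sup>2 / 4"
    then show "x = y"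
      using power2_eq_iff_nonneg[of x y] by simp
  qed
qed

lemma infinite_bessel_zeros: "infinite {y. 0 < y \<and> bessel_J k y = 0}"
proof
  assume "finite {y. 0 < y \<and> bessel_J k y = 0}"
  then have "finite ((\<lambda>y. y\<^sup>2 / 4) ` {y. 0 < y \<and> bessel_J k y = 0})"
    by simp
  moreover have "{t\<in>{0<..}. clifford k t = 0} \<subseteq> (\<lambda>y. y\<^sup>2 / 4) ` {y. 0 < y \<and> bessel_J k y = 0}"
  proof
    fix t assume t: "t \<in> {t\<in>{0<..}. clifford k t = 0}"
    then show "t \<in> (\<lambda>y. y\<^sup>2 / 4) ` {y. 0 < y \<and> bessel_J k y = 0}"
      using bessel_J_zero_iff[of "2 * sqrt t" k]
      by (intro image_eqI[of _ _ "2 * sqrt t"]) (simp_all add: power_mult_distrib)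
  qed
  ultimately show False
    using clifford_zeros_infinite[of k] finite_subset by blast
qed

lemma bessel_zero_unique:
  assumes "0 < x" "bessel_J k x = 0" "0 < y" "bessel_J k y = 0"
    and "card {z. 0 < z \<and> z \<le> x \<and> bessel_J k z = 0} = card {z. 0 < z \<and> z \<le> y \<and> bessel_J k z = 0}"
  shows "x = y"
  using assms
proof (induction x y rule: linorder_wlog)
  case (le a b)
  have "{z. 0 < z \<and> z \<le> a \<and> bessel_J k z = 0} = {z. 0 < z \<and> z \<le> b \<and> bessel_J k z = 0}"
    using le by (intro card_subset_eq[OF finite_bessel_zeros]) auto
  moreover have "b \<in> {z. 0 < z \<and> z \<le> b \<and> bessel_J k z = 0}"
    using le by simp
  ultimately have "b \<in> {z. 0 < z \<and> z \<le> a \<and> bessel_J k z = 0}"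
    by metis
  then show ?case using le by simp
next
  case (sym a b)
  then show ?case by simp
qed

lemma bessel_zero_eqI:
  assumes "0 < x" "bessel_J k x = 0" "card {z. 0 < z \<and> z \<le> x \<and> bessel_J k z = 0} = n"
  shows "bessel_zero k n = x"
  unfolding bessel_zero_def
proof (rule the_equality)
  fix y
  assume "0 < y \<and> bessel_J k y = 0 \<and> card {z. 0 < z \<and> z \<le> y \<and> bessel_J k z = 0} = n"
  then show "y = x"
    using assms bessel_zero_unique[of y k x] by simp
qed (use assms in blast)

text \<open>The defining description of the \<open>n\<close>-th zero is satisfiable for \<open>n \<ge> 1\<close>, so the description
  operator yields an actual zero.\<close>

lemma bessel_zero:
  assumes "n \<ge> 1"
  shows "bessel_zero k n > 0" and "bessel_J k (bessel_zero k n) = 0"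
proof -
  let ?Z = "{y. 0 < y \<and> bessel_J k y = 0}"
  have eq: "?Z \<inter> {..x} = {z. 0 < z \<and> z \<le> x \<and> bessel_J k z = 0}" for x
    by auto
  obtain x where x: "x = 0 \<or> x \<in> ?Z" "card (?Z \<inter> {..x}) = n"
    using ex_nth_element[OF infinite_bessel_zeros[of k] _, of n] finite_bessel_zeros[of _ k]
    unfolding eq by auto
  have "x \<noteq> 0"
  proof
    assume "x = 0"
    then have "?Z \<inter> {..x} = {}" by auto
    then show False using x(2) assms by (metis card.empty not_one_le_zero)
  qed
  then have "bessel_zero k n = x" "x \<in> ?Z"
    using x by (auto intro!: bessel_zero_eqI simp: eq)
  then show "bessel_zero k n > 0" "bessel_J k (bessel_zero k n) = 0"
    by auto
qed

lemma ex_bessel_zero_eq: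
  assumes "x > 0" "bessel_J k x = 0"
  shows "\<exists>n\<ge>1. bessel_zero k n = x"
proof (intro exI conjI)
  show "bessel_zero k (card {z. 0 < z \<and> z \<le> x \<and> bessel_J k z = 0}) = x"
    by (rule bessel_zero_eqI) (use assms in auto)
  have "x \<in> {z. 0 < z \<and> z \<le> x \<and> bessel_J k z = 0}"
    using assms by auto
  then have "0 < card {z. 0 < z \<and> z \<le> x \<and> bessel_J k z = 0}"
    using finite_bessel_zeros[of x k] by (auto simp only: card_gt_0_iff)
  then show "1 \<le> card {z. 0 < z \<and> z \<le> x \<and> bessel_J k z = 0}" by simp
qed

section \<open>Rotations and radial integrals on the disc\<close>

definition cpx :: "real^2 \<Rightarrow> complex" where
  "cpx x = Complex (x $ 1) (x $ 2)"

definition rot :: "complex \<Rightarrow> real^2 \<Rightarrow> real^2" where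
  "rot c x = vector [Re (c * cpx x), Im (c * cpx x)]"

abbreviation disc :: "real \<Rightarrow> (real^2) measure" where
  "disc R \<equiv> lebesgue_on (ball 0 R)"

lemma cpx_0 [simp]: "cpx 0 = 0"
  by (simp add: cpx_def complex_eq_iff)

lemma cpx_diff: "cpx (x - y) = cpx x - cpx y"
  by (simp add: cpx_def complex_eq_iff)

lemma cpx_rot: "cpx (rot c x) = c * cpx x"
  by (simp add: cpx_def rot_def complex_eq_iff)

lemma norm_cpx [simp]: "norm (cpx x) = norm x"
  by (simp add: cpx_def cmod_def norm_vec_def L2_set_def UNIV_2)

lemma inj_cpx: "cpx x = cpx y \<Longrightarrow> x = y"
  using norm_cpx[of "x - y"] by (simp add: cpx_diff)

lemma cpx_eq_0_iff [simp]: "cpx x = 0 \<longleftrightarrow> x = 0"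
  using inj_cpx[of x 0] by auto

lemma cpx_times_cnj_power: "cpx x ^ l * cnj (cpx x) ^ l = of_real (norm x ^ (2 * l))"
  by (simp only: power_mult_distrib[symmetric] complex_norm_square[symmetric] norm_cpx) (simp add: power_mult)

lemma bounded_linear_cpx: "bounded_linear cpx"
  by (rule bounded_linear_intro[where K = 1]) (simp_all add: cpx_def complex_eq_iff flip: norm_cpx)

lemma continuous_on_cpx [continuous_intros]:
  "continuous_on S f \<Longrightarrow> continuous_on S (\<lambda>x. cpx (f x))"
  by (rule bounded_linear.continuous_on[OF bounded_linear_cpx])

lemma norm_rot: "cmod c = 1 \<Longrightarrow> norm (rot c x) = norm x"
  by (metis cpx_rot norm_cpx norm_mult mult_1)

lemma orthogonal_rot: "cmod c = 1 \<Longrightarrow> orthogonal_transformation (rot c)"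
  unfolding orthogonal_transformation
proof (intro conjI allI)
  show "linear (rot c)"
    by (rule linearI) (simp_all add: rot_def cpx_def vec_eq_iff forall_2 algebra_simps)
qed (rule norm_rot)

lemma rot_inverse: "cmod c = 1 \<Longrightarrow> rot c (rot (cnj c) x) = x" "cmod c = 1 \<Longrightarrow> rot (cnj c) (rot c x) = x"
  by (rule inj_cpx, simp add: cpx_rot mult.assoc[symmetric] complex_norm_square[symmetric] mult.commute)+

lemma finite_measure_disc: "finite_measure (disc R)"
  by (simp add: finite_measure_lebesgue_on)

lemma sets_disc_iff: "A \<in> sets (disc R) \<longleftrightarrow> A \<subseteq> ball 0 R \<and> A \<in> lmeasurable"
  by (auto simp: sets_restrict_space_iff fmeasurable_Int_fmeasurable
      intro: bounded_set_imp_lmeasurable bounded_subset)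

lemma rot_vimage:
  assumes "cmod c = 1" "A \<in> sets (disc R)"
  shows "rot c -` A \<inter> ball 0 R = rot (cnj c) ` A" and "rot (cnj c) ` A \<in> sets (disc R)"
proof -
  have A: "A \<subseteq> ball 0 R" "A \<in> lmeasurable"
    using assms(2) by (simp_all add: sets_disc_iff)
  have c': "cmod (cnj c) = 1" using assms(1) by simp
  show "rot c -` A \<inter> ball 0 R = rot (cnj c) ` A"
  proof (intro equalityI subsetI)
    fix x assume "x \<in> rot c -` A \<inter> ball 0 R"
    then show "x \<in> rot (cnj c) ` A"
      using rot_inverse(2)[OF assms(1), of x] by (auto intro!: image_eqI[of _ _ "rot c x"])
  qed (use A norm_rot[OF c'] rot_inverse(1)[OF assms(1)] in auto)
  show "rot (cnj c) ` A \<in> sets (disc R)"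
    using A norm_rot[OF c'] measurable_orthogonal_image[OF orthogonal_rot[OF c'] A(2)]
    by (auto simp: sets_disc_iff)
qed

lemma measurable_rot: "cmod c = 1 \<Longrightarrow> rot c \<in> disc R \<rightarrow>\<^sub>M disc R"
  using rot_vimage[of c] norm_rot[of c] by (intro measurableI) auto

text \<open>The disc is used as a measure space of its own, so that invariance under rotations is an
  equality of measures and integrals can be transformed by \<open>integral_distr\<close>.\<close>

lemma distr_rot:
  assumes "cmod c = 1"
  shows "distr (disc R) (disc R) (rot c) = disc R"
proof (rule measure_eqI)
  fix A assume "A \<in> sets (distr (disc R) (disc R) (rot c))"
  then have A: "A \<in> sets (disc R)" by simp
  then have Am: "A \<subseteq> ball 0 R" "A \<in> lmeasurable" by (simp_all add: sets_disc_iff)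
  have c': "cmod (cnj c) = 1" using assms(1) by simp
  let ?B = "rot (cnj c) ` A"
  have B: "?B \<subseteq> ball 0 R" "?B \<in> lmeasurable"
    using rot_vimage(2)[OF assms A] by (simp_all add: sets_disc_iff)
  have "emeasure (distr (disc R) (disc R) (rot c)) A = emeasure (disc R) ?B"
    using rot_vimage[OF assms A] A by (subst emeasure_distr[OF measurable_rot[OF assms]]) auto
  also have "\<dots> = emeasure lebesgue ?B"
    using B by (subst emeasure_restrict_space) auto
  also have "\<dots> = emeasure lebesgue A"
    using measure_orthogonal_image[OF orthogonal_rot[OF c'] Am(2)] B Am
    by (simp add: emeasure_eq_measure2)
  also have "\<dots> = emeasure (disc R) A"
    using Am by (subst emeasure_restrict_space) auto
  finally show "emeasure (distr (disc R) (disc R) (rot c)) A = emeasure (disc R) A" .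
qed simp

lemma integral_rot:
  fixes f :: "real^2 \<Rightarrow> 'b::{banach, second_countable_topology}"
  assumes "cmod c = 1" "f \<in> borel_measurable (disc R)"
  shows "(\<integral>x. f (rot c x) \<partial>disc R) = (\<integral>x. f x \<partial>disc R)"
  using integral_distr[OF measurable_rot[OF assms(1)] assms(2)] distr_rot[OF assms(1), of R] by simp

lemma AE_rot:
  assumes "cmod c = 1" "AE x in disc R. P x"
  shows "AE x in disc R. P (rot c x)"
proof -
  have "AE x in distr (disc R) (disc R) (rot c). P x"
    unfolding distr_rot[OF assms(1)] by (rule assms(2))
  then show ?thesis
    by (rule AE_distrD[OF measurable_rot[OF assms(1)]])
qed

lemma id_measurable_disc [measurable]: "(\<lambda>x. x) \<in> disc R \<rightarrow>\<^sub>M borel"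
  using id_borel_measurable_lebesgue_on[of "ball 0 R"] unfolding id_def .

lemma borel_measurable_disc:
  assumes "f \<in> borel_measurable borel"
  shows "f \<in> borel_measurable (disc R)"
  using measurable_compose[OF id_measurable_disc assms] .

lemma cnj_measurable [measurable]: "cnj \<in> borel_measurable borel"
  by (rule borel_measurable_continuous_onI) (rule continuous_on_cnj, rule continuous_on_id)

lemma cpx_measurable [measurable]: "cpx \<in> borel_measurable borel"
  by (rule borel_measurable_continuous_onI) (rule continuous_on_cpx, rule continuous_on_id)

lemma cpx_measurable_disc [measurable]: "cpx \<in> borel_measurable (disc R)"
  by (rule borel_measurable_disc, rule cpx_measurable)

lemma norm_measurable_disc [measurable]: "norm \<in> borel_measurable (disc R)"
  by (rule borel_measurable_disc) measurable

lemma integrable_bounded_disc: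
  fixes f :: "real^2 \<Rightarrow> 'b::{banach, second_countable_topology}"
  assumes "f \<in> borel_measurable (disc R)" "\<And>x. norm x < R \<Longrightarrow> norm (f x) \<le> C"
  shows "integrable (disc R) f"
proof (rule finite_measure.integrable_const_bound[OF finite_measure_disc _ assms(1)])
  show "AE x in disc R. norm (f x) \<le> C"
    by (rule AE_I2) (simp add: assms(2))
qed

text \<open>The only consequence of the rotational symmetry that is needed: a single rotation,
  by the angle \<open>\<pi> / |a - b|\<close>, changes the sign of the integrand.\<close>

lemma integral_off_diagonal_eq_0:
  fixes G :: "real^2 \<Rightarrow> complex"
  assumes "a \<noteq> b" and [measurable]: "G \<in> borel_measurable (disc R)"
    and G: "\<And>c. cmod c = 1 \<Longrightarrow> AE x in disc R. G (rot c x) = G x"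
  shows "(\<integral>x. G x * (cpx x ^ a * cnj (cpx x) ^ b) \<partial>disc R) = 0"
proof -
  let ?I = "\<integral>x. G x * (cpx x ^ a * cnj (cpx x) ^ b) \<partial>disc R"
  define d where "d = \<bar>real a - real b\<bar>"
  define c where "c = cis (pi / d)"
  have d: "d > 0" using assms(1) by (simp add: d_def)
  have c: "cmod c = 1" by (simp add: c_def)
  have "c ^ a * cnj c ^ b = cis (real a * (pi / d) - real b * (pi / d))"
    by (simp add: c_def Complex.DeMoivre cis_cnj cis_mult)
  also have "real a * (pi / d) - real b * (pi / d) = (real a - real b) / d * pi"
    by (simp add: diff_divide_distrib algebra_simps)
  also have "(real a - real b) / d = 1 \<or> (real a - real b) / d = -1"
    using d by (auto simp: d_def abs_if field_simps)
  then have "cis ((real a - real b) / d * pi) = -1"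
    by (elim disjE) (simp_all only: mult_minus1 mult_1 cis_pi cis_cnj[symmetric], simp)
  finally have ccb: "c ^ a * cnj c ^ b = -1" .
  have "?I = (\<integral>x. G (rot c x) * (cpx (rot c x) ^ a * cnj (cpx (rot c x)) ^ b) \<partial>disc R)"
    by (rule integral_rot[OF c, symmetric]) measurable
  also have "\<dots> = (\<integral>x. - (G x * (cpx x ^ a * cnj (cpx x) ^ b)) \<partial>disc R)"
  proof (rule integral_cong_AE)
    show "(\<lambda>x. G (rot c x) * (cpx (rot c x) ^ a * cnj (cpx (rot c x)) ^ b)) \<in> borel_measurable (disc R)"
      using measurable_rot[OF c, of R, measurable] by measurable
    show "AE x in disc R. G (rot c x) * (cpx (rot c x) ^ a * cnj (cpx (rot c x)) ^ b)
        = - (G x * (cpx x ^ a * cnj (cpx x) ^ b))"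
      using G[OF c]
    proof eventually_elim
      case (elim x)
      have "cpx (rot c x) ^ a * cnj (cpx (rot c x)) ^ b = (c ^ a * cnj c ^ b) * (cpx x ^ a * cnj (cpx x) ^ b)"
        by (simp add: cpx_rot power_mult_distrib mult_ac)
      then show ?case by (simp add: elim ccb)
    qed
  qed measurable
  also have "\<dots> = - ?I" by (rule Bochner_Integration.integral_minus)
  finally show ?thesis by (simp add: eq_neg_iff_add_eq_0)
qed

lemma emeasure_disc_cball: "0 \<le> s \<Longrightarrow> s \<le> R \<Longrightarrow> emeasure (disc R) (cball 0 s \<inter> ball 0 R) = ennreal (pi * s\<^sup>2)"
proof -
  assume s: "0 \<le> s" "s \<le> R"
  have "emeasure (disc R) (cball 0 s \<inter> ball 0 R) = emeasure lebesgue (cball 0 s \<inter> ball 0 R :: (real^2) set)"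
    by (subst emeasure_restrict_space) auto
  also have "\<dots> = emeasure lebesgue (ball 0 s :: (real^2) set)"
  proof (rule emeasure_eq_AE)
    have "AE x in lebesgue. (x :: real^2) \<notin> sphere 0 s"
      using negligible_sphere[of "0 :: real^2" s] unfolding negligible_iff_null_sets by (rule AE_not_in)
    then show "AE x in lebesgue. (x :: real^2) \<in> cball 0 s \<inter> ball 0 R \<longleftrightarrow> x \<in> ball 0 s"
      by eventually_elim (use s in auto)
  qed auto
  also have "\<dots> = ennreal (pi * s\<^sup>2)"
    using s by (simp add: emeasure_ball unit_ball_vol_2)
  finally show ?thesis .
qed

text \<open>Polar coordinates for functions of \<open>|x|\<close> alone: both measures give \<open>\<pi> (R^2 - s^2)\<close> to
  the half-line above \<open>s\<close>.\<close>

lemma distr_norm_disc: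
  assumes "R > 0"
  shows "distr (disc R) borel norm = density lborel (\<lambda>s. ennreal (2 * pi * s) * indicator {0..R} s)"
    (is "?M = ?N")
proof (rule measure_eqI_lessThan)
  have nm: "norm \<in> disc R \<rightarrow>\<^sub>M borel" by measurable
  have M: "emeasure ?M {x<..} = ennreal (pi * R\<^sup>2 - pi * (max 0 (min x R))\<^sup>2)" for x
  proof -
    define s where "s = max 0 (min x R)"
    have s: "0 \<le> s" "s \<le> R" using assms by (auto simp: s_def)
    interpret finite_measure "disc R" by (rule finite_measure_disc)
    have "emeasure ?M {x<..} = emeasure (disc R) (norm -` {x<..} \<inter> ball 0 R)"
      by (subst emeasure_distr[OF nm]) auto
    also have "\<dots> = emeasure (disc R) (ball 0 R - cball 0 s \<inter> ball 0 R)"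
    proof (cases "x < 0")
      case True
      have "AE y in disc R. y \<notin> {0::real^2}"
        using assms by (intro AE_not_in) (auto simp: null_sets_restrict_space)
      then show ?thesis
      proof (intro emeasure_eq_AE)
        show "norm -` {x<..} \<inter> ball 0 R \<in> sets (disc R)"
          using measurable_sets[OF nm, of "{x<..}"] by simp
        show "ball 0 R - cball 0 s \<inter> ball 0 R \<in> sets (disc R)"
          by (auto simp: sets_restrict_space_iff)
        show "AE y in disc R. y \<in> norm -` {x<..} \<inter> ball 0 R \<longleftrightarrow> y \<in> ball 0 R - cball 0 s \<inter> ball 0 R"
          using \<open>AE y in disc R. y \<notin> {0}\<close>
        proof eventually_elim
          case (elim y)
          have "0 \<le> norm y" by simp
          then have "x < norm y" using True by linarith
          then show ?case
            using True assms elim by (simp add: s_def)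
        qed
      qed
    next
      case False
      then have "norm -` {x<..} \<inter> ball 0 R = ball 0 R - cball (0::real^2) s \<inter> ball 0 R"
        using assms by (auto simp: s_def)
      then show ?thesis by simp
    qed
    also have "\<dots> = emeasure (disc R) (ball 0 R) - emeasure (disc R) (cball 0 s \<inter> ball 0 R)"
      by (rule emeasure_Diff) (auto simp: sets_restrict_space_iff)
    also have "emeasure (disc R) (ball 0 R) = ennreal (pi * R\<^sup>2)"
      using emeasure_disc_cball[of R R] assms by (simp add: inf.absorb2 ball_subset_cball)
    also have "emeasure (disc R) (cball 0 s \<inter> ball 0 R) = ennreal (pi * s\<^sup>2)"
      by (rule emeasure_disc_cball[OF s])
    also have "ennreal (pi * R\<^sup>2) - ennreal (pi * s\<^sup>2) = ennreal (pi * R\<^sup>2 - pi * s\<^sup>2)"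
      by (rule ennreal_minus) simp
    finally show ?thesis by (simp add: s_def)
  qed
  then show "emeasure ?M {x<..} < \<infinity>" for x by simp
  show "emeasure ?M {x<..} = emeasure ?N {x<..}" for x
  proof -
    define s where "s = max 0 (min x R)"
    have s: "0 \<le> s" "s \<le> R" using assms by (auto simp: s_def)
    have "emeasure ?N {x<..} = (\<integral>\<^sup>+t. ennreal (2 * pi * t) * indicator {0..R} t * indicator {x<..} t \<partial>lborel)"
      by (subst emeasure_density) auto
    also have "\<dots> = (\<integral>\<^sup>+t. ennreal (2 * pi * t) * indicator {s..R} t \<partial>lborel)"
    proof (rule nn_integral_cong_AE)
      show "AE t in lborel. ennreal (2 * pi * t) * indicator {0..R} t * indicator {x<..} t = ennreal (2 * pi * t) * indicator {s..R} t"
        using AE_lborel_singleton[of s] AE_lborel_singleton[of R]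
        by eventually_elim (auto simp: s_def indicator_def)
    qed
    also have "\<dots> = ennreal (pi * R\<^sup>2 - pi * s\<^sup>2)"
      using s by (intro nn_integral_FTC_Icc) (auto intro!: derivative_eq_intros)
    finally show ?thesis by (simp add: M s_def)
  qed
qed auto

lemma integral_radial:
  assumes R: "R > 0" and [measurable]: "h \<in> borel_measurable borel"
    and nonneg: "\<And>s. 0 \<le> s \<Longrightarrow> s \<le> R \<Longrightarrow> 0 \<le> h s"
    and I: "((\<lambda>s. s * h s) has_integral I) {0..R}"
  shows "(\<integral>y. h (norm y) \<partial>disc R) = 2 * pi * I"
proof -
  have I0: "0 \<le> I"
    by (rule has_integral_nonneg[OF I]) (auto intro!: nonneg mult_nonneg_nonneg)
  have "(\<integral>\<^sup>+y. ennreal (h (norm y)) \<partial>disc R) = (\<integral>\<^sup>+s. ennreal (h s) \<partial>distr (disc R) borel norm)"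
    by (rule nn_integral_distr[symmetric]) measurable
  also have "\<dots> = (\<integral>\<^sup>+s. ennreal (2 * pi * s) * indicator {0..R} s * ennreal (h s) \<partial>lborel)"
    unfolding distr_norm_disc[OF R] by (rule nn_integral_density) measurable
  also have "\<dots> = (\<integral>\<^sup>+s. ennreal (2 * pi * (s * h s)) * indicator {0..R} s \<partial>lborel)"
    using nonneg by (intro nn_integral_cong) (auto simp: indicator_def ennreal_mult'[symmetric] mult_ac)
  also have "\<dots> = ennreal (2 * pi * I)"
    by (rule nn_integral_has_integral_lebesgue') (use has_integral_mult_right[OF I, of "2 * pi"] nonneg in auto)
  finally have "(\<integral>\<^sup>+y. ennreal (h (norm y)) \<partial>disc R) = ennreal (2 * pi * I)" .
  then show ?thesis
    by (intro integral_eq_nn_integral[THEN trans]) (use nonneg I0 in \<open>auto intro!: AE_I2\<close>)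
qed

lemma AE_disc_norm_neq: "AE y in disc R. norm y \<noteq> (s::real)"
proof -
  have "AE x in lebesgue. (x :: real^2) \<notin> sphere 0 s"
    using negligible_sphere[of "0 :: real^2" s] unfolding negligible_iff_null_sets by (rule AE_not_in)
  then show ?thesis
    by (subst AE_restrict_space_iff) (auto elim!: eventually_mono)
qed

section \<open>Expansion of the logarithmic kernel\<close>

definition log_kernel :: "real^2 \<Rightarrow> real^2 \<Rightarrow> real" where
  "log_kernel x y = ln (1 / norm (x - y))"

text \<open>The polynomial \<open>z^m |z|^(2l)\<close>; together with their conjugates these span all polynomials
  in the two real coordinates.\<close>

definition monomial :: "nat \<Rightarrow> nat \<Rightarrow> real^2 \<Rightarrow> complex" where
  "monomial m l y = of_real (norm y ^ (2 * l)) * cpx y ^ m"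

lemma monomial_eq: "monomial m l x = cpx x ^ (m + l) * cnj (cpx x) ^ l"
  unfolding monomial_def cpx_times_cnj_power[symmetric] by (simp add: power_add mult_ac)

text \<open>The \<open>n\<close>-th term of the expansion of the logarithm, in a form that is the same for \<open>|y| < |x|\<close> and
  \<open>|y| > |x|\<close>. For \<open>n = 0\<close> the division by zero makes it \<open>0\<close>, as required.\<close>

definition kernel_term :: "real^2 \<Rightarrow> nat \<Rightarrow> real^2 \<Rightarrow> real" where
  "kernel_term x n y = Re ((cpx y * cnj (cpx x)) ^ n) / (real n * max (norm x) (norm y) ^ (2 * n))"

text \<open>For \<open>|y| < |x|\<close> the kernel is \<open>- ln |x| - ln |1 - y/x|\<close>, and symmetrically in the other case; the
  real part of the logarithmic series gives the expansion.\<close>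

lemma kernel_expansion:
  assumes "x \<noteq> 0" "norm y \<noteq> norm x"
  shows "(\<lambda>n. kernel_term x n y) sums (log_kernel x y + ln (max (norm x) (norm y)))"
proof -
  define \<mu> where "\<mu> = max (norm x) (norm y)"
  have \<mu>: "\<mu> > 0" using assms(1) by (simp add: \<mu>_def max.strict_coboundedI1)
  obtain q where q: "cmod q < 1" "norm (x - y) = \<mu> * cmod (1 - q)"
      "\<And>n. Re (q ^ n) = Re ((cpx y * cnj (cpx x)) ^ n) / \<mu> ^ (2 * n)"
  proof (cases "norm y < norm x")
    case True
    then have m: "\<mu> = norm x" by (simp add: \<mu>_def)
    have x: "cpx x \<noteq> 0" using assms(1) by simp
    show thesis
    proof (rule that[of "cpx y / cpx x"])
      show "cmod (cpx y / cpx x) < 1"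
        using True assms(1) by (simp add: norm_divide)
      have "cpx (x - y) = cpx x * (1 - cpx y / cpx x)"
        using x by (simp add: cpx_diff right_diff_distrib)
      then show "norm (x - y) = \<mu> * cmod (1 - cpx y / cpx x)"
        by (metis norm_cpx norm_mult m)
      have "cpx y / cpx x = cpx y * cnj (cpx x) / of_real (\<mu>\<^sup>2)"
        by (subst complex_div_cnj) (simp add: m)
      then have "(cpx y / cpx x) ^ n = (cpx y * cnj (cpx x)) ^ n / of_real (\<mu> ^ (2 * n))" for n
        by (simp add: power_divide power_mult)
      then show "Re ((cpx y / cpx x) ^ n) = Re ((cpx y * cnj (cpx x)) ^ n) / \<mu> ^ (2 * n)" for n
        by (simp only: Re_divide_of_real)
    qed
  next
    case False
    then have lt: "norm x < norm y" using assms(2) by simp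
    then have m: "\<mu> = norm y" by (simp add: \<mu>_def)
    have y: "cpx y \<noteq> 0" using lt by auto
    show thesis
    proof (rule that[of "cpx x / cpx y"])
      show "cmod (cpx x / cpx y) < 1"
        using lt y by (simp add: norm_divide)
      have "cpx (y - x) = cpx y * (1 - cpx x / cpx y)"
        using y by (simp add: cpx_diff right_diff_distrib)
      then show "norm (x - y) = \<mu> * cmod (1 - cpx x / cpx y)"
        by (metis norm_cpx norm_mult m norm_minus_commute)
      have "cpx x / cpx y = cnj (cpx y * cnj (cpx x)) / of_real (\<mu>\<^sup>2)"
        by (subst complex_div_cnj) (simp add: m mult.commute)
      then have "(cpx x / cpx y) ^ n = cnj ((cpx y * cnj (cpx x)) ^ n) / of_real (\<mu> ^ (2 * n))" for n
        by (simp add: power_divide power_mult)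
      then show "Re ((cpx x / cpx y) ^ n) = Re ((cpx y * cnj (cpx x)) ^ n) / \<mu> ^ (2 * n)" for n
        by (simp only: Re_divide_of_real cnj.simps)
    qed
  qed
  have nz: "1 - q \<noteq> 0" using q(1) by auto
  have "(\<lambda>n. - (q ^ n) / of_nat n) sums ln (1 - q)"
    using Ln_series'[of "- q"] q(1) by simp
  then have "(\<lambda>n. - Re (- (q ^ n) / of_nat n)) sums - Re (ln (1 - q))"
    by (intro sums_minus sums_Re)
  moreover have "- Re (- (q ^ n) / of_nat n) = kernel_term x n y" for n
    using Re_divide_of_real[of "q ^ n" "real n"] by (simp add: kernel_term_def q(3) \<mu>_def mult.commute)
  moreover have "- Re (ln (1 - q)) = log_kernel x y + ln \<mu>"
    using \<mu> nz by (simp add: log_kernel_def q(2) ln_div ln_mult)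
  ultimately show ?thesis by (simp add: \<mu>_def)
qed

text \<open>The true bound is \<open>(min / max)^n\<close>. The extra factor \<open>(R / s)^2 \<ge> 1\<close> gives the tail an elementary
  primitive for every \<open>n \<ge> 1\<close>, where \<open>s (r/s)^n\<close> alone would need a logarithm at \<open>n = 2\<close>.\<close>

definition term_majorant :: "real \<Rightarrow> real \<Rightarrow> nat \<Rightarrow> real \<Rightarrow> real" where
  "term_majorant R r n s = (if s \<le> r then (s / r) ^ n else (R / s)\<^sup>2 * (r / s) ^ n)"

lemma term_majorant_nonneg: "0 \<le> r \<Longrightarrow> 0 \<le> s \<Longrightarrow> 0 \<le> term_majorant R r n s"
  by (simp add: term_majorant_def)

lemma term_majorant_measurable [measurable]: "term_majorant R r n \<in> borel_measurable borel"
  unfolding term_majorant_def by measurable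

lemma abs_kernel_term_le:
  assumes "x \<noteq> 0" "norm y < R"
  shows "\<bar>kernel_term x n y\<bar> \<le> term_majorant R (norm x) n (norm y) / real n"
proof -
  define r s where "r = norm x" and "s = norm y"
  have r: "r > 0" and s: "0 \<le> s" "s < R" using assms by (auto simp: r_def s_def)
  have "\<bar>Re ((cpx y * cnj (cpx x)) ^ n)\<bar> \<le> cmod ((cpx y * cnj (cpx x)) ^ n)"
    by (rule abs_Re_le_cmod)
  also have "\<dots> = (s * r) ^ n"
    by (simp add: norm_power norm_mult r_def s_def)
  finally have "\<bar>kernel_term x n y\<bar> \<le> (s * r) ^ n / (real n * max r s ^ (2 * n))"
    using r by (simp add: kernel_term_def r_def[symmetric] s_def[symmetric] abs_mult divide_right_mono)
  also have "\<dots> = (s * r / (max r s)\<^sup>2) ^ n / real n"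
    by (simp add: power_divide power_mult)
  also have "(s * r / (max r s)\<^sup>2) ^ n \<le> term_majorant R r n s"
  proof (cases "s \<le> r")
    case True
    then show ?thesis using r by (simp add: term_majorant_def power2_eq_square)
  next
    case False
    then have "1 \<le> (R / s)\<^sup>2"
      using r s by (intro one_le_power) (simp add: field_simps)
    then have "1 * (r / s) ^ n \<le> (R / s)\<^sup>2 * (r / s) ^ n"
      using r s by (intro mult_right_mono) simp_all
    then show ?thesis using False r s by (simp add: term_majorant_def power2_eq_square)
  qed
  finally show ?thesis by (simp add: r_def s_def divide_right_mono)
qed

lemma term_majorant_integral:
  assumes "0 < r" "r < R" "n \<ge> 1"
  shows "\<exists>I\<le>2 * R\<^sup>2 / real n. ((\<lambda>s. s * term_majorant R r n s) has_integral I) {0..R}"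
proof -
  obtain k where k: "n = Suc k" using assms(3) by (cases n) auto
  define F where "F s = s ^ (n + 2) / (real (n + 2) * r ^ n)" for s
  define G where "G s = - (R\<^sup>2 * r ^ n / (real n * s ^ n))" for s
  have "((\<lambda>s. s * (s / r) ^ n) has_integral (F r - F 0)) {0..r}"
  proof (rule fundamental_theorem_of_calculus)
    fix s
    have "(F has_real_derivative real (n + 2) * s ^ (n + 1) / (real (n + 2) * r ^ n)) (at s within {0..r})"
    proof -
      have "((\<lambda>s. s ^ (n + 2)) has_real_derivative real (n + 2) * s ^ (n + 2 - 1)) (at s within {0..r})"
        using DERIV_power[OF DERIV_ident, where n = "n + 2"] by simp
      then show ?thesis
        unfolding F_def by (intro DERIV_cdivide) simp
    qed
    moreover have "real (n + 2) * s ^ (n + 1) / (real (n + 2) * r ^ n) = s * (s / r) ^ n"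
      by (simp add: power_divide del: of_nat_add)
    ultimately show "(F has_vector_derivative s * (s / r) ^ n) (at s within {0..r})"
      by (simp add: has_real_derivative_iff_has_vector_derivative)
  qed (use assms in auto)
  then have 1: "((\<lambda>s. s * term_majorant R r n s) has_integral (F r - F 0)) {0..r}"
    by (rule has_integral_eq[rotated]) (simp add: term_majorant_def)
  have "((\<lambda>s. s * ((R / s)\<^sup>2 * (r / s) ^ n)) has_integral (G R - G r)) {r..R}"
  proof (rule fundamental_theorem_of_calculus)
    fix s assume "s \<in> {r..R}"
    then have s: "s > 0" using assms by simp
    have "(G has_real_derivative R\<^sup>2 * r ^ n * (real n * (real n * s ^ (n - 1))) / (real n * s ^ n)\<^sup>2) (at s within {r..R})"
      unfolding G_def using s assms by (auto intro!: derivative_eq_intros simp: power2_eq_square)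
    moreover have "R\<^sup>2 * r ^ n * (real n * (real n * s ^ (n - 1))) / (real n * s ^ n)\<^sup>2 = s * ((R / s)\<^sup>2 * (r / s) ^ n)"
      using s unfolding k by (simp add: power_divide power2_eq_square field_simps del: of_nat_Suc)
    ultimately show "(G has_vector_derivative s * ((R / s)\<^sup>2 * (r / s) ^ n)) (at s within {r..R})"
      by (simp add: has_real_derivative_iff_has_vector_derivative)
  qed (use assms in auto)
  then have 2: "((\<lambda>s. s * term_majorant R r n s) has_integral (G R - G r)) {r..R}"
  proof (rule has_integral_spike_finite[rotated 2])
    show "s * term_majorant R r n s = s * ((R / s)\<^sup>2 * (r / s) ^ n)" if "s \<in> {r..R} - {r}" for s
      using that by (simp add: term_majorant_def)
  qed simp
  have "((\<lambda>s. s * term_majorant R r n s) has_integral (F r - F 0 + (G R - G r))) {0..R}"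
    using has_integral_combine[OF _ _ 1 2] assms by simp
  moreover have "F r - F 0 + (G R - G r) \<le> 2 * R\<^sup>2 / real n"
  proof -
    have "F r - F 0 = r\<^sup>2 / real (n + 2)"
      using assms by (simp add: F_def power_add power2_eq_square)
    also have "\<dots> \<le> R\<^sup>2 / real n"
      using assms by (intro frac_le power_mono) auto
    finally have F: "F r - F 0 \<le> R\<^sup>2 / real n" .
    have "G R \<le> 0" "G r = - (R\<^sup>2 / real n)"
      using assms by (auto simp: G_def)
    with F show ?thesis by (simp add: field_simps)
  qed
  ultimately show ?thesis by blast
qed

lemma kernel_term_measurable [measurable]: "kernel_term x n \<in> borel_measurable borel"
  unfolding kernel_term_def by measurable

lemma log_kernel_measurable [measurable]: "log_kernel x \<in> borel_measurable borel"
  unfolding log_kernel_def by measurable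

lemma kernel_term_0 [simp]: "kernel_term x 0 y = 0"
  by (simp add: kernel_term_def)

lemma kernel_term_le_1:
  assumes "x \<noteq> 0"
  shows "\<bar>kernel_term x n y\<bar> \<le> 1"
proof (cases "n = 0")
  case False
  define r s where "r = norm x" and "s = norm y"
  have r: "r > 0" and s: "0 \<le> s" using assms by (auto simp: r_def s_def)
  have "\<bar>Re ((cpx y * cnj (cpx x)) ^ n)\<bar> \<le> cmod ((cpx y * cnj (cpx x)) ^ n)"
    by (rule abs_Re_le_cmod)
  also have "\<dots> = (s * r) ^ n"
    by (simp add: norm_power norm_mult r_def s_def)
  also have "\<dots> \<le> (max r s * max r s) ^ n"
    using r s by (intro power_mono mult_mono) auto
  also have "\<dots> = max r s ^ (2 * n)"
    by (simp add: power_mult power2_eq_square)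
  also have "\<dots> \<le> real n * max r s ^ (2 * n)"
    using False by (simp add: mult_le_cancel_right1)
  finally show ?thesis
    using r False by (simp add: kernel_term_def r_def[symmetric] s_def[symmetric] abs_mult divide_le_eq max.strict_coboundedI1)
qed simp

text \<open>The terms are only \<open>O(1/n)\<close> pointwise near the circle \<open>|y| = |x|\<close>, but integration
  gains another factor \<open>1/n\<close>, so that the expansion converges absolutely in the mean, uniformly in \<open>x\<close>.\<close>

lemma integral_abs_kernel_term_le:
  assumes "x \<noteq> 0" "norm x < R"
  shows "integrable (disc R) (\<lambda>y. \<bar>kernel_term x n y\<bar>)"
    and "(\<integral>y. \<bar>kernel_term x n y\<bar> \<partial>disc R) \<le> 4 * pi * R\<^sup>2 * (1 / real n ^ 2)"
proof -
  have m [measurable]: "kernel_term x n \<in> borel_measurable (disc R)"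
    by (rule borel_measurable_disc) measurable
  show i: "integrable (disc R) (\<lambda>y. \<bar>kernel_term x n y\<bar>)"
    by (rule integrable_bounded_disc[where C = 1]) (use kernel_term_le_1[OF assms(1)] in auto)
  show "(\<integral>y. \<bar>kernel_term x n y\<bar> \<partial>disc R) \<le> 4 * pi * R\<^sup>2 * (1 / real n ^ 2)"
  proof (cases "n = 0")
    case False
    let ?h = "\<lambda>s. term_majorant R (norm x) n s / real n"
    have R: "R > 0" using assms(2) norm_ge_zero[of x] by linarith
    obtain I where I: "I \<le> 2 * R\<^sup>2 / real n" "((\<lambda>s. s * term_majorant R (norm x) n s) has_integral I) {0..R}"
      using term_majorant_integral[of "norm x" R n] assms False by auto
    have "((\<lambda>s. s * ?h s) has_integral I / real n) {0..R}"
      using has_integral_divide[OF I(2), of "real n"] by simp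
    then have v: "(\<integral>y. ?h (norm y) \<partial>disc R) = 2 * pi * (I / real n)"
      by (intro integral_radial[OF R]) (auto intro!: divide_nonneg_nonneg term_majorant_nonneg)
    have mb: "?h (norm y) \<le> (R / norm x)\<^sup>2 / real n" if y: "norm y < R" for y :: "real^2"
    proof (rule divide_right_mono)
      have x: "norm x > 0" using assms by simp
      show "term_majorant R (norm x) n (norm y) \<le> (R / norm x)\<^sup>2"
      proof (cases "norm y \<le> norm x")
        case True
        then have "(norm y / norm x) ^ n \<le> 1"
          using x by (intro power_le_one) auto
        also have "1 \<le> (R / norm x)\<^sup>2"
          using x assms(2) by (intro one_le_power) (simp add: field_simps)
        finally show ?thesis using True by (simp add: term_majorant_def)
      next
        case False
        have "(R / norm y)\<^sup>2 * (norm x / norm y) ^ n \<le> (R / norm x)\<^sup>2 * 1"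
        proof (intro mult_mono power_mono power_le_one)
          have lt: "norm x \<le> norm y" "0 < norm y" using False x by linarith+
          show "R / norm y \<le> R / norm x"
            using lt x R by (intro divide_left_mono) auto
          show "norm x / norm y \<le> 1" using lt by simp
        qed (use R in auto)
        then show ?thesis using False by (simp add: term_majorant_def)
      qed
    qed simp
    have "(\<integral>y. \<bar>kernel_term x n y\<bar> \<partial>disc R) \<le> (\<integral>y. ?h (norm y) \<partial>disc R)"
    proof (rule integral_mono[OF i])
      show "integrable (disc R) (\<lambda>y. ?h (norm y))"
        by (rule integrable_bounded_disc[where C = "(R / norm x)\<^sup>2 / real n"])
          (use mb in \<open>auto simp: term_majorant_nonneg\<close>)
    qed (use abs_kernel_term_le[OF assms(1)] in auto)
    also have "\<dots> \<le> 2 * pi * (2 * R\<^sup>2 / real n / real n)"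
      unfolding v using I(1) by (intro mult_left_mono divide_right_mono) auto
    finally show ?thesis by (simp add: power2_eq_square)
  qed simp
qed

lemma abs_ln_max_integral:
  assumes "x \<noteq> 0" "norm x < R"
  shows "integrable (disc R) (\<lambda>y. ln (max (norm x) (norm y)))"
    and "(\<integral>y. \<bar>ln (max (norm x) (norm y))\<bar> \<partial>disc R) \<le> 2 * pi * (R ^ 3 + R)"
proof -
  have R: "R > 0" using assms(2) norm_ge_zero[of x] by linarith
  have x: "norm x > 0" using assms by simp
  have b: "\<bar>ln t\<bar> \<le> t + 1 / t" if "t > 0" for t :: real
  proof -
    have "1 / t > 0" using that by simp
    then have "ln t \<le> t - 1" "- ln t \<le> 1 / t - 1"
      using ln_le_minus_one[of t] ln_le_minus_one[of "1 / t"] that by (simp_all add: ln_div)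
    then show ?thesis using that \<open>1 / t > 0\<close> by linarith
  qed
  have b': "\<bar>ln (max (norm x) (norm y))\<bar> \<le> R + 1 / max (norm x) (norm y)" if "norm y < R" for y :: "real^2"
  proof -
    have "max (norm x) (norm y) > 0" "max (norm x) (norm y) < R"
      using x that assms(2) by (simp_all add: max.strict_coboundedI1)
    then show ?thesis using b[of "max (norm x) (norm y)"] by linarith
  qed
  show i: "integrable (disc R) (\<lambda>y. ln (max (norm x) (norm y)))"
  proof (rule integrable_bounded_disc[where C = "R + 1 / norm x"])
    fix y :: "real^2" assume "norm y < R"
    moreover have "1 / max (norm x) (norm y) \<le> 1 / norm x"
      using x by (intro divide_left_mono mult_pos_pos) (auto simp: max.strict_coboundedI1)
    ultimately show "norm (ln (max (norm x) (norm y))) \<le> R + 1 / norm x"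
      using b'[of y] by simp
  qed measurable
  let ?h = "\<lambda>s. R + 1 / max (norm x) s"
  have "((\<lambda>s. s * ?h s) integrable_on {0..R})"
    using x by (intro integrable_continuous_interval continuous_intros) (auto simp: max_def split: if_splits)
  then obtain I where I: "((\<lambda>s. s * ?h s) has_integral I) {0..R}" by blast
  have "I \<le> (R * R + 1) * (R - 0)"
  proof (rule has_integral_le[OF I])
    show "((\<lambda>s. R * R + 1) has_integral (R * R + 1) * (R - 0)) {0..R}"
      using has_integral_const_real[of "R * R + 1" 0 R] R by (simp add: mult.commute)
    fix s assume s: "s \<in> {0..R}"
    have "s * (1 / max (norm x) s) \<le> 1"
      using x s by (simp add: field_simps max_def)
    moreover have "s * R \<le> R * R" using s R by simp
    ultimately show "s * ?h s \<le> R * R + 1" by (simp add: distrib_left)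
  qed
  then have I': "I \<le> R ^ 3 + R" by (simp add: power3_eq_cube algebra_simps)
  have "(\<integral>y. \<bar>ln (max (norm x) (norm y))\<bar> \<partial>disc R) \<le> (\<integral>y. ?h (norm y) \<partial>disc R)"
  proof (rule integral_mono)
    show "integrable (disc R) (\<lambda>y. ?h (norm y))"
    proof (rule integrable_bounded_disc[where C = "R + 1 / norm x"])
      fix y :: "real^2"
      have "1 / max (norm x) (norm y) \<le> 1 / norm x"
        using x by (intro divide_left_mono mult_pos_pos) (auto simp: max.strict_coboundedI1)
      then show "norm (?h (norm y)) \<le> R + 1 / norm x"
        using R x by (simp add: abs_of_nonneg max.coboundedI1)
    qed measurable
  qed (use i b' in auto)
  also have "\<dots> = 2 * pi * I"
    using R x by (intro integral_radial[OF R _ _ I]) auto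
  also have "\<dots> \<le> 2 * pi * (R ^ 3 + R)"
    using I' by (intro mult_left_mono) auto
  finally show "(\<integral>y. \<bar>ln (max (norm x) (norm y))\<bar> \<partial>disc R) \<le> 2 * pi * (R ^ 3 + R)" .
qed

lemma kernel_expansion_AE:
  assumes "x \<noteq> 0"
  shows "AE y in disc R. (\<lambda>n. kernel_term x n y) sums (log_kernel x y + ln (max (norm x) (norm y)))
    \<and> summable (\<lambda>n. \<bar>kernel_term x n y\<bar>)"
  using AE_disc_norm_neq[of "norm x" R] AE_space
proof eventually_elim
  case (elim y)
  define q where "q = norm y * norm x / (max (norm x) (norm y))\<^sup>2"
  have q: "0 \<le> q" "q < 1"
    using elim assms by (auto simp: q_def max_def power2_eq_square)
  have "summable (\<lambda>n. \<bar>kernel_term x n y\<bar>)"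
  proof (rule summable_comparison_test'[where N = 0])
    show "summable (\<lambda>n. q ^ n)" using q by (simp add: summable_geometric)
    fix n
    have "\<bar>Re ((cpx y * cnj (cpx x)) ^ n)\<bar> \<le> cmod ((cpx y * cnj (cpx x)) ^ n)"
      by (rule abs_Re_le_cmod)
    also have "\<dots> = (norm y * norm x) ^ n"
      by (simp add: norm_power norm_mult)
    finally have "\<bar>kernel_term x n y\<bar> \<le> (norm y * norm x) ^ n / (real n * max (norm x) (norm y) ^ (2 * n))"
      by (simp add: kernel_term_def abs_mult divide_right_mono)
    also have "\<dots> = q ^ n / real n"
      by (simp add: q_def power_divide power_mult)
    also have "\<dots> \<le> q ^ n"
      using q by (cases "n = 0") (simp_all add: divide_le_eq mult_le_cancel_left1)
    finally show "norm \<bar>kernel_term x n y\<bar> \<le> q ^ n" by simp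
  qed
  then show ?case using kernel_expansion[OF assms] elim by blast
qed

section \<open>Potentials of monomials\<close>

definition kernel_bound :: "real \<Rightarrow> real" where
  "kernel_bound R = 2 * pi * (R ^ 3 + R) + (\<Sum>n. 4 * pi * R\<^sup>2 * (1 / real n ^ 2))"

lemma summable_inverse_squares: "summable (\<lambda>n. c * (1 / real n ^ 2))"
  using inverse_power_summable[of 2, where 'a = real] by (intro summable_mult) (simp add: divide_inverse)

lemma kernel_terms_integrable:
  assumes "x \<noteq> 0" "norm x < R"
  shows "summable (\<lambda>n. \<integral>y. norm (\<bar>kernel_term x n y\<bar>) \<partial>disc R)"
    and "(\<Sum>n. \<integral>y. norm (\<bar>kernel_term x n y\<bar>) \<partial>disc R) \<le> (\<Sum>n. 4 * pi * R\<^sup>2 * (1 / real n ^ 2))"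
proof -
  have le: "(\<integral>y. norm (\<bar>kernel_term x n y\<bar>) \<partial>disc R) \<le> 4 * pi * R\<^sup>2 * (1 / real n ^ 2)" for n
    using integral_abs_kernel_term_le(2)[OF assms, of n] by simp
  show s: "summable (\<lambda>n. \<integral>y. norm (\<bar>kernel_term x n y\<bar>) \<partial>disc R)"
  proof (rule summable_comparison_test'[OF summable_inverse_squares[of "4 * pi * R\<^sup>2"], where N = 0])
    fix n
    show "norm (\<integral>y. norm (\<bar>kernel_term x n y\<bar>) \<partial>disc R) \<le> 4 * pi * R\<^sup>2 * (1 / real n ^ 2)"
      using le[of n] by simp
  qed
  show "(\<Sum>n. \<integral>y. norm (\<bar>kernel_term x n y\<bar>) \<partial>disc R) \<le> (\<Sum>n. 4 * pi * R\<^sup>2 * (1 / real n ^ 2))"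
    by (rule suminf_le[OF le s summable_inverse_squares[of "4 * pi * R\<^sup>2"]])
qed

text \<open>The bound does not depend on \<open>x\<close>; this is what makes Fubini's theorem applicable to
  potentials of merely integrable functions.\<close>

lemma log_kernel_integrable:
  assumes "x \<noteq> 0" "norm x < R"
  shows "integrable (disc R) (log_kernel x)"
    and "(\<integral>y. \<bar>log_kernel x y\<bar> \<partial>disc R) \<le> kernel_bound R"
proof -
  let ?f = "\<lambda>n y. \<bar>kernel_term x n y\<bar>"
  let ?S = "\<lambda>y. \<Sum>n. ?f n y"
  note E = kernel_expansion_AE[OF assms(1), of R]
  have AEs: "AE y in disc R. summable (\<lambda>n. norm (?f n y))"
    using E by eventually_elim simp
  note i = integral_abs_kernel_term_le(1)[OF assms]
  have iS: "integrable (disc R) ?S"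
    by (rule integrable_suminf[OF i AEs kernel_terms_integrable(1)[OF assms]])
  have "(\<integral>y. ?S y \<partial>disc R) = (\<Sum>n. \<integral>y. ?f n y \<partial>disc R)"
    by (rule integral_suminf[OF i AEs kernel_terms_integrable(1)[OF assms]])
  then have vS: "(\<integral>y. ?S y \<partial>disc R) \<le> (\<Sum>n. 4 * pi * R\<^sup>2 * (1 / real n ^ 2))"
    using kernel_terms_integrable(2)[OF assms] by simp
  let ?L = "\<lambda>y. \<bar>ln (max (norm x) (norm y))\<bar>"
  have iL: "integrable (disc R) ?L"
    using abs_ln_max_integral(1)[OF assms] by (rule integrable_abs)
  have le: "AE y in disc R. \<bar>log_kernel x y\<bar> \<le> ?L y + ?S y"
    using E
  proof eventually_elim
    case (elim y)
    have "norm (\<Sum>n. kernel_term x n y) \<le> (\<Sum>n. norm (kernel_term x n y))"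
      using elim by (intro summable_norm) simp
    moreover have "(\<Sum>n. kernel_term x n y) = log_kernel x y + ln (max (norm x) (norm y))"
      using elim by (simp add: sums_iff)
    ultimately show ?case by simp
  qed
  have iLS: "integrable (disc R) (\<lambda>y. ?L y + ?S y)"
    using iL iS by (rule Bochner_Integration.integrable_add)
  have mk: "log_kernel x \<in> borel_measurable (disc R)"
    by (rule borel_measurable_disc) measurable
  show ik: "integrable (disc R) (log_kernel x)"
  proof (rule Bochner_Integration.integrable_bound[OF iLS mk])
    show "AE y in disc R. norm (log_kernel x y) \<le> norm (?L y + ?S y)"
      using le by eventually_elim simp
  qed
  have "(\<integral>y. \<bar>log_kernel x y\<bar> \<partial>disc R) \<le> (\<integral>y. ?L y + ?S y \<partial>disc R)"
    by (rule integral_mono_AE[OF integrable_abs[OF ik] iLS le])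
  also have "\<dots> = (\<integral>y. ?L y \<partial>disc R) + (\<integral>y. ?S y \<partial>disc R)"
    using iL iS by (rule Bochner_Integration.integral_add)
  also have "\<dots> \<le> kernel_bound R"
    unfolding kernel_bound_def using abs_ln_max_integral(2)[OF assms] vS by (rule add_mono)
  finally show "(\<integral>y. \<bar>log_kernel x y\<bar> \<partial>disc R) \<le> kernel_bound R" .
qed

lemma integrable_continuous_disc:
  fixes f :: "real^2 \<Rightarrow> 'b::{banach, second_countable_topology}"
  assumes "continuous_on UNIV f"
  shows "integrable (disc R) f"
proof -
  have "compact (f ` cball 0 R)"
    by (intro compact_continuous_image compact_cball continuous_on_subset[OF assms]) simp
  then have "bounded (f ` cball 0 R)"
    by (rule compact_imp_bounded)
  then obtain C where C: "\<forall>y\<in>f ` cball 0 R. norm y \<le> C"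
    unfolding bounded_iff by (elim exE)
  show ?thesis
  proof (rule integrable_bounded_disc)
    show "f \<in> borel_measurable (disc R)"
      by (rule borel_measurable_disc, rule borel_measurable_continuous_onI, rule assms)
    show "norm (f x) \<le> C" if "norm x < R" for x
      using C that by simp
  qed
qed

lemma continuous_on_monomial [continuous_intros]: "continuous_on S (monomial m l)"
  unfolding monomial_def by (intro continuous_intros)

lemma monomial_measurable [measurable]: "monomial m l \<in> borel_measurable borel"
  unfolding monomial_def by measurable

lemma norm_monomial: "cmod (monomial m l x) = norm x ^ (m + 2 * l)"
  by (simp add: monomial_def norm_mult norm_power power_add mult.commute)

lemma monomial_le: "norm x < R \<Longrightarrow> cmod (monomial m l x) \<le> R ^ (m + 2 * l)"
  unfolding norm_monomial by (intro power_mono) auto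

lemma radial_power_integral:
  assumes "0 < r" "r < R" "m \<ge> 1"
  shows "((\<lambda>s. s * (s ^ (2 * m + 2 * l) / (2 * real m * max r s ^ (2 * m)))) has_integral
     (R ^ (2 * l + 2) / (4 * real m * (real l + 1)) - r ^ (2 * l + 2) / (4 * (real l + 1) * (real m + real l + 1)))) {0..R}"
proof -
  let ?g = "\<lambda>s. s * (s ^ (2 * m + 2 * l) / (2 * real m * max r s ^ (2 * m)))"
  define F where "F s = s ^ (2 * m + 2 * l + 2) / (real (2 * m + 2 * l + 2) * (2 * real m * r ^ (2 * m)))" for s
  define G where "G s = s ^ (2 * l + 2) / (real (2 * l + 2) * (2 * real m))" for s
  have d: "((\<lambda>s. s ^ (k + 2) / (real (k + 2) * c)) has_vector_derivative s ^ (k + 1) / c) (at s within A)"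
    if "c \<noteq> 0" for k c A and s :: real
  proof -
    have "((\<lambda>s. s ^ (k + 2)) has_real_derivative real (k + 2) * s ^ (k + 1)) (at s within A)"
      using DERIV_power[OF DERIV_ident, where n = "k + 2"] by simp
    then have "((\<lambda>s. s ^ (k + 2) / (real (k + 2) * c)) has_real_derivative
        real (k + 2) * s ^ (k + 1) / (real (k + 2) * c)) (at s within A)"
      by (rule DERIV_cdivide)
    then show ?thesis
      by (simp add: has_real_derivative_iff_has_vector_derivative del: of_nat_add)
  qed
  have c: "2 * real m * r ^ (2 * m) \<noteq> 0" "2 * real m \<noteq> 0"
    using assms by auto
  have "((\<lambda>s. s ^ (2 * m + 2 * l + 1) / (2 * real m * r ^ (2 * m))) has_integral (F r - F 0)) {0..r}"
    unfolding F_def by (rule fundamental_theorem_of_calculus) (use assms in simp, rule d[OF c(1)])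
  then have 1: "(?g has_integral (F r - F 0)) {0..r}"
  proof (rule has_integral_eq[rotated])
    fix s assume "s \<in> {0..r}"
    then have "max r s = r" by simp
    then show "s ^ (2 * m + 2 * l + 1) / (2 * real m * r ^ (2 * m)) = ?g s"
      by simp
  qed
  have "((\<lambda>s. s ^ (2 * l + 1) / (2 * real m)) has_integral (G R - G r)) {r..R}"
    unfolding G_def by (rule fundamental_theorem_of_calculus) (use assms in simp, rule d[OF c(2)])
  then have 2: "(?g has_integral (G R - G r)) {r..R}"
  proof (rule has_integral_eq[rotated])
    fix s assume "s \<in> {r..R}"
    then have "s > 0" "max r s = s" using assms by auto
    then show "s ^ (2 * l + 1) / (2 * real m) = ?g s"
      by (simp add: power_add)
  qed
  have "(?g has_integral (F r - F 0 + (G R - G r))) {0..R}"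
    using has_integral_combine[OF _ _ 1 2] assms by simp
  moreover have "F r - F 0 + (G R - G r) =
     R ^ (2 * l + 2) / (4 * real m * (real l + 1)) - r ^ (2 * l + 2) / (4 * (real l + 1) * (real m + real l + 1))"
  proof -
    define a b where "a = r ^ (2 * l + 2)" and "b = R ^ (2 * l + 2)"
    have F: "F r - F 0 = a / (2 * (real m + real l + 1) * (2 * real m))"
    proof -
      have "r ^ (2 * m + 2 * l + 2) = r ^ (2 * m) * a"
        by (simp add: a_def power_add)
      moreover have "real (2 * m + 2 * l + 2) = 2 * (real m + real l + 1)" by simp
      ultimately show ?thesis
        unfolding F_def using assms by (simp del: of_nat_add)
    qed
    have G: "G R - G r = (b - a) / (2 * (real l + 1) * (2 * real m))"
      by (simp add: G_def a_def b_def diff_divide_distrib add.commute)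
    have "a / (2 * (M + L) * (2 * M)) + (b - a) / (2 * L * (2 * M)) = b / (4 * M * L) - a / (4 * L * (M + L))"
      if "M > 0" "L > 0" for M L :: real
      using that by (simp add: divide_simps) (simp add: algebra_simps)
    from this[of "real m" "real l + 1"] show ?thesis
      unfolding F G a_def[symmetric] b_def[symmetric] using assms by (simp add: add_ac)
  qed
  ultimately show ?thesis by simp
qed

text \<open>Writing the real part as half the sum of a number and its conjugate splits the integrand
  into the frequencies \<open>m + n\<close> and \<open>m - n\<close>; only \<open>n = m\<close> leaves a rotation-invariant part.\<close>

lemma integral_kernel_term_monomial:
  assumes "x \<noteq> 0" "norm x < R" "m \<ge> 1"
  shows "(\<integral>y. of_real (kernel_term x n y) * monomial m l y \<partial>disc R) =
    (if n = m then of_real (2 * pi * (R ^ (2 * l + 2) / (4 * real m * (real l + 1))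
        - norm x ^ (2 * l + 2) / (4 * (real l + 1) * (real m + real l + 1)))) * cpx x ^ m else 0)"
proof (cases "n = 0")
  case True
  then show ?thesis using assms(3) by simp
next
  case False
  define r where "r = norm x"
  have r: "0 < r" "r < R" using assms by (auto simp: r_def)
  have mx: "max r t \<noteq> 0" for t using r by (simp add: max_def)
  define h where "h s = s ^ (2 * l) / (2 * real n * max r s ^ (2 * n))" for s
  have h: "continuous_on UNIV (\<lambda>y::real^2. h (norm y))"
    unfolding h_def using False mx by (intro continuous_intros) auto
  define G1 where "G1 y = of_real (h (norm y)) * cnj (cpx x) ^ n" for y :: "real^2"
  define G2 where "G2 y = of_real (h (norm y)) * cpx x ^ n" for y :: "real^2"
  have cG: "continuous_on UNIV G1" "continuous_on UNIV G2"
    unfolding G1_def G2_def by (intro continuous_intros h)+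
  have mG: "G1 \<in> borel_measurable (disc R)" "G2 \<in> borel_measurable (disc R)"
    using cG by (blast intro: borel_measurable_disc borel_measurable_continuous_onI)+
  have rG: "G1 (rot c y) = G1 y" "G2 (rot c y) = G2 y" if "cmod c = 1" for c y
    using that by (simp_all add: G1_def G2_def norm_rot)
  have "of_real (kernel_term x n y) * monomial m l y =
    G1 y * (cpx y ^ (n + m) * cnj (cpx y) ^ 0) + G2 y * (cpx y ^ m * cnj (cpx y) ^ n)" for y
  proof -
    define w where "w = (cpx y * cnj (cpx x)) ^ n"
    have "of_real (kernel_term x n y) = (w + cnj w) / of_real (2 * (real n * max r (norm y) ^ (2 * n)))"
      unfolding kernel_term_def w_def[symmetric] r_def[symmetric]
      by (simp only: complex_add_cnj of_real_divide[symmetric]) simp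
    then show ?thesis
      unfolding monomial_def G1_def G2_def h_def w_def
      by (simp add: power_mult_distrib power_add field_simps) (simp add: add_divide_distrib)
  qed
  then have "(\<integral>y. of_real (kernel_term x n y) * monomial m l y \<partial>disc R) =
    (\<integral>y. G1 y * (cpx y ^ (n + m) * cnj (cpx y) ^ 0) + G2 y * (cpx y ^ m * cnj (cpx y) ^ n) \<partial>disc R)"
    by simp
  also have "\<dots> = (\<integral>y. G1 y * (cpx y ^ (n + m) * cnj (cpx y) ^ 0) \<partial>disc R) +
      (\<integral>y. G2 y * (cpx y ^ m * cnj (cpx y) ^ n) \<partial>disc R)"
    by (intro Bochner_Integration.integral_add integrable_continuous_disc continuous_intros cG)
  also have "(\<integral>y. G1 y * (cpx y ^ (n + m) * cnj (cpx y) ^ 0) \<partial>disc R) = 0"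
    by (rule integral_off_diagonal_eq_0[OF _ mG(1)]) (use assms(3) rG in auto)
  finally have eq: "(\<integral>y. of_real (kernel_term x n y) * monomial m l y \<partial>disc R) =
      (\<integral>y. G2 y * (cpx y ^ m * cnj (cpx y) ^ n) \<partial>disc R)" by simp
  show ?thesis
  proof (cases "n = m")
    case False
    have "(\<integral>y. G2 y * (cpx y ^ m * cnj (cpx y) ^ n) \<partial>disc R) = 0"
      by (rule integral_off_diagonal_eq_0[OF _ mG(2)]) (use False rG in auto)
    then show ?thesis using False eq by simp
  next
    case True
    let ?h = "\<lambda>s. s ^ (2 * m + 2 * l) / (2 * real m * max r s ^ (2 * m))"
    have "G2 y * (cpx y ^ m * cnj (cpx y) ^ n) = cpx x ^ m * of_real (?h (norm y))" for y
      unfolding True G2_def h_def cpx_times_cnj_power by (simp add: power_add mult_ac)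
    then have "(\<integral>y. G2 y * (cpx y ^ m * cnj (cpx y) ^ n) \<partial>disc R) = cpx x ^ m * of_real (\<integral>y. ?h (norm y) \<partial>disc R)"
      by (simp only: integral_mult_right_zero integral_complex_of_real)
    also have "(\<integral>y. ?h (norm y) \<partial>disc R) = 2 * pi * (R ^ (2 * l + 2) / (4 * real m * (real l + 1)) - r ^ (2 * l + 2) / (4 * (real l + 1) * (real m + real l + 1)))"
      by (rule integral_radial[OF _ _ _ radial_power_integral[OF r assms(3)]]) (use r in auto)
    finally show ?thesis using True eq by (simp add: r_def mult.commute)
  qed
qed

text \<open>Up to the factor \<open>2 \<pi>\<close> this is the potential of \<open>z^m |z|^(2l)\<close>. The term
  \<open>- ln (max |x| |y|)\<close> does not contribute since it is radial in \<open>y\<close> and \<open>m \<ge> 1\<close>.\<close>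

lemma integral_log_kernel_monomial:
  assumes "x \<noteq> 0" "norm x < R" "m \<ge> 1"
  shows "(\<integral>y. of_real (log_kernel x y) * monomial m l y \<partial>disc R) =
    of_real (2 * pi * (R ^ (2 * l + 2) / (4 * real m * (real l + 1))
        - norm x ^ (2 * l + 2) / (4 * (real l + 1) * (real m + real l + 1)))) * cpx x ^ m"
    (is "_ = ?V")
proof -
  let ?P = "R ^ (m + 2 * l)"
  let ?f = "\<lambda>n y. complex_of_real (kernel_term x n y) * monomial m l y"
  let ?L = "\<lambda>y. complex_of_real (ln (max (norm x) (norm y)))"
  note E = kernel_expansion_AE[OF assms(1), of R]
  have R: "R > 0" using assms(2) norm_ge_zero[of x] by linarith
  have mx: "max (norm x) t > 0" for t using assms(1) by (simp add: max.strict_coboundedI1)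
  have nf: "norm (?f n y) \<le> \<bar>kernel_term x n y\<bar> * ?P" if "norm y < R" for n y
    using monomial_le[OF that, of m l] by (simp add: norm_mult mult_left_mono)
  have i: "integrable (disc R) (?f n)" for n
  proof (rule integrable_bounded_disc[where C = "1 * ?P"])
    show "?f n \<in> borel_measurable (disc R)"
      by (rule borel_measurable_disc) measurable
    fix y :: "real^2" assume "norm y < R"
    from nf[OF this, of n] kernel_term_le_1[OF assms(1), of n y] show "norm (?f n y) \<le> 1 * ?P"
      using R by (elim order_trans) (intro mult_right_mono, auto)
  qed
  have s: "AE y in disc R. summable (\<lambda>n. norm (?f n y))"
    using E by eventually_elim (simp add: norm_mult summable_mult2)
  have si: "summable (\<lambda>n. \<integral>y. norm (?f n y) \<partial>disc R)"
  proof (rule summable_comparison_test'[where N = 0])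
    show "summable (\<lambda>n. (\<integral>y. norm (\<bar>kernel_term x n y\<bar>) \<partial>disc R) * ?P)"
      by (intro summable_mult2 kernel_terms_integrable(1) assms)
    fix n
    have "(\<integral>y. norm (?f n y) \<partial>disc R) \<le> (\<integral>y. \<bar>kernel_term x n y\<bar> * ?P \<partial>disc R)"
      by (rule integral_mono) (use i integral_abs_kernel_term_le(1)[OF assms(1,2)] nf in auto)
    then show "norm (\<integral>y. norm (?f n y) \<partial>disc R) \<le> (\<integral>y. norm (\<bar>kernel_term x n y\<bar>) \<partial>disc R) * ?P"
      by simp
  qed
  have "(\<lambda>n. \<integral>y. ?f n y \<partial>disc R) sums (\<integral>y. (\<Sum>n. ?f n y) \<partial>disc R)"
    by (rule sums_integral[OF i s si])
  moreover have "(\<lambda>n. \<integral>y. ?f n y \<partial>disc R) sums ?V"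
    using sums_single[of m "\<lambda>_. ?V"] unfolding integral_kernel_term_monomial[OF assms] .
  ultimately have 1: "(\<integral>y. (\<Sum>n. ?f n y) \<partial>disc R) = ?V"
    by (rule sums_unique2)
  have iS: "integrable (disc R) (\<lambda>y. \<Sum>n. ?f n y)"
    by (rule integrable_suminf[OF i s si])
  have cL: "continuous_on UNIV ?L"
    using mx by (intro continuous_intros) (auto simp: less_le)
  have iL: "integrable (disc R) (\<lambda>y. ?L y * monomial m l y)"
    by (intro integrable_continuous_disc continuous_intros cL)
  have 2: "(\<integral>y. ?L y * monomial m l y \<partial>disc R) = 0"
  proof -
    let ?G = "\<lambda>y. ?L y * of_real (norm y ^ (2 * l))"
    have "(\<integral>y. ?G y * (cpx y ^ m * cnj (cpx y) ^ 0) \<partial>disc R) = 0"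
    proof (rule integral_off_diagonal_eq_0)
      show "?G \<in> borel_measurable (disc R)"
        by (rule borel_measurable_disc) measurable
    qed (use assms(3) in \<open>auto simp: norm_rot\<close>)
    then show ?thesis by (simp add: monomial_def mult.assoc)
  qed
  have "(\<integral>y. of_real (log_kernel x y) * monomial m l y \<partial>disc R) =
      (\<integral>y. (\<Sum>n. ?f n y) - ?L y * monomial m l y \<partial>disc R)"
  proof (rule integral_cong_AE)
    show "(\<lambda>y. of_real (log_kernel x y) * monomial m l y) \<in> borel_measurable (disc R)"
      by (rule borel_measurable_disc) measurable
    show "(\<lambda>y. (\<Sum>n. ?f n y) - ?L y * monomial m l y) \<in> borel_measurable (disc R)"
      using iS iL by (intro borel_measurable_diff borel_measurable_integrable)
    show "AE y in disc R. of_real (log_kernel x y) * monomial m l y = (\<Sum>n. ?f n y) - ?L y * monomial m l y"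
      using E
    proof eventually_elim
      case (elim y)
      have "(\<lambda>n. ?f n y) sums (of_real (log_kernel x y + ln (max (norm x) (norm y))) * monomial m l y)"
        using elim by (intro sums_mult2 sums_of_real) simp
      then show ?case by (simp add: sums_iff algebra_simps)
    qed
  qed
  also have "\<dots> = ?V"
    using iS iL 1 2 by (subst Bochner_Integration.integral_diff) auto
  finally show ?thesis .
qed

section \<open>Moments of eigenfunctions\<close>

lemma log_kernel_commute: "log_kernel x y = log_kernel y x"
  by (simp add: log_kernel_def norm_minus_commute)

lemma AE_disc_nonzero: "AE x in disc R. x \<noteq> 0"
  using AE_disc_norm_neq[of 0 R] by simp

lemma pair_sigma_finite_disc: "pair_sigma_finite (disc R) (disc R)"
  using finite_measure_disc[of R] by (intro pair_sigma_finite.intro finite_measure.axioms(1))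

text \<open>Integrating first over \<open>x\<close>, where the other factor is bounded, only uses the uniform bound
  on the kernel.\<close>

lemma kernel_product_integrable:
  fixes p :: "real^2 \<Rightarrow> complex"
  assumes f: "integrable (disc R) f" and p: "p \<in> borel_measurable borel"
    and bp: "\<And>x. norm x < R \<Longrightarrow> cmod (p x) \<le> P"
  shows "integrable (disc R \<Otimes>\<^sub>M disc R) (\<lambda>(y, x). of_real (log_kernel x y * f y) * p x)"
proof -
  interpret pair_sigma_finite "disc R" "disc R" by (rule pair_sigma_finite_disc)
  note [measurable] = p
  have pd [measurable]: "p \<in> borel_measurable (disc R)"
    by (rule borel_measurable_disc[OF p])
  have fd [measurable]: "f \<in> borel_measurable (disc R)"
    using f by (rule borel_measurable_integrable)
  have [measurable]: "(\<lambda>(y, x). log_kernel x y) \<in> borel_measurable (disc R \<Otimes>\<^sub>M disc R)"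
    unfolding log_kernel_def by measurable
  let ?F = "\<lambda>(y, x). of_real (log_kernel x y * f y) * p x"
  have mF [measurable]: "?F \<in> borel_measurable (disc R \<Otimes>\<^sub>M disc R)"
    by measurable
  have good: "AE y in disc R. y \<noteq> 0 \<and> norm y < R"
    using AE_disc_nonzero[of R] AE_space by eventually_elim simp
  have i1: "integrable (disc R) (\<lambda>x. of_real (log_kernel x y * f y) * p x)"
    and i2: "(\<integral>x. norm (of_real (log_kernel x y * f y) * p x) \<partial>disc R) \<le> kernel_bound R * P * \<bar>f y\<bar>"
    if y: "y \<noteq> 0" "norm y < R" for y
  proof -
    have P: "0 \<le> P" using bp[OF y(2)] norm_ge_zero order_trans by blast
    have ik: "integrable (disc R) (\<lambda>x. log_kernel x y)"
      using log_kernel_integrable(1)[OF y] log_kernel_commute[of _ y] by simp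
    have ib: "integrable (disc R) (\<lambda>x. \<bar>log_kernel x y\<bar> * (P * \<bar>f y\<bar>))"
      using ik by simp
    have [measurable]: "(\<lambda>x. log_kernel x y) \<in> borel_measurable (disc R)"
      using ik by (rule borel_measurable_integrable)
    have le: "norm (of_real (log_kernel x y * f y) * p x) \<le> \<bar>log_kernel x y\<bar> * (P * \<bar>f y\<bar>)" if "norm x < R" for x
      using mult_left_mono[OF bp[OF that], of "\<bar>log_kernel x y\<bar> * \<bar>f y\<bar>"]
      by (simp add: norm_mult abs_mult mult_ac)
    show i: "integrable (disc R) (\<lambda>x. of_real (log_kernel x y * f y) * p x)"
    proof (rule Bochner_Integration.integrable_bound[OF ib])
      show "AE x in disc R. norm (of_real (log_kernel x y * f y) * p x) \<le> norm (\<bar>log_kernel x y\<bar> * (P * \<bar>f y\<bar>))"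
        using AE_space by eventually_elim (use le P in \<open>simp add: abs_mult\<close>)
    qed measurable
    have "(\<integral>x. norm (of_real (log_kernel x y * f y) * p x) \<partial>disc R) \<le> (\<integral>x. \<bar>log_kernel x y\<bar> * (P * \<bar>f y\<bar>) \<partial>disc R)"
      by (rule integral_mono[OF integrable_norm[OF i] ib]) (use le in simp)
    also have "\<dots> = (\<integral>x. \<bar>log_kernel y x\<bar> \<partial>disc R) * (P * \<bar>f y\<bar>)"
      using log_kernel_commute[of _ y] by simp
    also have "\<dots> \<le> kernel_bound R * (P * \<bar>f y\<bar>)"
      using log_kernel_integrable(2)[OF y] P by (intro mult_right_mono) auto
    finally show "(\<integral>x. norm (of_real (log_kernel x y * f y) * p x) \<partial>disc R) \<le> kernel_bound R * P * \<bar>f y\<bar>"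
      by (simp add: mult.assoc)
  qed
  show ?thesis
  proof (rule Fubini_integrable[OF mF])
    show "integrable (disc R) (\<lambda>y. \<integral>x. norm (?F (y, x)) \<partial>disc R)"
    proof (rule Bochner_Integration.integrable_bound)
      show "integrable (disc R) (\<lambda>y. kernel_bound R * P * \<bar>f y\<bar>)"
        using f by simp
      show "AE y in disc R. norm (\<integral>x. norm (?F (y, x)) \<partial>disc R) \<le> norm (kernel_bound R * P * \<bar>f y\<bar>)"
        using good
      proof eventually_elim
        case (elim y)
        have "0 \<le> (\<integral>x. norm (?F (y, x)) \<partial>disc R)" by simp
        moreover have "(\<integral>x. norm (?F (y, x)) \<partial>disc R) \<le> kernel_bound R * P * \<bar>f y\<bar>"
          using i2 elim by simp
        ultimately show ?case by simp
      qed
    qed measurable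
    show "AE y in disc R. integrable (disc R) (\<lambda>x. ?F (y, x))"
      using good by eventually_elim (use i1 in simp)
  qed
qed

lemma AE_kernel_product_integrable:
  assumes f: "integrable (disc R) f"
  shows "AE x in disc R. integrable (disc R) (\<lambda>y. log_kernel x y * f y)"
proof -
  interpret pair_sigma_finite "disc R" "disc R" by (rule pair_sigma_finite_disc)
  have "AE x in disc R. integrable (disc R) (\<lambda>y. complex_of_real (log_kernel x y * f y) * 1)"
    using kernel_product_integrable[OF f, of "\<lambda>_. 1" 1] by (intro AE_integrable_snd) simp
  then show ?thesis
    by eventually_elim (simp only: mult_1_right complex_of_real_integrable_eq)
qed

text \<open>The operator is symmetric; one factor is kept merely integrable and the other one bounded.\<close>

lemma kernel_swap:
  fixes p :: "real^2 \<Rightarrow> complex"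
  assumes f: "integrable (disc R) f" and p: "p \<in> borel_measurable borel"
    and bp: "\<And>x. norm x < R \<Longrightarrow> cmod (p x) \<le> P"
  shows "(\<integral>x. of_real (\<integral>y. log_kernel x y * f y \<partial>disc R) * p x \<partial>disc R) =
    (\<integral>y. of_real (f y) * (\<integral>x. of_real (log_kernel y x) * p x \<partial>disc R) \<partial>disc R)"
proof -
  interpret pair_sigma_finite "disc R" "disc R" by (rule pair_sigma_finite_disc)
  have "(\<integral>x. of_real (\<integral>y. log_kernel x y * f y \<partial>disc R) * p x \<partial>disc R) =
    (\<integral>x. (\<integral>y. of_real (log_kernel x y * f y) * p x \<partial>disc R) \<partial>disc R)"
    by (simp only: integral_mult_left_zero integral_complex_of_real)
  also have "\<dots> = (\<integral>y. (\<integral>x. of_real (log_kernel x y * f y) * p x \<partial>disc R) \<partial>disc R)"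
    by (rule Fubini_integral) (rule kernel_product_integrable[OF assms])
  also have "\<dots> = (\<integral>y. of_real (f y) * (\<integral>x. of_real (log_kernel y x) * p x \<partial>disc R) \<partial>disc R)"
  proof -
    have "complex_of_real (log_kernel x y * f y) * p x = of_real (f y) * (of_real (log_kernel y x) * p x)" for x y
      by (simp add: log_kernel_commute[of x y])
    then show ?thesis by (simp only: integral_mult_right_zero)
  qed
  finally show ?thesis .
qed

definition moment :: "real \<Rightarrow> (real^2 \<Rightarrow> real) \<Rightarrow> nat \<Rightarrow> nat \<Rightarrow> complex" where
  "moment R f m l = (\<integral>x. of_real (f x) * monomial m l x \<partial>disc R)"

lemma L2_fun_integrable:
  assumes "L2_fun (ball 0 R) f"
  shows "integrable (disc R) f"
proof (rule Bochner_Integration.integrable_bound)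
  show "integrable (disc R) (\<lambda>x. 1 + (f x)\<^sup>2)"
    using assms integrable_continuous_disc[of "\<lambda>_. 1::real" R] unfolding L2_fun_def
    by (intro Bochner_Integration.integrable_add) auto
  show "f \<in> borel_measurable (disc R)"
    using assms by (simp add: L2_fun_def)
  show "AE x in disc R. norm (f x) \<le> norm (1 + (f x)\<^sup>2)"
  proof (rule AE_I2)
    fix x
    have "0 \<le> (\<bar>f x\<bar> - 1)\<^sup>2" by simp
    then have "2 * \<bar>f x\<bar> \<le> 1 + (f x)\<^sup>2" by (simp add: power2_diff)
    then show "norm (f x) \<le> norm (1 + (f x)\<^sup>2)" by simp
  qed
qed

lemma integrable_times_continuous:
  fixes g :: "real^2 \<Rightarrow> complex"
  assumes f: "integrable (disc R) f" and g: "continuous_on UNIV g"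
  shows "integrable (disc R) (\<lambda>x. of_real (f x) * g x)"
proof -
  have "compact (g ` cball 0 R)"
    by (intro compact_continuous_image compact_cball continuous_on_subset[OF g]) simp
  then have "bounded (g ` cball 0 R)"
    by (rule compact_imp_bounded)
  then obtain C where C: "\<forall>y\<in>g ` cball 0 R. norm y \<le> C"
    unfolding bounded_iff by (elim exE)
  have [measurable]: "f \<in> borel_measurable (disc R)" "g \<in> borel_measurable (disc R)"
    using f borel_measurable_disc[OF borel_measurable_continuous_onI[OF g]] by simp_all
  show ?thesis
  proof (rule Bochner_Integration.integrable_bound)
    show "integrable (disc R) (\<lambda>x. C * f x)" using f by simp
    show "AE x in disc R. norm (of_real (f x) * g x) \<le> norm (C * f x)"
      using AE_space
    proof eventually_elim
      case (elim x)
      then have "norm (g x) \<le> C" using C by simp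
      then have "norm (g x) \<le> \<bar>C\<bar>" by simp
      then have "\<bar>f x\<bar> * norm (g x) \<le> \<bar>f x\<bar> * \<bar>C\<bar>" by (rule mult_left_mono) simp
      then show ?case by (simp add: norm_mult abs_mult mult.commute)
    qed
  qed measurable
qed

lemma monomial_step: "of_real (norm x ^ (2 * l + 2)) * cpx x ^ m = monomial m (Suc l) x"
  by (simp add: monomial_def)

text \<open>Pair the eigenvalue equation with a monomial and move the operator to the monomial, whose
  potential is known explicitly.\<close>

lemma moment_recurrence:
  assumes f: "in_eigenspace (ball 0 R) \<tau> f" and m: "m \<ge> 1"
  shows "of_real \<tau> * moment R f m l =
    of_real (R ^ (2 * l + 2) / (4 * real m * (real l + 1))) * moment R f m 0
     - of_real (1 / (4 * (real l + 1) * (real m + real l + 1))) * moment R f m (Suc l)"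
proof -
  have i: "integrable (disc R) f"
    using f by (intro L2_fun_integrable) (simp add: in_eigenspace_def)
  have [measurable]: "f \<in> borel_measurable (disc R)"
    using i by (rule borel_measurable_integrable)
  have [measurable]: "monomial k j \<in> borel_measurable (disc R)" for k j
    by (rule borel_measurable_disc) measurable
  let ?A = "R ^ (2 * l + 2) / (4 * real m * (real l + 1))"
  let ?B = "1 / (4 * (real l + 1) * (real m + real l + 1))"
  have AE: "AE x in disc R. log_potential (ball 0 R) f x = \<tau> * f x"
    using f by (simp add: in_eigenspace_def)
  have "of_real (2 * pi) * (of_real \<tau> * moment R f m l) =
     (\<integral>x. of_real (2 * pi * (\<tau> * f x)) * monomial m l x \<partial>disc R)"
    unfolding moment_def by (simp flip: integral_mult_right_zero add: mult.assoc)
  also have "\<dots> = (\<integral>x. of_real (\<integral>y. log_kernel x y * f y \<partial>disc R) * monomial m l x \<partial>disc R)"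
  proof (rule integral_cong_AE)
    show "(\<lambda>x. of_real (2 * pi * (\<tau> * f x)) * monomial m l x) \<in> borel_measurable (disc R)"
      by measurable
    have [measurable]: "(\<lambda>(x, y). log_kernel x y * f y) \<in> borel_measurable (disc R \<Otimes>\<^sub>M disc R)"
      unfolding log_kernel_def by measurable
    interpret finite_measure "disc R" by (rule finite_measure_disc)
    show "(\<lambda>x. of_real (\<integral>y. log_kernel x y * f y \<partial>disc R) * monomial m l x) \<in> borel_measurable (disc R)"
      by measurable
    show "AE x in disc R. of_real (2 * pi * (\<tau> * f x)) * monomial m l x = of_real (\<integral>y. log_kernel x y * f y \<partial>disc R) * monomial m l x"
      using AE by eventually_elim (simp add: log_potential_def log_kernel_def field_simps)
  qed
  also have "\<dots> = (\<integral>y. of_real (f y) * (\<integral>x. of_real (log_kernel y x) * monomial m l x \<partial>disc R) \<partial>disc R)"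
    by (rule kernel_swap[OF i _ monomial_le]) measurable
  also have "\<dots> = (\<integral>y. of_real (2 * pi * ?A) * (of_real (f y) * monomial m 0 y) - of_real (2 * pi * ?B) * (of_real (f y) * monomial m (Suc l) y) \<partial>disc R)"
  proof (rule integral_cong_AE)
    have "(\<lambda>(y, x). complex_of_real (log_kernel y x) * monomial m l x) \<in> borel_measurable (disc R \<Otimes>\<^sub>M disc R)"
      unfolding log_kernel_def by measurable
    note [measurable] = this
    interpret finite_measure "disc R" by (rule finite_measure_disc)
    show "(\<lambda>y. of_real (f y) * (\<integral>x. of_real (log_kernel y x) * monomial m l x \<partial>disc R)) \<in> borel_measurable (disc R)"
      by measurable
    show "AE y in disc R. of_real (f y) * (\<integral>x. of_real (log_kernel y x) * monomial m l x \<partial>disc R) =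
      of_real (2 * pi * ?A) * (of_real (f y) * monomial m 0 y) - of_real (2 * pi * ?B) * (of_real (f y) * monomial m (Suc l) y)"
      using AE_disc_nonzero AE_space
    proof eventually_elim
      case (elim y)
      have "(\<integral>x. of_real (log_kernel y x) * monomial m l x \<partial>disc R) =
        of_real (2 * pi * (?A - norm y ^ (2 * l + 2) * ?B)) * cpx y ^ m"
        using integral_log_kernel_monomial[of y R m l] elim m by simp
      moreover have "of_real (f y) * (of_real (2 * pi * (A - n * B)) * z) =
         of_real (2 * pi * A) * (of_real (f y) * z) - of_real (2 * pi * B) * (of_real (f y) * (of_real n * z))"
        for A B n :: real and z :: complex
        by (simp add: algebra_simps)
      moreover have "monomial m 0 y = cpx y ^ m"
        by (simp add: monomial_def)
      ultimately show ?case
        by (simp only: monomial_step[symmetric])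
    qed
  qed measurable
  also have "\<dots> = of_real (2 * pi * ?A) * moment R f m 0 - of_real (2 * pi * ?B) * moment R f m (Suc l)"
    unfolding moment_def
    by (subst Bochner_Integration.integral_diff)
      (intro integrable_mult_right integrable_times_continuous[OF i] continuous_intros
        | simp only: integral_mult_right_zero)+
  finally have "of_real (2 * pi) * (of_real \<tau> * moment R f m l) =
      of_real (2 * pi) * (of_real ?A * moment R f m 0 - of_real ?B * moment R f m (Suc l))"
    by (simp only: of_real_mult mult.assoc right_diff_distrib)
  then show ?thesis
    by (subst (asm) mult_cancel_left) simp
qed

lemma continuous_on_real_polynomial_function:
  "real_polynomial_function p \<Longrightarrow> continuous_on UNIV p"
  by (rule continuous_at_imp_continuous_on) (simp add: continuous_real_polymonial_function)

text \<open>The functions \<open>w\<close> that are orthogonal to \<open>f\<close> together with all their multiples by powers of \<open>z\<close> and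
  its conjugate form a module over the real polynomials: a real linear form is
  \<open>\<alpha> z\<close> plus its conjugate for some \<open>\<alpha>\<close>.\<close>

lemma polynomial_annihilator:
  fixes f :: "real^2 \<Rightarrow> real"
  assumes f: "integrable (disc R) f" and p: "real_polynomial_function p"
    and w: "continuous_on UNIV w"
      "\<And>a b. (\<integral>x. of_real (f x) * (w x * (cpx x ^ a * cnj (cpx x) ^ b)) \<partial>disc R) = 0"
  shows "(\<integral>x. of_real (f x) * (of_real (p x) * w x * (cpx x ^ a * cnj (cpx x) ^ b)) \<partial>disc R) = 0"
  using p w
proof (induction p arbitrary: w a b rule: real_polynomial_function.induct)
  case (linear p)
  interpret p: bounded_linear p by fact
  define \<alpha> where "\<alpha> = Complex (p (axis 1 1) / 2) (- p (axis 2 1) / 2)"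
  have dec: "(x $ 1) *\<^sub>R axis 1 1 + (x $ 2) *\<^sub>R axis 2 1 = x" for x :: "real^2"
    by (simp add: vec_eq_iff forall_2 axis_def)
  have coord: "p x = (x $ 1) * p (axis 1 1) + (x $ 2) * p (axis 2 1)" for x
  proof -
    have "p ((x $ 1) *\<^sub>R axis 1 1 + (x $ 2) *\<^sub>R axis 2 1) = (x $ 1) * p (axis 1 1) + (x $ 2) * p (axis 2 1)"
      by (simp only: p.add p.scaleR real_scaleR_def)
    then show ?thesis by (simp only: dec)
  qed
  have px: "of_real (p x) = \<alpha> * cpx x + cnj \<alpha> * cnj (cpx x)" for x
    by (subst coord) (simp add: \<alpha>_def cpx_def complex_eq_iff algebra_simps)
  have "of_real (f x) * (of_real (p x) * w x * (cpx x ^ a * cnj (cpx x) ^ b)) =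
     \<alpha> * (of_real (f x) * (w x * (cpx x ^ Suc a * cnj (cpx x) ^ b)))
     + cnj \<alpha> * (of_real (f x) * (w x * (cpx x ^ a * cnj (cpx x) ^ Suc b)))" for x
    unfolding px by (simp add: algebra_simps)
  then have "(\<integral>x. of_real (f x) * (of_real (p x) * w x * (cpx x ^ a * cnj (cpx x) ^ b)) \<partial>disc R) =
     (\<integral>x. \<alpha> * (of_real (f x) * (w x * (cpx x ^ Suc a * cnj (cpx x) ^ b)))
     + cnj \<alpha> * (of_real (f x) * (w x * (cpx x ^ a * cnj (cpx x) ^ Suc b))) \<partial>disc R)"
    by (simp only:)
  also have "\<dots> = (\<integral>x. \<alpha> * (of_real (f x) * (w x * (cpx x ^ Suc a * cnj (cpx x) ^ b))) \<partial>disc R)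
     + (\<integral>x. cnj \<alpha> * (of_real (f x) * (w x * (cpx x ^ a * cnj (cpx x) ^ Suc b))) \<partial>disc R)"
    by (intro Bochner_Integration.integral_add integrable_mult_right integrable_times_continuous[OF f]
        continuous_intros linear.prems)
  also have "\<dots> = 0"
    by (simp only: integral_mult_right_zero linear.prems mult_zero_right add_0)
  finally show ?case .
next
  case (const c)
  have "of_real (f x) * (of_real c * w x * (cpx x ^ a * cnj (cpx x) ^ b)) =
      of_real c * (of_real (f x) * (w x * (cpx x ^ a * cnj (cpx x) ^ b)))" for x
    by (simp add: mult_ac)
  then show ?case by (simp only: integral_mult_right_zero const.prems mult_zero_right)
next
  case (add p q)
  have c: "continuous_on UNIV p" "continuous_on UNIV q"
    using add.hyps by (simp_all add: continuous_on_real_polynomial_function)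
  have "of_real (f x) * (of_real (p x + q x) * w x * (cpx x ^ a * cnj (cpx x) ^ b)) =
      of_real (f x) * (of_real (p x) * w x * (cpx x ^ a * cnj (cpx x) ^ b))
      + of_real (f x) * (of_real (q x) * w x * (cpx x ^ a * cnj (cpx x) ^ b))" for x
    by (simp add: algebra_simps)
  then have "(\<integral>x. of_real (f x) * (of_real (p x + q x) * w x * (cpx x ^ a * cnj (cpx x) ^ b)) \<partial>disc R) =
      (\<integral>x. of_real (f x) * (of_real (p x) * w x * (cpx x ^ a * cnj (cpx x) ^ b))
      + of_real (f x) * (of_real (q x) * w x * (cpx x ^ a * cnj (cpx x) ^ b)) \<partial>disc R)"
    by (simp only:)
  also have "\<dots> = (\<integral>x. of_real (f x) * (of_real (p x) * w x * (cpx x ^ a * cnj (cpx x) ^ b)) \<partial>disc R)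
      + (\<integral>x. of_real (f x) * (of_real (q x) * w x * (cpx x ^ a * cnj (cpx x) ^ b)) \<partial>disc R)"
    by (intro Bochner_Integration.integral_add integrable_times_continuous[OF f]
        continuous_intros add.prems c)
  also have "\<dots> = 0"
    using add.IH(1)[OF add.prems] add.IH(2)[OF add.prems] by simp
  finally show ?case .
next
  case (mult p q)
  have c: "continuous_on UNIV q"
    using mult.hyps by (simp add: continuous_on_real_polynomial_function)
  have "(\<integral>x. of_real (f x) * (of_real (p x) * (of_real (q x) * w x) * (cpx x ^ a * cnj (cpx x) ^ b)) \<partial>disc R) = 0"
    by (rule mult.IH(1)) (intro continuous_intros c mult.prems, rule mult.IH(2)[OF mult.prems])
  then show ?case by (simp add: mult.assoc)
qed

text \<open>By the Stone-Weierstrass theorem \<open>f\<close> is orthogonal to all continuous functions. As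
  \<open>sgn f\<close> is an almost everywhere limit of continuous functions, which may be truncated to \<open>[-1, 1]\<close>,
  dominated convergence shows that the integral of \<open>|f| = f sgn f\<close> vanishes.\<close>

lemma AE_zero_if_moments_zero:
  fixes f :: "real^2 \<Rightarrow> real"
  assumes f: "integrable (disc R) f"
    and mom: "\<And>a b. (\<integral>x. of_real (f x) * (cpx x ^ a * cnj (cpx x) ^ b) \<partial>disc R) = 0"
  shows "AE x in disc R. f x = 0"
proof -
  have fm [measurable]: "f \<in> borel_measurable (disc R)"
    using f by (rule borel_measurable_integrable)
  have ifc: "integrable (disc R) (\<lambda>x. f x * g x)" if "continuous_on UNIV g" for g :: "real^2 \<Rightarrow> real"
  proof -
    have "integrable (disc R) (\<lambda>x. complex_of_real (f x * g x))"
      using integrable_times_continuous[OF f, of "\<lambda>x. of_real (g x)"] that by (simp add: continuous_intros)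
    then show ?thesis by (simp only: complex_of_real_integrable_eq)
  qed
  have poly: "(\<integral>x. f x * p x \<partial>disc R) = 0" if "real_polynomial_function p" for p
  proof -
    have "(\<integral>x. complex_of_real (f x * p x) \<partial>disc R) = 0"
      using polynomial_annihilator[OF f that, of "\<lambda>_. 1" 0 0] mom by simp
    then show ?thesis by (simp only: integral_complex_of_real of_real_eq_0_iff)
  qed
  have cont: "(\<integral>x. f x * g x \<partial>disc R) = 0" if g: "continuous_on UNIV g" for g
  proof (rule ccontr)
    let ?I = "\<integral>x. f x * g x \<partial>disc R"
    let ?N = "\<integral>x. \<bar>f x\<bar> \<partial>disc R"
    assume "?I \<noteq> 0"
    define e where "e = \<bar>?I\<bar> / (?N + 1)"
    have N: "?N \<ge> 0" by simp
    have e: "e > 0" using \<open>?I \<noteq> 0\<close> N by (simp add: e_def add_nonneg_pos)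
    obtain p where p: "real_polynomial_function p" "\<And>x. x \<in> cball 0 R \<Longrightarrow> \<bar>g x - p x\<bar> < e"
      using Stone_Weierstrass_real_polynomial_function[OF compact_cball continuous_on_subset[OF g] e]
      by (metis subset_UNIV)
    have cp: "continuous_on UNIV p"
      using p(1) by (rule continuous_on_real_polynomial_function)
    have "?I = (\<integral>x. f x * g x \<partial>disc R) - (\<integral>x. f x * p x \<partial>disc R)"
      using poly[OF p(1)] by simp
    also have "\<dots> = (\<integral>x. f x * g x - f x * p x \<partial>disc R)"
      by (rule Bochner_Integration.integral_diff[symmetric]) (intro ifc g cp)+
    also have "\<bar>\<dots>\<bar> \<le> (\<integral>x. \<bar>f x\<bar> * e \<partial>disc R)"
    proof (rule integral_abs_bound[THEN order_trans], rule integral_mono)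
      show "integrable (disc R) (\<lambda>x. \<bar>f x * g x - f x * p x\<bar>)"
        by (intro integrable_abs Bochner_Integration.integrable_diff ifc g cp)
      show "integrable (disc R) (\<lambda>x. \<bar>f x\<bar> * e)" using f by simp
      fix x :: "real^2" assume "x \<in> space (disc R)"
      then have "\<bar>g x - p x\<bar> \<le> e" using p(2)[of x] by (simp add: less_imp_le)
      then show "\<bar>f x * g x - f x * p x\<bar> \<le> \<bar>f x\<bar> * e"
        by (simp add: right_diff_distrib[symmetric] abs_mult mult_left_mono)
    qed
    also have "\<dots> = ?N * e" by simp
    also have "\<dots> < (?N + 1) * e" using e by simp
    also have "\<dots> = \<bar>?I\<bar>"
    proof -
      have "?N + 1 \<noteq> 0" using N by linarith
      then show ?thesis unfolding e_def times_divide_eq_right by (rule nonzero_mult_div_cancel_left)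
    qed
    finally show False by simp
  qed
  have "(\<lambda>x. sgn (f x)) measurable_on ball 0 R"
    by (subst measurable_on_iff_borel_measurable) auto
  then obtain N g where N: "negligible N" and g: "\<And>n. continuous_on UNIV (g n)"
    and lim: "\<And>x. x \<notin> N \<Longrightarrow> (\<lambda>n. g n x) \<longlonglongrightarrow> (if x \<in> ball 0 R then sgn (f x) else 0)"
    unfolding measurable_on_def by blast
  \<comment> \<open>Truncation keeps continuity and the limit, and makes \<open>|f|\<close> a dominating function.\<close>
  define h where "h n x = max (-1) (min 1 (g n x))" for n x
  have h: "continuous_on UNIV (h n)" for n
    unfolding h_def using g by (intro continuous_intros)
  have "(\<lambda>n. \<integral>x. f x * h n x \<partial>disc R) \<longlonglongrightarrow> (\<integral>x. \<bar>f x\<bar> \<partial>disc R)"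
  proof (rule integral_dominated_convergence[where w = "\<lambda>x. \<bar>f x\<bar>"])
    show "integrable (disc R) (\<lambda>x. \<bar>f x\<bar>)" using f by simp
    show "(\<lambda>x. f x * h n x) \<in> borel_measurable (disc R)" for n
      using ifc[OF h] by (rule borel_measurable_integrable)
    show "AE x in disc R. norm (f x * h n x) \<le> \<bar>f x\<bar>" for n
    proof (rule AE_I2)
      fix x
      have "\<bar>h n x\<bar> \<le> 1" by (simp add: h_def abs_le_iff)
      then show "norm (f x * h n x) \<le> \<bar>f x\<bar>"
        by (simp add: abs_mult mult_left_le)
    qed
    have "AE x in lebesgue. x \<notin> N"
      using N unfolding negligible_iff_null_sets by (rule AE_not_in)
    then have "AE x in disc R. x \<notin> N"
      by (subst AE_restrict_space_iff) (auto elim!: eventually_mono)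
    then show "AE x in disc R. (\<lambda>n. f x * h n x) \<longlonglongrightarrow> \<bar>f x\<bar>"
      using AE_space
    proof eventually_elim
      case (elim x)
      then have "(\<lambda>n. f x * h n x) \<longlonglongrightarrow> f x * max (-1) (min 1 (sgn (f x)))"
        unfolding h_def using lim[of x] by (intro tendsto_intros) simp
      also have "f x * max (-1) (min 1 (sgn (f x))) = \<bar>f x\<bar>"
        by (simp add: sgn_if)
      finally show ?case .
    qed
  qed measurable
  then have "(\<integral>x. \<bar>f x\<bar> \<partial>disc R) = 0"
    using cont[OF h] LIMSEQ_unique[OF _ tendsto_const] by simp
  then show ?thesis
    using f by (simp add: integral_nonneg_eq_0_iff_AE)
qed

lemma off_diagonal_zero_if_moments_zero:
  assumes "\<And>m l. m \<ge> 1 \<Longrightarrow> moment R f m l = 0" "a \<noteq> b"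
  shows "(\<integral>x. of_real (f x) * (cpx x ^ a * cnj (cpx x) ^ b) \<partial>disc R) = 0"
proof (cases "a > b")
  case True
  then have "cpx x ^ a * cnj (cpx x) ^ b = monomial (a - b) b x" for x
    by (simp add: monomial_eq)
  then show ?thesis
    using assms(1)[of "a - b" b] True by (simp add: moment_def)
next
  case False
  then have "cpx x ^ a * cnj (cpx x) ^ b = cnj (monomial (b - a) a x)" for x
    using assms(2) by (simp add: monomial_eq mult.commute)
  then have "(\<integral>x. of_real (f x) * (cpx x ^ a * cnj (cpx x) ^ b) \<partial>disc R) =
      (\<integral>x. cnj (of_real (f x) * monomial (b - a) a x) \<partial>disc R)"
    by simp
  also have "\<dots> = cnj (moment R f (b - a) a)"
    unfolding moment_def by (rule Bochner_Integration.integral_cnj)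
  also have "\<dots> = 0"
    using assms(1)[of "b - a" a] False assms(2) by simp
  finally show ?thesis .
qed

text \<open>Compare \<open>f\<close> with its conditional expectation \<open>E\<close> given \<open>|x|\<close>. They have the same diagonal
  moments by the defining property of \<open>E\<close>; the off-diagonal ones vanish for \<open>f\<close> by assumption and for
  \<open>E\<close> by rotation invariance. So \<open>f = E\<close>, and \<open>E\<close> is a function of \<open>|x|\<close>.\<close>

lemma radial_if_moments_zero:
  fixes f :: "real^2 \<Rightarrow> real"
  assumes f: "integrable (disc R) f" and mom: "\<And>m l. m \<ge> 1 \<Longrightarrow> moment R f m l = 0"
  shows "radial (ball 0 R) f"
proof -
  \<comment> \<open>The \<open>\<sigma>\<close>-algebra generated by \<open>|x|\<close>.\<close>
  define F where "F = vimage_algebra (ball 0 R :: (real^2) set) norm (borel :: real measure)"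
  have spF: "space F = ball 0 R" by (simp add: F_def)
  have nF: "norm \<in> F \<rightarrow>\<^sub>M borel"
    unfolding F_def by (rule measurable_vimage_algebra1) simp
  have fm [measurable]: "f \<in> borel_measurable (disc R)"
    using f by (rule borel_measurable_integrable)
  have sub: "subalgebra (disc R) F"
    unfolding subalgebra_def
  proof
    show "sets F \<subseteq> sets (disc R)"
      unfolding F_def using measurable_sets[OF norm_measurable_disc, of _ R]
      by (auto simp: sets_vimage_algebra2)
  qed (simp add: spF)
  interpret finite_measure_subalgebra "disc R" F
    using finite_measure_disc[of R] sub
    by (intro finite_measure_subalgebra.intro finite_measure_subalgebra_axioms.intro)
  define E where "E = real_cond_exp (disc R) F f"
  have EF: "E \<in> borel_measurable F" unfolding E_def by simp
  have iE: "integrable (disc R) E" unfolding E_def by (rule real_cond_exp_int(1)[OF f])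
  have Em [measurable]: "E \<in> borel_measurable (disc R)" using iE by (rule borel_measurable_integrable)
  have Erad: "E x = E y" if "norm x = norm y" "norm x < R" for x y
  proof -
    have "E -` {E x} \<inter> ball 0 R \<in> sets F"
      using measurable_sets[OF EF, of "{E x}"] by (simp add: spF)
    then obtain A where A: "E -` {E x} \<inter> ball 0 R = norm -` A \<inter> ball 0 R"
      unfolding F_def by (auto simp: sets_vimage_algebra2)
    have "x \<in> E -` {E x} \<inter> ball 0 R" using that by simp
    then have "y \<in> norm -` A \<inter> ball 0 R" unfolding A using that by simp
    then have "y \<in> E -` {E x} \<inter> ball 0 R" unfolding A .
    then show ?thesis by simp
  qed
  have "AE x in disc R. f x - E x = 0"
  proof (rule AE_zero_if_moments_zero)
    show "integrable (disc R) (\<lambda>x. f x - E x)" using f iE by simp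
    fix a b :: nat
    let ?q = "\<lambda>x. cpx x ^ a * cnj (cpx x) ^ b"
    have cq: "continuous_on UNIV ?q" by (intro continuous_intros)
    have "(\<integral>x. of_real (f x - E x) * ?q x \<partial>disc R) = (\<integral>x. of_real (f x) * ?q x - of_real (E x) * ?q x \<partial>disc R)"
      by (simp add: left_diff_distrib)
    also have "\<dots> = (\<integral>x. of_real (f x) * ?q x \<partial>disc R) - (\<integral>x. of_real (E x) * ?q x \<partial>disc R)"
      by (rule Bochner_Integration.integral_diff) (rule integrable_times_continuous[OF _ cq], fact)+
    also have "\<dots> = 0"
    proof (cases "a = b")
      case False
      have "(\<integral>x. of_real (E x) * ?q x \<partial>disc R) = 0"
      proof (rule integral_off_diagonal_eq_0[OF False])
        show "AE x in disc R. complex_of_real (E (rot c x)) = of_real (E x)" if "cmod c = 1" for c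
          using AE_space
        proof eventually_elim
          case (elim x)
          then show ?case using Erad[of "rot c x" x] norm_rot[OF that] by simp
        qed
      qed measurable
      then show ?thesis
        using off_diagonal_zero_if_moments_zero[OF mom False] by simp
    next
      case True
      have q: "?q x = of_real (norm x ^ (2 * a))" for x
        unfolding True by (rule cpx_times_cnj_power)
      have i: "integrable (disc R) (\<lambda>x. norm x ^ (2 * a) * f x)"
      proof -
        have "integrable (disc R) (\<lambda>x. complex_of_real (norm x ^ (2 * a) * f x))"
          using integrable_times_continuous[OF f cq] unfolding q by (simp add: mult.commute)
        then show ?thesis by (simp only: complex_of_real_integrable_eq)
      qed
      have "(\<integral>x. norm x ^ (2 * a) * E x \<partial>disc R) = (\<integral>x. norm x ^ (2 * a) * f x \<partial>disc R)"
        unfolding E_def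
      proof (rule real_cond_exp_intg(2)[OF i _ fm])
        show "(\<lambda>x. norm x ^ (2 * a)) \<in> borel_measurable F" using nF by measurable
      qed
      then show ?thesis
        unfolding q by (simp only: of_real_mult[symmetric] integral_complex_of_real mult.commute[of _ "norm _ ^ _"] cancel_comm_monoid_add_class.diff_cancel)
    qed
    finally show "(\<integral>x. of_real (f x - E x) * ?q x \<partial>disc R) = 0" .
  qed
  then have "AE x in disc R. f x = E (SOME y. norm y = norm x)"
    using AE_space
  proof eventually_elim
    case (elim x)
    have "norm (SOME y :: real^2. norm y = norm x) = norm x"
      by (rule someI[of _ x]) simp
    then show ?case using Erad[of x "SOME y. norm y = norm x"] elim by simp
  qed
  then show ?thesis
    unfolding radial_def by (intro exI[of _ "\<lambda>r. E (SOME y. norm y = r)"])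
qed

section \<open>The eigenvalue condition and the potentials of Bessel modes\<close>

lemma norm_moment_le:
  assumes f: "integrable (disc R) f"
  shows "cmod (moment R f m l) \<le> (\<integral>x. \<bar>f x\<bar> \<partial>disc R) * R ^ (m + 2 * l)"
proof -
  have i: "integrable (disc R) (\<lambda>x. of_real (f x) * monomial m l x)"
    by (intro integrable_times_continuous[OF f] continuous_on_monomial)
  have "cmod (moment R f m l) \<le> (\<integral>x. norm (of_real (f x) * monomial m l x) \<partial>disc R)"
    unfolding moment_def by (rule integral_norm_bound)
  also have "\<dots> \<le> (\<integral>x. \<bar>f x\<bar> * R ^ (m + 2 * l) \<partial>disc R)"
  proof (rule integral_mono[OF integrable_norm[OF i]])
    fix x :: "real^2" assume "x \<in> space (disc R)"
    then show "norm (of_real (f x) * monomial m l x) \<le> \<bar>f x\<bar> * R ^ (m + 2 * l)"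
      using monomial_le[of x R m l] by (simp add: norm_mult mult_left_mono)
  qed (use f in simp)
  also have "\<dots> = (\<integral>x. \<bar>f x\<bar> \<partial>disc R) * R ^ (m + 2 * l)"
    by simp
  finally show ?thesis .
qed

text \<open>The coefficients of \<open>A_m (s q)\<close> as a power series in \<open>q\<close>. With \<open>s = 1 / (4 \<tau>)\<close> the ratio of
  consecutive coefficients matches the moment recurrence.\<close>

definition bessel_coeff :: "nat \<Rightarrow> real \<Rightarrow> nat \<Rightarrow> real" where
  "bessel_coeff m s l = (-1) ^ l / (fact l * fact (m + l)) * s ^ l"

lemma bessel_coeff_0 [simp]: "bessel_coeff m s 0 = 1 / fact m"
  by (simp add: bessel_coeff_def)

lemma bessel_coeff_Suc:
  "bessel_coeff m s (Suc l) = - s / ((real l + 1) * (real m + real l + 1)) * bessel_coeff m s l"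
proof -
  have "(fact (m + Suc l) :: real) = (real m + real l + 1) * fact (m + l)"
    "(fact (Suc l) :: real) = (real l + 1) * fact l"
    by (simp_all add: algebra_simps)
  then show ?thesis
    unfolding bessel_coeff_def by (simp only: power_Suc) (simp add: field_simps)
qed

lemma bessel_coeff_sums: "(\<lambda>l. bessel_coeff m s l * q ^ l) sums clifford m (s * q)"
  using clifford_sums[of m "s * q"] by (simp add: bessel_coeff_def power_mult_distrib mult_ac)

lemma summable_bessel_coeff_abs: "summable (\<lambda>l. \<bar>bessel_coeff m s l\<bar> * \<bar>q\<bar> ^ l)"
  using summable_clifford_abs[of m "s * q"]
  by (simp add: bessel_coeff_def power_mult_distrib abs_mult power_abs mult_ac)

text \<open>The boundary terms \<open>R^(2l+2) / (4m(l+1))\<close> weighted with the coefficients of index \<open>m\<close> form the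
  series of index \<open>m - 1\<close> without its constant term. This is where \<open>J_{m-1}\<close> comes from.\<close>

lemma bessel_coeff_boundary_sums:
  assumes "m \<ge> 1" "s \<noteq> 0"
  shows "(\<lambda>l. bessel_coeff m s l * (R ^ (2 * l + 2) / (4 * real m * (real l + 1))))
    sums (1 / (4 * s * real m) * (1 / fact (m - 1) - clifford (m - 1) (s * R\<^sup>2)))"
proof -
  have "(\<lambda>l. bessel_coeff (m - 1) s (Suc l) * (R\<^sup>2) ^ Suc l) sums (clifford (m - 1) (s * R\<^sup>2) - 1 / fact (m - 1))"
    using bessel_coeff_sums[of "m - 1" s "R\<^sup>2"] by (subst sums_Suc_iff) simp
  from sums_mult[OF this, of "- (1 / (4 * s * real m))"]
  have "(\<lambda>l. - (1 / (4 * s * real m)) * (bessel_coeff (m - 1) s (Suc l) * (R\<^sup>2) ^ Suc l))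
      sums (1 / (4 * s * real m) * (1 / fact (m - 1) - clifford (m - 1) (s * R\<^sup>2)))"
    by (simp add: right_diff_distrib)
  moreover have "- (1 / (4 * s * real m)) * (bessel_coeff (m - 1) s (Suc l) * (R\<^sup>2) ^ Suc l)
      = bessel_coeff m s l * (R ^ (2 * l + 2) / (4 * real m * (real l + 1)))" for l
  proof -
    have f: "m - 1 + Suc l = m + l" "(fact (Suc l) :: real) = (real l + 1) * fact l"
      using assms(1) by (simp_all add: algebra_simps)
    have "R ^ (2 * l + 2) = (R\<^sup>2) ^ Suc l"
      by (simp only: power_mult[symmetric] mult_Suc_right add.commute)
    then show ?thesis
      unfolding bessel_coeff_def f using assms
      by (simp only: power_Suc[of _ l]) (simp add: field_simps power2_eq_square)
  qed
  ultimately show ?thesis by (simp only:)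
qed

lemma zero_moments:
  assumes f: "in_eigenspace (ball 0 R) \<tau> f" and m: "m \<ge> 1" and z: "moment R f m 0 = 0"
  shows "moment R f m l = 0"
proof (induction l)
  case (Suc l)
  have "of_real (1 / (4 * (real l + 1) * (real m + real l + 1))) * moment R f m (Suc l) = 0"
    using moment_recurrence[OF f m, of l] Suc z by (simp del: of_real_divide)
  moreover have "1 / (4 * (real l + 1) * (real m + real l + 1)) \<noteq> 0"
    by (simp add: add_nonneg_eq_0_iff)
  ultimately show ?case by (simp only: mult_eq_0_iff of_real_eq_0_iff simp_thms)
qed (rule z)

text \<open>For \<open>\<tau> = 0\<close> the recurrence gives \<open>M (l+1) = R^(2l+2) (m+l+1)/m M 0\<close>, which grows faster than the
  trivial bound \<open>O(R^(2l))\<close> unless \<open>M 0 = 0\<close>.\<close>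

lemma moment_zero_if_eigenvalue_zero:
  assumes R: "R > 0" and f: "in_eigenspace (ball 0 R) 0 f" and m: "m \<ge> 1"
  shows "moment R f m 0 = 0"
proof (rule ccontr)
  assume "moment R f m 0 \<noteq> 0"
  define M where "M = cmod (moment R f m 0)"
  have M: "M > 0" using \<open>moment R f m 0 \<noteq> 0\<close> by (simp add: M_def)
  have i: "integrable (disc R) f"
    using f by (intro L2_fun_integrable) (simp add: in_eigenspace_def)
  define C where "C = (\<integral>x. \<bar>f x\<bar> \<partial>disc R) * R ^ m"
  have le: "(real m + real l + 1) * M \<le> real m * C" for l
  proof -
    let ?A = "R ^ (2 * l + 2) / (4 * real m * (real l + 1))"
    let ?B = "1 / (4 * (real l + 1) * (real m + real l + 1))"
    have "of_real ?B * moment R f m (Suc l) = of_real ?A * moment R f m 0"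
      using moment_recurrence[OF f m, of l] by (simp del: of_real_divide)
    then have "cmod (of_real ?B * moment R f m (Suc l)) = cmod (of_real ?A * moment R f m 0)"
      by (simp only:)
    then have "?A * M = ?B * cmod (moment R f m (Suc l))"
      using R unfolding norm_mult norm_of_real M_def by (simp add: abs_of_nonneg)
    also have "\<dots> \<le> ?B * (C * R ^ (2 * l + 2))"
      using norm_moment_le[OF i, of m "Suc l"]
      by (intro mult_left_mono) (simp_all add: C_def power_add mult_ac)
    finally have "R ^ (2 * l + 2) * (M / (4 * real m * (real l + 1))) \<le> R ^ (2 * l + 2) * (C / (4 * (real l + 1) * (real m + real l + 1)))"
      by (simp add: mult_ac)
    then have MC: "M / (4 * real m * (real l + 1)) \<le> C / (4 * (real l + 1) * (real m + real l + 1))"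
      using R by (subst (asm) mult_le_cancel_left_pos) simp_all
    have "c * M \<le> a * C"
      if "M / (4 * a * b) \<le> C / (4 * b * c)" "0 < a" "0 < b" "0 < c" for a b c :: real
      using mult_right_mono[OF that(1), of "4 * a * b * c"] that(2-4) by (simp add: mult_ac)
    from this[OF MC] show ?thesis
      using m by simp
  qed
  obtain l where "real m * C < real l * M"
    using reals_Archimedean3[OF M] by blast
  also have "real l * M \<le> (real m + real l + 1) * M"
    using M by (intro mult_right_mono) auto
  finally show False using le[of l] by simp
qed

text \<open>With \<open>e l\<close> the Bessel coefficients, the recurrence becomes
  \<open>\<tau> (e l M l - e (l+1) M (l+1)) = e l A l M 0\<close>, where \<open>A l\<close> is the boundary coefficient. The left-hand side telescopes
  to \<open>\<tau> e 0 M 0\<close> because \<open>e l M l\<close> tends to \<open>0\<close>; the right-hand side sums to the same value minus a multiple of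
  \<open>A_{m-1} (R^2 / (4 \<tau>)) M 0\<close>.\<close>

lemma nonzero_moment_clifford:
  assumes R: "R > 0" and f: "in_eigenspace (ball 0 R) \<tau> f" and m: "m \<ge> 1"
    and nz: "moment R f m 0 \<noteq> 0"
  shows "\<tau> > 0" and "clifford (m - 1) (1 / (4 * \<tau>) * R\<^sup>2) = 0"
proof -
  have \<tau>: "\<tau> \<noteq> 0"
    using moment_zero_if_eigenvalue_zero[OF R _ m] f nz by blast
  define s where "s = 1 / (4 * \<tau>)"
  have s: "s \<noteq> 0" "\<tau> * s = 1 / 4" using \<tau> by (simp_all add: s_def)
  let ?e = "bessel_coeff m s"
  let ?M = "moment R f m"
  have i: "integrable (disc R) f"
    using f by (intro L2_fun_integrable) (simp add: in_eigenspace_def)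
  define C where "C = (\<integral>x. \<bar>f x\<bar> \<partial>disc R) * R ^ m"
  have "(\<lambda>l. of_real (?e l) * ?M l) \<longlonglongrightarrow> 0"
  proof (rule Lim_null_comparison)
    show "\<forall>\<^sub>F l in sequentially. norm (of_real (?e l) * ?M l) \<le> C * (\<bar>?e l\<bar> * \<bar>R\<^sup>2\<bar> ^ l)"
    proof (rule always_eventually, rule allI)
      fix l
      have "cmod (?M l) \<le> C * (R\<^sup>2) ^ l"
        using norm_moment_le[OF i, of m l] by (simp add: C_def power_add power_mult mult.assoc)
      from mult_left_mono[OF this abs_ge_zero[of "?e l"]]
      show "norm (of_real (?e l) * ?M l) \<le> C * (\<bar>?e l\<bar> * \<bar>R\<^sup>2\<bar> ^ l)"
        by (simp add: norm_mult mult_ac)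
    qed
    show "(\<lambda>l. C * (\<bar>?e l\<bar> * \<bar>R\<^sup>2\<bar> ^ l)) \<longlonglongrightarrow> 0"
      by (rule tendsto_mult_right_zero, rule summable_LIMSEQ_zero, rule summable_bessel_coeff_abs)
  qed
  from telescope_sums'[OF this]
  have "(\<lambda>l. of_real (?e l) * ?M l - of_real (?e (Suc l)) * ?M (Suc l)) sums (of_real (?e 0) * ?M 0)"
    by simp
  from sums_mult[OF this, of "of_real \<tau>"]
  have 1: "(\<lambda>l. of_real \<tau> * (of_real (?e l) * ?M l - of_real (?e (Suc l)) * ?M (Suc l))) sums (of_real \<tau> * (of_real (?e 0) * ?M 0))" .
  have step: "of_real \<tau> * (of_real (?e l) * ?M l - of_real (?e (Suc l)) * ?M (Suc l)) =
      of_real (?e l * (R ^ (2 * l + 2) / (4 * real m * (real l + 1)))) * ?M 0" for l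
  proof -
    define B where "B = 1 / (4 * (real l + 1) * (real m + real l + 1))"
    define A where "A = R ^ (2 * l + 2) / (4 * real m * (real l + 1))"
    have "\<tau> * ?e (Suc l) = - B * ?e l"
    proof -
      have "B = \<tau> * s / ((real l + 1) * (real m + real l + 1))"
        unfolding B_def s(2) by (simp add: mult.assoc)
      then show ?thesis by (simp add: bessel_coeff_Suc)
    qed
    then have 1: "of_real \<tau> * of_real (?e (Suc l)) = - of_real B * complex_of_real (?e l)"
      by (simp only: of_real_mult[symmetric] of_real_minus[symmetric])
    have 2: "of_real \<tau> * ?M l = of_real A * ?M 0 - of_real B * ?M (Suc l)"
      using moment_recurrence[OF f m, of l] by (simp only: A_def B_def)
    have "of_real \<tau> * (of_real (?e l) * ?M l - of_real (?e (Suc l)) * ?M (Suc l)) =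
       of_real (?e l) * (of_real \<tau> * ?M l) - (of_real \<tau> * of_real (?e (Suc l))) * ?M (Suc l)"
      by (simp add: right_diff_distrib mult_ac)
    also have "\<dots> = of_real (?e l * A) * ?M 0"
      unfolding 1 2 by (simp add: right_diff_distrib mult_ac)
    finally show ?thesis by (simp only: A_def)
  qed
  note b = bessel_coeff_boundary_sums[OF m s(1), of R]
  have 2: "(\<lambda>l. of_real (?e l * (R ^ (2 * l + 2) / (4 * real m * (real l + 1)))) * ?M 0)
      sums (of_real (1 / (4 * s * real m) * (1 / fact (m - 1) - clifford (m - 1) (s * R\<^sup>2))) * ?M 0)"
    by (rule sums_mult2, rule sums_of_real, rule b)
  have "of_real (\<tau> * ?e 0) * ?M 0 = of_real (1 / (4 * s * real m) * (1 / fact (m - 1) - clifford (m - 1) (s * R\<^sup>2))) * ?M 0"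
    using sums_unique2[OF 1 2[folded step]] by (simp add: mult.assoc)
  then have "\<tau> * ?e 0 = 1 / (4 * s * real m) * (1 / fact (m - 1) - clifford (m - 1) (s * R\<^sup>2))"
    using nz by (simp only: mult_cancel_right of_real_eq_iff simp_thms)
  moreover have "(fact m :: real) = real m * fact (m - 1)"
    using m by (simp add: fact_reduce)
  moreover have "1 / (4 * s * real m) = \<tau> / real m"
    using \<tau> by (simp add: s_def)
  ultimately have "\<tau> / real m * clifford (m - 1) (s * R\<^sup>2) = 0"
    by (simp add: right_diff_distrib)
  then have c: "clifford (m - 1) (s * R\<^sup>2) = 0"
    using \<tau> m by simp
  then show "clifford (m - 1) (1 / (4 * \<tau>) * R\<^sup>2) = 0"
    by (simp add: s_def)
  have "\<not> s * R\<^sup>2 \<le> 0"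
    using clifford_pos_nonpos[of "s * R\<^sup>2" "m - 1"] c by auto
  then show "\<tau> > 0"
    using R by (simp add: s_def not_le zero_less_mult_iff zero_less_divide_iff)
qed

lemma nonzero_moment_eigenvalue:
  assumes R: "R > 0" and f: "in_eigenspace (ball 0 R) \<tau> f" and m: "m \<ge> 1"
    and nz: "moment R f m 0 \<noteq> 0"
  shows "\<exists>n\<ge>1. tau R m n = \<tau>"
proof -
  note c = nonzero_moment_clifford[OF assms]
  have "bessel_J (m - 1) (R / sqrt \<tau>) = 0"
    using c R by (simp add: bessel_J_eq_clifford power_divide mult.commute)
  then obtain n where n: "n \<ge> 1" "bessel_zero (m - 1) n = R / sqrt \<tau>"
    using ex_bessel_zero_eq[of "R / sqrt \<tau>" "m - 1"] R c(1) by auto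
  then have "tau R m n = \<tau>"
    using R c(1) by (simp add: tau_def power_divide)
  then show ?thesis using n(1) by blast
qed

text \<open>For a fixed argument, \<open>A_{m-1}\<close> does not vanish once \<open>m\<close> is large.\<close>

lemma finite_nonzero_moments:
  assumes R: "R > 0" and f: "in_eigenspace (ball 0 R) \<tau> f"
  shows "finite {m. m \<ge> 1 \<and> moment R f m 0 \<noteq> 0}"
proof -
  let ?X = "1 / (4 * \<tau>) * R\<^sup>2"
  obtain K where K: "exp ?X \<le> real K" using real_arch_simple by blast
  have "{m. m \<ge> 1 \<and> moment R f m 0 \<noteq> 0} \<subseteq> {..K}"
  proof
    fix m assume "m \<in> {m. m \<ge> 1 \<and> moment R f m 0 \<noteq> 0}"
    then have m: "m \<ge> 1" "moment R f m 0 \<noteq> 0" by auto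
    note c = nonzero_moment_clifford[OF R f m]
    show "m \<in> {..K}"
    proof (rule ccontr)
      assume "m \<notin> {..K}"
      then have "exp ?X \<le> real (m - 1) + 1" using K by simp
      then have "clifford (m - 1) ?X > 0"
        using c(1) by (intro clifford_pos_large[of _ ?X]) auto
      then show False using c(2) by simp
    qed
  qed
  then show ?thesis by (rule finite_subset) simp
qed

text \<open>The function \<open>J_m (k |x|) e^(i m \<theta>)\<close>, written without polar coordinates so that it is visibly
  continuous at the origin.\<close>

definition bessel_mode :: "nat \<Rightarrow> real \<Rightarrow> real^2 \<Rightarrow> complex" where
  "bessel_mode m k x = of_real ((k / 2) ^ m * clifford m (k\<^sup>2 / 4 * (norm x)\<^sup>2)) * cpx x ^ m"

lemma cpx_polar: "cpx x = of_real (norm x) * cis (polar_angle x)"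
  using rcis_cmod_Arg[of "cpx x"] by (simp add: rcis_def polar_angle_def cpx_def[symmetric])

lemma bessel_mode_polar:
  "bessel_mode m k x = of_real (bessel_J m (k * norm x)) * cis (real m * polar_angle x)"
proof -
  have "cpx x ^ m = of_real (norm x ^ m) * cis (real m * polar_angle x)"
    by (subst cpx_polar) (simp add: power_mult_distrib Complex.DeMoivre)
  then show ?thesis
    by (simp add: bessel_mode_def bessel_J_eq_clifford power_mult_distrib power_divide)
qed

lemma u_fun_eq: "u_fun R m n x = Re (1 * bessel_mode m (bessel_zero (m - 1) n / R) x)"
  by (simp add: u_fun_def bessel_mode_polar)

lemma v_fun_eq: "v_fun R m n x = Re (- \<i> * bessel_mode m (bessel_zero (m - 1) n / R) x)"
  by (simp add: v_fun_def bessel_mode_polar)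

lemma continuous_on_bessel_mode [continuous_intros]: "continuous_on S (bessel_mode m k)"
  unfolding bessel_mode_def by (intro continuous_intros)

lemma bessel_mode_sums:
  "(\<lambda>l. of_real ((k / 2) ^ m * bessel_coeff m (k\<^sup>2 / 4) l) * monomial m l x) sums bessel_mode m k x"
proof -
  have "(\<lambda>l. of_real ((k / 2) ^ m * (bessel_coeff m (k\<^sup>2 / 4) l * ((norm x)\<^sup>2) ^ l)) * cpx x ^ m) sums bessel_mode m k x"
    unfolding bessel_mode_def by (intro sums_mult2 sums_of_real sums_mult bessel_coeff_sums)
  then show ?thesis
    unfolding monomial_def power_mult[of _ 2] by (simp only: of_real_mult mult.assoc)
qed

text \<open>Integrate the series of the mode term by term. The terms in \<open>|x|^(2l+2)\<close> are those of the
  mode itself, shifted by one and divided by \<open>k^2\<close>; the boundary terms add up to the missing constant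
  term because \<open>k R\<close> is a zero of \<open>J_{m-1}\<close>.\<close>

lemma integral_log_kernel_bessel_mode:
  assumes R: "R > 0" and m: "m \<ge> 1" and k: "k > 0" and zero: "bessel_J (m - 1) (k * R) = 0"
    and x: "x \<noteq> 0" "norm x < R"
  shows "integrable (disc R) (\<lambda>y. of_real (log_kernel x y) * bessel_mode m k y)"
    and "(\<integral>y. of_real (log_kernel x y) * bessel_mode m k y \<partial>disc R) = of_real (2 * pi / k\<^sup>2) * bessel_mode m k x"
proof -
  define s where "s = k\<^sup>2 / 4"
  have s: "s > 0" using k by (simp add: s_def)
  define c where "c l = (k / 2) ^ m * bessel_coeff m s l" for l
  let ?F = "\<lambda>l y. of_real (c l) * (of_real (log_kernel x y) * monomial m l y)"
  have ik: "integrable (disc R) (log_kernel x)"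
    by (rule log_kernel_integrable(1)[OF x])
  have iF: "integrable (disc R) (?F l)" for l
    by (intro integrable_mult_right integrable_times_continuous[OF ik] continuous_on_monomial)
  have sumc: "summable (\<lambda>l. D * (\<bar>c l\<bar> * R ^ (m + 2 * l)))" for D
  proof -
    have "\<bar>c l\<bar> * R ^ (m + 2 * l) = ((k / 2) ^ m * R ^ m) * (\<bar>bessel_coeff m s l\<bar> * \<bar>R\<^sup>2\<bar> ^ l)" for l
    proof -
      have "R ^ (m + 2 * l) = R ^ m * (R\<^sup>2) ^ l"
        by (simp only: power_add power_mult)
      then show ?thesis
        using k by (simp add: c_def abs_mult power_abs)
    qed
    then show ?thesis
      by (simp only:) (intro summable_mult summable_bessel_coeff_abs)
  qed
  have Fle: "norm (?F l y) \<le> \<bar>log_kernel x y\<bar> * (\<bar>c l\<bar> * R ^ (m + 2 * l))" if "norm y < R" for l y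
    using mult_left_mono[OF monomial_le[OF that, of m l], of "\<bar>log_kernel x y\<bar> * \<bar>c l\<bar>"]
    by (simp add: norm_mult mult_ac)
  have AEs: "AE y in disc R. summable (\<lambda>l. norm (?F l y))"
    using AE_space
  proof eventually_elim
    case (elim y)
    show ?case
    proof (rule summable_comparison_test'[OF sumc[of "\<bar>log_kernel x y\<bar>"], where N = 0])
      fix l
      show "norm (norm (?F l y)) \<le> \<bar>log_kernel x y\<bar> * (\<bar>c l\<bar> * R ^ (m + 2 * l))"
        using Fle[of y l] elim by simp
    qed
  qed
  have si: "summable (\<lambda>l. \<integral>y. norm (?F l y) \<partial>disc R)"
  proof (rule summable_comparison_test'[OF sumc[of "kernel_bound R"], where N = 0])
    fix l
    have "(\<integral>y. norm (?F l y) \<partial>disc R) \<le> (\<integral>y. \<bar>log_kernel x y\<bar> * (\<bar>c l\<bar> * R ^ (m + 2 * l)) \<partial>disc R)"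
    proof (rule integral_mono[OF integrable_norm[OF iF]])
      show "integrable (disc R) (\<lambda>y. \<bar>log_kernel x y\<bar> * (\<bar>c l\<bar> * R ^ (m + 2 * l)))"
        using ik by simp
      fix y assume "y \<in> space (disc R)"
      then show "norm (?F l y) \<le> \<bar>log_kernel x y\<bar> * (\<bar>c l\<bar> * R ^ (m + 2 * l))"
        using Fle[of y l] by simp
    qed
    also have "\<dots> = (\<integral>y. \<bar>log_kernel x y\<bar> \<partial>disc R) * (\<bar>c l\<bar> * R ^ (m + 2 * l))"
      by (rule integral_mult_left_zero)
    also have "\<dots> \<le> kernel_bound R * (\<bar>c l\<bar> * R ^ (m + 2 * l))"
      using log_kernel_integrable(2)[OF x] R by (intro mult_right_mono) auto
    finally show "norm (\<integral>y. norm (?F l y) \<partial>disc R) \<le> kernel_bound R * (\<bar>c l\<bar> * R ^ (m + 2 * l))"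
      by simp
  qed
  have S: "(\<Sum>l. ?F l y) = of_real (log_kernel x y) * bessel_mode m k y" for y
  proof -
    have "(\<lambda>l. of_real (log_kernel x y) * (of_real (c l) * monomial m l y)) sums (of_real (log_kernel x y) * bessel_mode m k y)"
      unfolding c_def s_def by (intro sums_mult bessel_mode_sums)
    then show ?thesis by (simp add: sums_iff mult.left_commute)
  qed
  show "integrable (disc R) (\<lambda>y. of_real (log_kernel x y) * bessel_mode m k y)"
    using integrable_suminf[OF iF AEs si] unfolding S .
  have 1: "(\<lambda>l. \<integral>y. ?F l y \<partial>disc R) sums (\<integral>y. of_real (log_kernel x y) * bessel_mode m k y \<partial>disc R)"
    using sums_integral[OF iF AEs si] unfolding S .
  let ?A = "\<lambda>l. R ^ (2 * l + 2) / (4 * real m * (real l + 1))"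
  let ?B = "\<lambda>l. norm x ^ (2 * l + 2) / (4 * (real l + 1) * (real m + real l + 1))"
  have v: "(\<integral>y. ?F l y \<partial>disc R) = of_real (2 * pi * (k / 2) ^ m * (bessel_coeff m s l * ?A l - bessel_coeff m s l * ?B l)) * cpx x ^ m" for l
    unfolding integral_mult_right_zero integral_log_kernel_monomial[OF x m] c_def
    by (simp add: right_diff_distrib left_diff_distrib mult_ac)
  have "clifford (m - 1) (s * R\<^sup>2) = 0"
    using zero k R by (auto simp: bessel_J_eq_clifford s_def power_mult_distrib)
  then have sA: "(\<lambda>l. bessel_coeff m s l * ?A l) sums (1 / (4 * s * real m) * (1 / fact (m - 1)))"
    using bessel_coeff_boundary_sums[OF m, of s R] s by simp
  have "(\<lambda>l. bessel_coeff m s (Suc l) * ((norm x)\<^sup>2) ^ Suc l) sums (clifford m (s * (norm x)\<^sup>2) - 1 / fact m)"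
    using bessel_coeff_sums[of m s "(norm x)\<^sup>2"] by (subst sums_Suc_iff) simp
  from sums_mult[OF this, of "- 1 / (4 * s)"]
  have "(\<lambda>l. - 1 / (4 * s) * (bessel_coeff m s (Suc l) * ((norm x)\<^sup>2) ^ Suc l)) sums (- 1 / (4 * s) * (clifford m (s * (norm x)\<^sup>2) - 1 / fact m))" .
  moreover have "- 1 / (4 * s) * (bessel_coeff m s (Suc l) * ((norm x)\<^sup>2) ^ Suc l) = bessel_coeff m s l * ?B l" for l
  proof -
    have "norm x ^ (2 * l + 2) = ((norm x)\<^sup>2) ^ Suc l"
      by (simp only: power_mult[symmetric] mult_Suc_right add.commute)
    then show ?thesis
      unfolding bessel_coeff_Suc using s by (simp add: field_simps)
  qed
  ultimately have sB: "(\<lambda>l. bessel_coeff m s l * ?B l) sums (- 1 / (4 * s) * (clifford m (s * (norm x)\<^sup>2) - 1 / fact m))"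
    by (simp only:)
  have "1 / (4 * s * real m) * (1 / fact (m - 1)) - - 1 / (4 * s) * (clifford m (s * (norm x)\<^sup>2) - 1 / fact m) = 1 / (4 * s) * clifford m (s * (norm x)\<^sup>2)"
  proof -
    have "(fact m :: real) = real m * fact (m - 1)"
      using m by (simp add: fact_reduce)
    then show ?thesis using s by (simp add: right_diff_distrib)
  qed
  with sums_diff[OF sA sB] have "(\<lambda>l. bessel_coeff m s l * ?A l - bessel_coeff m s l * ?B l) sums (1 / (4 * s) * clifford m (s * (norm x)\<^sup>2))"
    by (simp only:)
  then have "(\<lambda>l. \<integral>y. ?F l y \<partial>disc R) sums (of_real (2 * pi * (k / 2) ^ m * (1 / (4 * s) * clifford m (s * (norm x)\<^sup>2))) * cpx x ^ m)"
    unfolding v by (intro sums_mult2 sums_of_real sums_mult)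
  from sums_unique2[OF 1 this]
  show "(\<integral>y. of_real (log_kernel x y) * bessel_mode m k y \<partial>disc R) = of_real (2 * pi / k\<^sup>2) * bessel_mode m k x"
    by (simp add: bessel_mode_def s_def mult_ac)
qed

section \<open>The non-radial eigenspaces\<close>

text \<open>The choices \<open>\<omega> = 1\<close> and \<open>\<omega> = - \<i>\<close> give the cosine and the sine mode, so both are treated at once.\<close>

definition mode_part :: "complex \<Rightarrow> nat \<Rightarrow> real \<Rightarrow> real^2 \<Rightarrow> real" where
  "mode_part \<omega> m k x = Re (\<omega> * bessel_mode m k x)"

lemma continuous_on_mode_part [continuous_intros]: "continuous_on S (mode_part \<omega> m k)"
  unfolding mode_part_def by (intro continuous_intros)

lemma mode_part_eigenspace:
  assumes R: "R > 0" and m: "m \<ge> 1" and k: "k > 0" and zero: "bessel_J (m - 1) (k * R) = 0"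
  shows "in_eigenspace (ball 0 R) (1 / k\<^sup>2) (mode_part \<omega> m k)"
  unfolding in_eigenspace_def L2_fun_def
proof (intro conjI)
  show "mode_part \<omega> m k \<in> borel_measurable (disc R)"
    by (rule borel_measurable_disc, rule borel_measurable_continuous_onI, rule continuous_on_mode_part)
  show "integrable (disc R) (\<lambda>x. (mode_part \<omega> m k x)\<^sup>2)"
    by (intro integrable_continuous_disc continuous_intros)
  show "AE x in disc R. log_potential (ball 0 R) (mode_part \<omega> m k) x = 1 / k\<^sup>2 * mode_part \<omega> m k x"
    using AE_disc_nonzero AE_space
  proof eventually_elim
    case (elim x)
    let ?F = "\<lambda>y. \<omega> * (of_real (log_kernel x y) * bessel_mode m k y)"
    have x: "x \<noteq> 0" "norm x < R" using elim by simp_all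
    note I = integral_log_kernel_bessel_mode[OF R m k zero x]
    have "(\<integral>y. log_kernel x y * mode_part \<omega> m k y \<partial>disc R) = (\<integral>y. Re (?F y) \<partial>disc R)"
      by (simp add: mode_part_def algebra_simps)
    also have "\<dots> = Re (\<integral>y. ?F y \<partial>disc R)"
      by (rule integral_bounded_linear[OF bounded_linear_Re]) (rule integrable_mult_right, rule I(1))
    also have "(\<integral>y. ?F y \<partial>disc R) = of_real (2 * pi / k\<^sup>2) * (\<omega> * bessel_mode m k x)"
      unfolding integral_mult_right_zero I(2) by (rule mult.left_commute)
    also have "Re \<dots> = 2 * pi / k\<^sup>2 * mode_part \<omega> m k x"
      unfolding mode_part_def by simp
    finally show ?case
      by (simp add: log_potential_def log_kernel_def)
  qed
qed

text \<open>The moment of frequency \<open>m\<close> and exponent \<open>l = 0\<close> of the cosine mode.\<close>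

definition mode_mass :: "real \<Rightarrow> nat \<Rightarrow> real \<Rightarrow> complex" where
  "mode_mass R m k = (\<integral>x. of_real ((k / 2) ^ m * clifford m (k\<^sup>2 / 4 * (norm x)\<^sup>2)) * (cpx x ^ m * cnj (cpx x) ^ m) \<partial>disc R) / 2"

lemma integral_mode_part:
  assumes m: "m \<ge> 1"
  shows "(\<integral>x. of_real (mode_part \<omega> m k x) * (cpx x ^ a * cnj (cpx x) ^ b) \<partial>disc R) =
    (\<omega> / 2) * (\<integral>x. of_real ((k / 2) ^ m * clifford m (k\<^sup>2 / 4 * (norm x)\<^sup>2)) * (cpx x ^ (a + m) * cnj (cpx x) ^ b) \<partial>disc R) +
    (cnj \<omega> / 2) * (\<integral>x. of_real ((k / 2) ^ m * clifford m (k\<^sup>2 / 4 * (norm x)\<^sup>2)) * (cpx x ^ a * cnj (cpx x) ^ (b + m)) \<partial>disc R)"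
proof -
  define G where "G x = (k / 2) ^ m * clifford m (k\<^sup>2 / 4 * (norm x)\<^sup>2)" for x :: "real^2"
  have cG: "continuous_on UNIV G" unfolding G_def by (intro continuous_intros)
  have "of_real (mode_part \<omega> m k x) * (cpx x ^ a * cnj (cpx x) ^ b) =
    (\<omega> / 2) * (of_real (G x) * (cpx x ^ (a + m) * cnj (cpx x) ^ b)) +
    (cnj \<omega> / 2) * (of_real (G x) * (cpx x ^ a * cnj (cpx x) ^ (b + m)))" for x
  proof -
    define w where "w = \<omega> * (of_real (G x) * cpx x ^ m)"
    have "mode_part \<omega> m k x = Re w"
      by (simp only: mode_part_def bessel_mode_def w_def G_def)
    then have "of_real (mode_part \<omega> m k x) = (w + cnj w) / 2"
      by (simp add: complex_add_cnj)
    then have "of_real (mode_part \<omega> m k x) = (\<omega> * (of_real (G x) * cpx x ^ m) + cnj \<omega> * (of_real (G x) * cnj (cpx x) ^ m)) / 2"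
      by (simp add: w_def)
    then show ?thesis
      by (simp add: power_add algebra_simps add_divide_distrib)
  qed
  then have "(\<integral>x. of_real (mode_part \<omega> m k x) * (cpx x ^ a * cnj (cpx x) ^ b) \<partial>disc R) =
    (\<integral>x. (\<omega> / 2) * (of_real (G x) * (cpx x ^ (a + m) * cnj (cpx x) ^ b)) +
    (cnj \<omega> / 2) * (of_real (G x) * (cpx x ^ a * cnj (cpx x) ^ (b + m))) \<partial>disc R)"
    by (simp only:)
  also have "\<dots> = (\<integral>x. (\<omega> / 2) * (of_real (G x) * (cpx x ^ (a + m) * cnj (cpx x) ^ b)) \<partial>disc R) +
    (\<integral>x. (cnj \<omega> / 2) * (of_real (G x) * (cpx x ^ a * cnj (cpx x) ^ (b + m))) \<partial>disc R)"
    by (rule Bochner_Integration.integral_add)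
      (intro integrable_continuous_disc continuous_intros cG)+
  finally show ?thesis
    unfolding integral_mult_right_zero G_def .
qed

lemma radial_factor_integral_eq_0:
  assumes "a \<noteq> b"
  shows "(\<integral>x. of_real ((k / 2) ^ m * clifford m (k\<^sup>2 / 4 * (norm x)\<^sup>2)) * (cpx x ^ a * cnj (cpx x) ^ b) \<partial>disc R) = 0"
proof (rule integral_off_diagonal_eq_0[OF assms])
  show "(\<lambda>x. complex_of_real ((k / 2) ^ m * clifford m (k\<^sup>2 / 4 * (norm x)\<^sup>2))) \<in> borel_measurable (disc R)"
    by (rule borel_measurable_disc, rule borel_measurable_continuous_onI) (intro continuous_intros)
qed (simp add: norm_rot)

lemma moment_mode_part:
  assumes "m \<ge> 1" "m' \<ge> 1"
  shows "moment R (mode_part \<omega> m k) m' 0 = (if m' = m then cnj \<omega> * mode_mass R m k else 0)"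
proof -
  have "moment R (mode_part \<omega> m k) m' 0 = (cnj \<omega> / 2) * (\<integral>x. of_real ((k / 2) ^ m * clifford m (k\<^sup>2 / 4 * (norm x)\<^sup>2)) * (cpx x ^ m' * cnj (cpx x) ^ m) \<partial>disc R)"
    using integral_mode_part[OF assms(1), where a = m' and b = 0 and \<omega> = \<omega> and k = k and R = R]
      radial_factor_integral_eq_0[where a = "m' + m" and b = 0 and k = k and m = m and R = R] assms
    by (simp add: moment_def monomial_eq)
  then show ?thesis
  proof (cases "m' = m")
    case False
    with \<open>moment R (mode_part \<omega> m k) m' 0 = _\<close> show ?thesis
      using radial_factor_integral_eq_0[where a = m' and b = m and k = k and m = m and R = R] by simp
  qed (simp add: mode_mass_def)
qed

lemma mode_mass_real: "of_real (Re (mode_mass R m k)) = mode_mass R m k"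
proof -
  have "mode_mass R m k = of_real ((\<integral>x. (k / 2) ^ m * clifford m (k\<^sup>2 / 4 * (norm x)\<^sup>2) * norm x ^ (2 * m) \<partial>disc R) / 2)"
    unfolding mode_mass_def cpx_times_cnj_power
    by (simp only: of_real_mult[symmetric] integral_complex_of_real of_real_divide of_real_numeral)
  then show ?thesis by (simp only: Re_complex_of_real)
qed

text \<open>If this moment vanished, all moments of the cosine and sine modes would vanish by the moment recurrence and
  rotation invariance, and the mode would be zero almost everywhere; but near the origin it is close to
  a nonzero multiple of \<open>z^m\<close>.\<close>

lemma mode_mass_nonzero:
  assumes R: "R > 0" and m: "m \<ge> 1" and k: "k > 0" and zero: "bessel_J (m - 1) (k * R) = 0"
  shows "mode_mass R m k \<noteq> 0"
proof
  assume mass: "mode_mass R m k = 0"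
  have AE0: "AE x in disc R. mode_part \<omega> m k x = 0" for \<omega>
  proof (rule AE_zero_if_moments_zero)
    show "integrable (disc R) (mode_part \<omega> m k)"
      by (intro integrable_continuous_disc continuous_on_mode_part)
    fix a b :: nat
    show "(\<integral>x. of_real (mode_part \<omega> m k x) * (cpx x ^ a * cnj (cpx x) ^ b) \<partial>disc R) = 0"
    proof (cases "a = b")
      case True
      then show ?thesis
        unfolding integral_mode_part[OF m]
        using radial_factor_integral_eq_0[where a = "a + m" and b = b and k = k and m = m and R = R]
          radial_factor_integral_eq_0[where a = a and b = "b + m" and k = k and m = m and R = R] m by simp
    next
      case False
      have mom: "moment R (mode_part \<omega> m k) m' l = 0" if "m' \<ge> 1" for m' l
      proof (rule zero_moments[OF mode_part_eigenspace[OF R m k zero] that])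
        show "moment R (mode_part \<omega> m k) m' 0 = 0"
          using moment_mode_part[OF m that, of R \<omega> k] mass by simp
      qed
      show ?thesis by (rule off_diagonal_zero_if_moments_zero[OF mom False])
    qed
  qed
  have "AE x in disc R. bessel_mode m k x = 0"
    using AE0[of 1] AE0[of "- \<i>"] by eventually_elim (simp add: mode_part_def complex_eq_iff)
  moreover have "isCont (\<lambda>x::real^2. clifford m (k\<^sup>2 / 4 * (norm x)\<^sup>2)) 0"
    using continuous_on_clifford[of UNIV "\<lambda>x::real^2. k\<^sup>2 / 4 * (norm x)\<^sup>2" m]
    by (simp add: continuous_on_eq_continuous_at continuous_intros)
  then obtain \<delta> where \<delta>: "\<delta> > 0"
    "\<And>x::real^2. dist x 0 < \<delta> \<Longrightarrow> dist (clifford m (k\<^sup>2 / 4 * (norm x)\<^sup>2)) (clifford m 0) < clifford m 0"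
    using clifford_pos_nonpos[of 0 m] unfolding continuous_at_eps_delta by force
  have nz: "bessel_mode m k x \<noteq> 0" if "x \<noteq> 0" "norm x < \<delta>" for x
  proof -
    have "clifford m (k\<^sup>2 / 4 * (norm x)\<^sup>2) \<noteq> 0"
      using \<delta>(2)[of x] that by (auto simp: dist_real_def)
    then show ?thesis using that k by (simp add: bessel_mode_def)
  qed
  \<comment> \<open>A nonempty open set on which the mode has no zero cannot be negligible.\<close>
  define S where "S = ball (0::real^2) (min \<delta> R) - {0}"
  have S: "open S" "S \<subseteq> ball 0 R" unfolding S_def by auto
  have "S \<noteq> {}"
  proof -
    obtain v :: "real^2" where "norm v = min \<delta> R / 2"
      using vector_choose_size[of "min \<delta> R / 2"] \<delta>(1) R by auto
    then have "v \<in> S" using \<delta>(1) R by (auto simp: S_def min_def split: if_splits)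
    then show ?thesis by blast
  qed
  moreover have "negligible S"
  proof -
    have "AE x in disc R. x \<notin> S"
      using \<open>AE x in disc R. bessel_mode m k x = 0\<close>
    proof eventually_elim
      case (elim x)
      then show ?case using nz[of x] by (auto simp: S_def)
    qed
    then have "AE x in lebesgue. x \<in> ball 0 R \<longrightarrow> x \<notin> S"
      by (simp add: AE_restrict_space_iff)
    then have "AE x in lebesgue. x \<notin> S"
      by eventually_elim (use S(2) in blast)
    then show ?thesis
      using S(1) by (simp add: negligible_iff_null_sets AE_iff_null_sets)
  qed
  ultimately show False
    using open_not_negligible[OF S(1)] by blast
qed

text \<open>Used in contrapositive form: a nonzero moment of frequency \<open>m \<ge> 1\<close> certifies that a function is not
  radial.\<close>

lemma radial_moment_zero:
  assumes f: "f \<in> borel_measurable (disc R)" and rad: "radial (ball 0 R) f" and m: "m \<ge> 1"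
  shows "moment R f m 0 = 0"
proof -
  obtain \<phi> where \<phi>: "AE x in disc R. f x = \<phi> (norm x)"
    using rad unfolding radial_def by blast
  have "(\<integral>x. of_real (f x) * (cpx x ^ m * cnj (cpx x) ^ 0) \<partial>disc R) = 0"
  proof (rule integral_off_diagonal_eq_0)
    show "AE x in disc R. complex_of_real (f (rot c x)) = of_real (f x)" if c: "cmod c = 1" for c
      using \<phi> AE_rot[OF c \<phi>] by eventually_elim (simp add: norm_rot[OF c])
  qed (use m f in auto)
  then show ?thesis by (simp add: moment_def monomial_def)
qed

lemma mode_part_nonradial_eigenfunction:
  assumes R: "R > 0" and m: "m \<ge> 1" and k: "k > 0" and zero: "bessel_J (m - 1) (k * R) = 0"
    and \<omega>: "\<omega> \<noteq> 0"
  shows "nonradial_eigenfunction (ball 0 R) (1 / k\<^sup>2) (mode_part \<omega> m k)"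
proof -
  have nz: "moment R (mode_part \<omega> m k) m 0 \<noteq> 0"
    using moment_mode_part[OF m m] mode_mass_nonzero[OF R m k zero] \<omega> by simp
  have "mode_part \<omega> m k \<in> borel_measurable (disc R)"
    by (rule borel_measurable_disc, rule borel_measurable_continuous_onI, rule continuous_on_mode_part)
  then have nr: "\<not> radial (ball 0 R) (mode_part \<omega> m k)"
    using radial_moment_zero[OF _ _ m] nz by blast
  then have "\<not> (AE x in disc R. mode_part \<omega> m k x = 0)"
    unfolding radial_def by (auto dest: spec[of _ "\<lambda>_. 0"])
  then show ?thesis
    using nr mode_part_eigenspace[OF R m k zero]
    by (simp add: nonradial_eigenfunction_def eigenfunction_def)
qed

lemma in_eigenspace_diff_scaled:
  assumes f: "in_eigenspace (ball 0 R) \<tau> f" and h: "in_eigenspace (ball 0 R) \<tau> h"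
  shows "in_eigenspace (ball 0 R) \<tau> (\<lambda>x. f x - c * h x)"
    and "moment R (\<lambda>x. f x - c * h x) m l = moment R f m l - of_real c * moment R h m l"
proof -
  have L2: "L2_fun (ball 0 R) f" "L2_fun (ball 0 R) h"
    using f h by (simp_all add: in_eigenspace_def)
  note i = L2_fun_integrable[OF L2(1)] L2_fun_integrable[OF L2(2)]
  have [measurable]: "f \<in> borel_measurable (disc R)" "h \<in> borel_measurable (disc R)"
    using L2 by (simp_all add: L2_fun_def)
  have "integrable (disc R) (\<lambda>x. (f x - c * h x)\<^sup>2)"
  proof (rule Bochner_Integration.integrable_bound)
    show "integrable (disc R) (\<lambda>x. 2 * (f x)\<^sup>2 + 2 * c\<^sup>2 * (h x)\<^sup>2)"
      using L2 by (simp add: L2_fun_def)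
    show "AE x in disc R. norm ((f x - c * h x)\<^sup>2) \<le> norm (2 * (f x)\<^sup>2 + 2 * c\<^sup>2 * (h x)\<^sup>2)"
    proof (rule AE_I2)
      fix x
      have "0 \<le> (f x + c * h x)\<^sup>2" by simp
      then have "(f x - c * h x)\<^sup>2 \<le> 2 * (f x)\<^sup>2 + 2 * c\<^sup>2 * (h x)\<^sup>2"
        by (simp add: power2_eq_square algebra_simps)
      moreover have "0 \<le> (f x - c * h x)\<^sup>2" by simp
      ultimately show "norm ((f x - c * h x)\<^sup>2) \<le> norm (2 * (f x)\<^sup>2 + 2 * c\<^sup>2 * (h x)\<^sup>2)"
        unfolding real_norm_def by linarith
    qed
  qed measurable
  then have "L2_fun (ball 0 R) (\<lambda>x. f x - c * h x)"
    unfolding L2_fun_def by simp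
  moreover have "AE x in disc R. log_potential (ball 0 R) (\<lambda>x. f x - c * h x) x = \<tau> * (f x - c * h x)"
  proof -
    have "AE x in disc R. log_potential (ball 0 R) f x = \<tau> * f x" "AE x in disc R. log_potential (ball 0 R) h x = \<tau> * h x"
      using f h by (simp_all add: in_eigenspace_def)
    then show ?thesis
      using AE_kernel_product_integrable[OF i(1)] AE_kernel_product_integrable[OF i(2)]
    proof eventually_elim
      case (elim x)
      have "(\<integral>y. log_kernel x y * (f y - c * h y) \<partial>disc R) = (\<integral>y. log_kernel x y * f y - c * (log_kernel x y * h y) \<partial>disc R)"
        by (simp add: algebra_simps)
      also have "\<dots> = (\<integral>y. log_kernel x y * f y \<partial>disc R) - c * (\<integral>y. log_kernel x y * h y \<partial>disc R)"
        using elim by (subst Bochner_Integration.integral_diff) auto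
      finally have "log_potential (ball 0 R) (\<lambda>x. f x - c * h x) x = log_potential (ball 0 R) f x - c * log_potential (ball 0 R) h x"
        unfolding log_potential_def log_kernel_def by (simp add: right_diff_distrib mult_ac)
      then show ?case using elim by (simp add: algebra_simps)
    qed
  qed
  ultimately show "in_eigenspace (ball 0 R) \<tau> (\<lambda>x. f x - c * h x)"
    by (simp add: in_eigenspace_def)
  have "moment R (\<lambda>x. f x - c * h x) m l = (\<integral>x. of_real (f x) * monomial m l x - of_real c * (of_real (h x) * monomial m l x) \<partial>disc R)"
    unfolding moment_def by (simp add: left_diff_distrib mult.assoc)
  also have "\<dots> = (\<integral>x. of_real (f x) * monomial m l x \<partial>disc R) - (\<integral>x. of_real c * (of_real (h x) * monomial m l x) \<partial>disc R)"
    by (rule Bochner_Integration.integral_diff)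
      (intro integrable_mult_right integrable_times_continuous i continuous_on_monomial)+
  finally show "moment R (\<lambda>x. f x - c * h x) m l = moment R f m l - of_real c * moment R h m l"
    unfolding moment_def integral_mult_right_zero .
qed

definition mode_combination ::
    "(nat \<Rightarrow> real) \<Rightarrow> (nat \<Rightarrow> real) \<Rightarrow> (nat \<Rightarrow> real) \<Rightarrow> nat set \<Rightarrow> real^2 \<Rightarrow> real" where
  "mode_combination k \<alpha> \<beta> S x =
    (\<Sum>m\<in>S. \<alpha> m * mode_part 1 m (k m) x + \<beta> m * mode_part (- \<i>) m (k m) x)"

text \<open>The leading moments of the cosine and sine modes of frequency \<open>m\<close> are \<open>U\<close> and \<open>\<i> U\<close> with a real
  \<open>U \<noteq> 0\<close>, while those of all other positive frequencies are zero; hence real coefficients suffice to cancel any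
  complex leading moment without disturbing the other frequencies.\<close>

lemma eigenspace_decomposition:
  fixes \<tau> :: real and f :: "real^2 \<Rightarrow> real"
  assumes f: "in_eigenspace (ball 0 R) \<tau> f" and S: "finite S" "S \<subseteq> {1..}"
    and k: "\<And>m. m \<in> S \<Longrightarrow> k m > 0 \<and> bessel_J (m - 1) (k m * R) = 0 \<and> 1 / (k m)\<^sup>2 = \<tau>" and R: "R > 0"
  shows "\<exists>\<alpha> \<beta>. in_eigenspace (ball 0 R) \<tau> (\<lambda>x. f x - mode_combination k \<alpha> \<beta> S x)
    \<and> (\<forall>m'\<ge>1. moment R (\<lambda>x. f x - mode_combination k \<alpha> \<beta> S x) m' 0
         = (if m' \<in> S then 0 else moment R f m' 0))"
  using S k
proof (induction S rule: finite_induct)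
  case empty
  then show ?case using f by (simp add: mode_combination_def)
next
  case (insert m S)
  have sub: "S \<subseteq> {1..}" using insert.prems(1) by simp
  have ks: "k j > 0 \<and> bessel_J (j - 1) (k j * R) = 0 \<and> 1 / (k j)\<^sup>2 = \<tau>" if "j \<in> S" for j
    using insert.prems(2)[of j] that by simp
  obtain \<alpha> \<beta> where IH: "in_eigenspace (ball 0 R) \<tau> (\<lambda>x. f x - mode_combination k \<alpha> \<beta> S x)"
    and IHm: "\<And>m'. m' \<ge> 1 \<Longrightarrow> moment R (\<lambda>x. f x - mode_combination k \<alpha> \<beta> S x) m' 0 = (if m' \<in> S then 0 else moment R f m' 0)"
    using insert.IH[OF sub ks] by blast
  let ?g = "\<lambda>x. f x - mode_combination k \<alpha> \<beta> S x"
  have m: "m \<ge> 1" and km: "k m > 0" "bessel_J (m - 1) (k m * R) = 0" "1 / (k m)\<^sup>2 = \<tau>"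
    using insert.prems(1) insert.prems(2)[of m] by simp_all
  define U where "U = Re (mode_mass R m (k m))"
  have mass: "mode_mass R m (k m) = of_real U"
    unfolding U_def by (rule mode_mass_real[symmetric])
  have U: "U \<noteq> 0"
    using mode_mass_nonzero[OF R m km(1,2)] mass by auto
  define A B where "A = Re (moment R f m 0) / U" and "B = Im (moment R f m 0) / U"
  note e1 = mode_part_eigenspace[OF R m km(1,2), of 1, unfolded km(3)]
  note e2 = mode_part_eigenspace[OF R m km(1,2), of "- \<i>", unfolded km(3)]
  note d1 = in_eigenspace_diff_scaled[OF IH e1, of A]
  note d2 = in_eigenspace_diff_scaled[OF d1(1) e2, of B]
  let ?h = "\<lambda>x. ?g x - A * mode_part 1 m (k m) x - B * mode_part (- \<i>) m (k m) x"
  let ?\<alpha> = "\<alpha>(m := A)" let ?\<beta> = "\<beta>(m := B)"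
  have h: "?h = (\<lambda>x. f x - mode_combination k ?\<alpha> ?\<beta> (insert m S) x)"
  proof
    fix x
    have "mode_combination k ?\<alpha> ?\<beta> S x = mode_combination k \<alpha> \<beta> S x"
      unfolding mode_combination_def by (rule sum.cong) (use insert.hyps in auto)
    moreover have "mode_combination k ?\<alpha> ?\<beta> (insert m S) x =
        A * mode_part 1 m (k m) x + B * mode_part (- \<i>) m (k m) x + mode_combination k ?\<alpha> ?\<beta> S x"
      unfolding mode_combination_def using insert.hyps by simp
    ultimately show "?h x = f x - mode_combination k ?\<alpha> ?\<beta> (insert m S) x"
      by simp
  qed
  have "moment R ?h m' 0 = (if m' \<in> insert m S then 0 else moment R f m' 0)" if m': "m' \<ge> 1" for m'
  proof -
    have eq: "moment R ?h m' 0 = (if m' \<in> S then 0 else moment R f m' 0)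
       - of_real A * (if m' = m then mode_mass R m (k m) else 0) - of_real B * (if m' = m then \<i> * mode_mass R m (k m) else 0)"
      unfolding d2(2) d1(2) IHm[OF m'] moment_mode_part[OF m m'] by simp
    show ?thesis
    proof (cases "m' = m")
      case True
      have "of_real A * of_real U + of_real B * (\<i> * of_real U) = moment R f m 0"
        using U by (simp add: A_def B_def complex_eq_iff)
      then show ?thesis
        using True insert.hyps unfolding eq mass by (simp add: algebra_simps)
    next
      case False
      then show ?thesis unfolding eq by simp
    qed
  qed
  then have "\<forall>m'\<ge>1. moment R ?h m' 0 = (if m' \<in> insert m S then 0 else moment R f m' 0)"
    by simp
  then show ?case
    using d2(1) unfolding h by (intro exI[of _ ?\<alpha>] exI[of _ ?\<beta>] conjI)
qed

theorem theoremA7: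
  fixes R :: real
  assumes "R > 0"
  shows "{\<tau>. nonradial_eigenvalue (ball 0 R) \<tau>} = {tau R m n | m n. m \<ge> 1 \<and> n \<ge> 1}
    \<and> (\<forall>m\<ge>1. \<forall>n\<ge>1. nonradial_eigenfunction (ball 0 R) (tau R m n) (u_fun R m n)
         \<and> nonradial_eigenfunction (ball 0 R) (tau R m n) (v_fun R m n))
    \<and> (\<forall>\<tau> f. nonradial_eigenfunction (ball 0 R) \<tau> f \<longrightarrow>
         (\<exists>g F a b. in_eigenspace (ball 0 R) \<tau> g \<and> radial (ball 0 R) g
            \<and> finite F \<and> F \<subseteq> {(m, n). m \<ge> 1 \<and> n \<ge> 1 \<and> tau R m n = \<tau>}
            \<and> (AE x in lebesgue_on (ball 0 R).
                 f x = g x + (\<Sum>(m, n)\<in>F. a m n * u_fun R m n x + b m n * v_fun R m n x))))"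
proof (intro conjI allI impI)
  define kk where "kk m n = bessel_zero (m - 1) n / R" for m n
  have u: "u_fun R m n = mode_part 1 m (kk m n)" for m n
    by (rule ext) (simp only: u_fun_eq mode_part_def kk_def)
  have v: "v_fun R m n = mode_part (- \<i>) m (kk m n)" for m n
    by (rule ext) (simp only: v_fun_eq mode_part_def kk_def)
  have kk: "kk m n > 0" "bessel_J (m - 1) (kk m n * R) = 0" "1 / (kk m n)\<^sup>2 = tau R m n" if "n \<ge> 1" for m n
    using bessel_zero[OF that, of "m - 1"] assms by (simp_all add: kk_def tau_def power_divide)
  have eig: "nonradial_eigenfunction (ball 0 R) (tau R m n) (u_fun R m n)"
      "nonradial_eigenfunction (ball 0 R) (tau R m n) (v_fun R m n)" if "m \<ge> 1" "n \<ge> 1" for m n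
    using mode_part_nonradial_eigenfunction[OF assms that(1) kk(1,2)[OF that(2)]] kk(3)[OF that(2), of m]
    unfolding u v by simp_all
  then show "nonradial_eigenfunction (ball 0 R) (tau R m n) (u_fun R m n)"
      "nonradial_eigenfunction (ball 0 R) (tau R m n) (v_fun R m n)" if "1 \<le> m" "1 \<le> n" for m n
    using that by blast+
  have nonzero: "\<exists>m\<ge>1. moment R f m 0 \<noteq> 0" if f: "in_eigenspace (ball 0 R) \<tau> f" "\<not> radial (ball 0 R) f" for \<tau> f
  proof (rule ccontr)
    assume "\<not> (\<exists>m\<ge>1. moment R f m 0 \<noteq> 0)"
    then have "moment R f m l = 0" if "m \<ge> 1" for m l
      using zero_moments[OF f(1) that] that by blast
    then have "radial (ball 0 R) f"
      using f(1) by (intro radial_if_moments_zero L2_fun_integrable) (simp_all add: in_eigenspace_def)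
    with f(2) show False by simp
  qed
  show "{\<tau>. nonradial_eigenvalue (ball 0 R) \<tau>} = {tau R m n | m n. m \<ge> 1 \<and> n \<ge> 1}"
  proof (intro equalityI subsetI)
    fix \<tau> assume "\<tau> \<in> {\<tau>. nonradial_eigenvalue (ball 0 R) \<tau>}"
    then obtain f where f: "in_eigenspace (ball 0 R) \<tau> f" "\<not> radial (ball 0 R) f"
      unfolding nonradial_eigenvalue_def nonradial_eigenfunction_def eigenfunction_def by blast
    then obtain m where m: "m \<ge> 1" "moment R f m 0 \<noteq> 0" using nonzero by blast
    then obtain n where "n \<ge> 1" "tau R m n = \<tau>"
      using nonzero_moment_eigenvalue[OF assms f(1)] by blast
    then show "\<tau> \<in> {tau R m n | m n. m \<ge> 1 \<and> n \<ge> 1}" using m(1) by blast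
  next
    fix \<tau> assume "\<tau> \<in> {tau R m n | m n. m \<ge> 1 \<and> n \<ge> 1}"
    then show "\<tau> \<in> {\<tau>. nonradial_eigenvalue (ball 0 R) \<tau>}"
      unfolding nonradial_eigenvalue_def using eig(1) by blast
  qed
  fix \<tau> f assume "nonradial_eigenfunction (ball 0 R) \<tau> f"
  then have f: "in_eigenspace (ball 0 R) \<tau> f"
    by (simp add: nonradial_eigenfunction_def eigenfunction_def)
  define S where "S = {m. m \<ge> 1 \<and> moment R f m 0 \<noteq> 0}"
  have S: "finite S" "S \<subseteq> {1..}"
    unfolding S_def by (rule finite_nonzero_moments[OF assms f]) auto
  have "\<forall>m\<in>S. \<exists>n\<ge>1. tau R m n = \<tau>"
    using nonzero_moment_eigenvalue[OF assms f] by (auto simp: S_def)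
  then obtain N where N: "\<And>m. m \<in> S \<Longrightarrow> N m \<ge> 1 \<and> tau R m (N m) = \<tau>"
    by metis
  have "kk m (N m) > 0 \<and> bessel_J (m - 1) (kk m (N m) * R) = 0 \<and> 1 / (kk m (N m))\<^sup>2 = \<tau>" if "m \<in> S" for m
    using kk[of "N m" m] N[OF that] by simp
  from eigenspace_decomposition[OF f S this assms]
  obtain \<alpha> \<beta> where
    g: "in_eigenspace (ball 0 R) \<tau> (\<lambda>x. f x - mode_combination (\<lambda>m. kk m (N m)) \<alpha> \<beta> S x)"
    and mg: "\<And>m'. m' \<ge> 1 \<Longrightarrow>
      moment R (\<lambda>x. f x - mode_combination (\<lambda>m. kk m (N m)) \<alpha> \<beta> S x) m' 0 =
        (if m' \<in> S then 0 else moment R f m' 0)"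
    by blast
  let ?g = "\<lambda>x. f x - mode_combination (\<lambda>m. kk m (N m)) \<alpha> \<beta> S x"
  have rad: "radial (ball 0 R) ?g"
  proof (rule ccontr)
    assume "\<not> radial (ball 0 R) ?g"
    then obtain m where "m \<ge> 1" "moment R ?g m 0 \<noteq> 0" using nonzero[OF g] by blast
    then show False using mg[of m] by (auto simp: S_def split: if_splits)
  qed
  define F where "F = (\<lambda>m. (m, N m)) ` S"
  have F: "finite F" "F \<subseteq> {(m, n). m \<ge> 1 \<and> n \<ge> 1 \<and> tau R m n = \<tau>}"
    using S N by (auto simp: F_def)
  have "(\<Sum>(m, n)\<in>F. \<alpha> m * u_fun R m n x + \<beta> m * v_fun R m n x) = mode_combination (\<lambda>m. kk m (N m)) \<alpha> \<beta> S x" for x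
    unfolding F_def mode_combination_def u v by (subst sum.reindex) (auto simp: inj_on_def)
  then have "AE x in disc R. f x = ?g x + (\<Sum>(m, n)\<in>F. \<alpha> m * u_fun R m n x + \<beta> m * v_fun R m n x)"
    by simp
  then show "\<exists>g F a b. in_eigenspace (ball 0 R) \<tau> g \<and> radial (ball 0 R) g
            \<and> finite F \<and> F \<subseteq> {(m, n). m \<ge> 1 \<and> n \<ge> 1 \<and> tau R m n = \<tau>}
            \<and> (AE x in lebesgue_on (ball 0 R).
                 f x = g x + (\<Sum>(m, n)\<in>F. a m n * u_fun R m n x + b m n * v_fun R m n x))"
    using g rad F by (intro exI[of _ ?g] exI[of _ F] exI[of _ "\<lambda>m n. \<alpha> m"] exI[of _ "\<lambda>m n. \<beta> m"] conjI)
qed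

end
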